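(* Let $s\ge 1$ and $n=2s$. Let $U$ be a left $K[C_n^{s,s+1}]$-module with basis $\{e_{i_1,\dots,i_{s-1}}: i_1,\dots,i_{s-1}\ge 0\}$. Assume that $(a_ia_j-a_ja_i)U=(a_ka_l-a_la_k)U=0$ for all $i,j<s$ and $k,l>s+1$. Assume also that for each $0\ne u\in U$ and all $i_1,\dots,i_{s-1}\ge 0$ there exists $x\in K\cdot C_n^{s,s+1}$ satisfying $xu=e_{i_1,\dots,i_{s-1}}$. Let $V$ be a $K$-linear space with basis $\{f_i: i\ge 0\}$. Then, for each $0\ne\lambda_s\in K$, the action of $a_1,\dots,a_n\in C_n$ on the $K$-linear space $W=U\otimes_K V$ with basis $\{e_{i_1,\dots,i_s}=e_{i_1,\dots,i_{s-1}}\otimes f_{i_s}: i_1,\dots,i_s\ge 0\}$ defined by $$a_je_{i_1,\dots,i_s}=\begin{cases} a_je_{i_1,\dots,i_{s-1}}\otimes f_{i_s+1} & \text{if } j<s,\\ \lambda_s e_{i_1,\dots,i_{s-1}}\otimes f_{i_s+1} & \text{if } j=s,\\ e_{i_1,\dots,i_{s-1}}\otimes f_{i_s-1} & \text{if } j=s+1 \text{ and } i_s>0,\\ a_je_{i_1,\dots,i_{s-1}}\otimes f_{i_s-1} & \text{if } j>s+1\text{ and } i_s>0,\\ 0 & \text{otherwise}\end{cases}$$ makes $W$ a left $K[C_n]$-module such that $(a_ia_j-a_ja_i)W=(a_ka_l-a_la_k)W=0$ for all $i,j\le s$ and $k,l>s$. Moreover, for each $0\ne w\in W$ and all $i_1,\dots,i_s\ge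 0$ there exists $x\in K\cdot C_n$ satisfying $xw=e_{i_1,\dots,i_s}$. In particular, $W$ is a simple left $K[C_n]$-module.
   Context: $K$ is a nondenumerable (uncountable) algebraically closed field. For a positive integer $n$, the Chinese monoid of rank $n$ is the monoid $C_n=\langle a_1,\dots,a_n\rangle$ given by the defining relations $a_ja_ka_i=a_ka_ja_i=a_ka_ia_j$ for all $i\le j\le k$; $K[C_n]$ is its monoid algebra. $C_n^{s,s+1}=\langle a_1,\dots,a_{s-1},a_{s+2},\dots,a_n\rangle\subseteq C_n$ is the submonoid generated by all generators except $a_s,a_{s+1}$; it is the Chinese monoid of rank $n-2$ on these generators (trivial monoid if $s=1$, in which case the basis of $U$ consists of a single vector with empty index). For a monoid $M$, $K\cdot M$ denotes the set of scalar multiples $\{\alpha w:\alpha\in K, w\in M\}\subseteq K[M]$. *)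

theory Defs
  imports
    "HOL-Algebra.Algebra"
    "HOL-Library.Countable_Set"
    "Jordan_Normal_Form.Missing_VectorSpace"
begin

subsection \<open>Monoids given by generators and relations\<close>

inductive monoid_cong :: "('g list \<times> 'g list) set \<Rightarrow> 'g list \<Rightarrow> 'g list \<Rightarrow> bool"
  for R :: "('g list \<times> 'g list) set" where
  rel: "(u, v) \<in> R \<Longrightarrow> monoid_cong R (x @ u @ y) (x @ v @ y)"
| refl: "monoid_cong R u u"
| sym: "monoid_cong R u v \<Longrightarrow> monoid_cong R v u"
| trans: "monoid_cong R u v \<Longrightarrow> monoid_cong R v w \<Longrightarrow> monoid_cong R u w"

definition word_rel :: "'g set \<Rightarrow> ('g list \<times> 'g list) set \<Rightarrow> ('g list \<times> 'g list) set" where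
  "word_rel G R = {(u, v). u \<in> lists G \<and> v \<in> lists G \<and> monoid_cong R u v}"

definition presented_monoid :: "'g set \<Rightarrow> ('g list \<times> 'g list) set \<Rightarrow> 'g list set monoid" where
  "presented_monoid G R =
    \<lparr>carrier = lists G // word_rel G R,
     monoid.mult = (\<lambda>A B. \<Union>u\<in>A. \<Union>v\<in>B. word_rel G R `` {u @ v}),
     one = word_rel G R `` {[]}\<rparr>"

definition chinese_rels :: "nat \<Rightarrow> (nat list \<times> nat list) set" where
  "chinese_rels n =
    {([j, k, i], [k, j, i]) | i j k. 1 \<le> i \<and> i \<le> j \<and> j \<le> k \<and> k \<le> n} \<union>
    {([k, j, i], [k, i, j]) | i j k. 1 \<le> i \<and> i \<le> j \<and> j \<le> k \<and> k \<le> n}"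

definition chinese_monoid :: "nat \<Rightarrow> nat list set monoid" where
  "chinese_monoid n = presented_monoid {1..n} (chinese_rels n)"

definition chinese_gen :: "nat \<Rightarrow> nat \<Rightarrow> nat list set" where
  "chinese_gen n j = word_rel {1..n} (chinese_rels n) `` {[j]}"

text \<open>The submonoid of the Chinese monoid generated by all generators except the
  \<open>s\<close>-th and the \<open>(s+1)\<close>-st one.\<close>

definition chinese_submonoid :: "nat \<Rightarrow> nat \<Rightarrow> nat list set monoid" where
  "chinese_submonoid n s = (chinese_monoid n)
    \<lparr>carrier := (\<lambda>H. submonoid H (chinese_monoid n)) hull
                 (chinese_gen n ` ({1..n} - {s, s + 1}))\<rparr>"


subsection \<open>Finitely supported functions and monoid algebras\<close>

definition finsupp :: "('a, 'b) ring_scheme \<Rightarrow> 'm set \<Rightarrow> ('m \<Rightarrow> 'a) set" where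
  "finsupp K S =
    {f. range f \<subseteq> carrier K \<and> {x. f x \<noteq> \<zero>\<^bsub>K\<^esub>} \<subseteq> S \<and> finite {x. f x \<noteq> \<zero>\<^bsub>K\<^esub>}}"

text \<open>\<open>monomial K \<alpha> m\<close> is the element \<open>\<alpha> m\<close> of a monoid algebra or of a free module.\<close>

definition monomial :: "('a, 'b) ring_scheme \<Rightarrow> 'a \<Rightarrow> 'm \<Rightarrow> 'm \<Rightarrow> 'a" where
  "monomial K \<alpha> m = (\<lambda>x. if x = m then \<alpha> else \<zero>\<^bsub>K\<^esub>)"

definition monoid_algebra ::
  "('a, 'b) ring_scheme \<Rightarrow> ('m, 'c) monoid_scheme \<Rightarrow> ('m \<Rightarrow> 'a) ring" where
  "monoid_algebra K M =
    \<lparr>carrier = finsupp K (carrier M),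
     monoid.mult = (\<lambda>f g x. \<Oplus>\<^bsub>K\<^esub> p \<in> {(y, z). f y \<noteq> \<zero>\<^bsub>K\<^esub> \<and> g z \<noteq> \<zero>\<^bsub>K\<^esub> \<and> y \<otimes>\<^bsub>M\<^esub> z = x}.
               f (fst p) \<otimes>\<^bsub>K\<^esub> g (snd p)),
     one = monomial K \<one>\<^bsub>K\<^esub> \<one>\<^bsub>M\<^esub>,
     ring.zero = (\<lambda>x. \<zero>\<^bsub>K\<^esub>),
     ring.add = (\<lambda>f g x. f x \<oplus>\<^bsub>K\<^esub> g x)\<rparr>"

text \<open>The set \<open>K \<cdot> M\<close> of scalar multiples of elements of \<open>M\<close>.\<close>

definition scalar_multiples ::
  "('a, 'b) ring_scheme \<Rightarrow> ('m, 'c) monoid_scheme \<Rightarrow> ('m \<Rightarrow> 'a) set" where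
  "scalar_multiples K M = {monomial K \<alpha> w | \<alpha> w. \<alpha> \<in> carrier K \<and> w \<in> carrier M}"

definition gen_elem :: "('a, 'b) ring_scheme \<Rightarrow> nat \<Rightarrow> nat \<Rightarrow> nat list set \<Rightarrow> 'a" where
  "gen_elem K n j = monomial K \<one>\<^bsub>K\<^esub> (chinese_gen n j)"


subsection \<open>Left modules\<close>

text \<open>The locale \<^locale>\<open>module\<close> of HOL-Algebra requires a commutative ring of scalars.\<close>

locale left_module = R?: ring R + M?: abelian_group M
  for R :: "('r, 'b) ring_scheme" (structure)
    and M :: "('r, 'm, 'c) module_scheme" (structure) +
  assumes smult_closed:
      "\<lbrakk>a \<in> carrier R; x \<in> carrier M\<rbrakk> \<Longrightarrow> a \<odot>\<^bsub>M\<^esub> x \<in> carrier M"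
    and smult_l_distr:
      "\<lbrakk>a \<in> carrier R; b \<in> carrier R; x \<in> carrier M\<rbrakk> \<Longrightarrow>
        (a \<oplus>\<^bsub>R\<^esub> b) \<odot>\<^bsub>M\<^esub> x = a \<odot>\<^bsub>M\<^esub> x \<oplus>\<^bsub>M\<^esub> b \<odot>\<^bsub>M\<^esub> x"
    and smult_r_distr:
      "\<lbrakk>a \<in> carrier R; x \<in> carrier M; y \<in> carrier M\<rbrakk> \<Longrightarrow>
        a \<odot>\<^bsub>M\<^esub> (x \<oplus>\<^bsub>M\<^esub> y) = a \<odot>\<^bsub>M\<^esub> x \<oplus>\<^bsub>M\<^esub> a \<odot>\<^bsub>M\<^esub> y"
    and smult_assoc:
      "\<lbrakk>a \<in> carrier R; b \<in> carrier R; x \<in> carrier M\<rbrakk> \<Longrightarrow>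
        (a \<otimes>\<^bsub>R\<^esub> b) \<odot>\<^bsub>M\<^esub> x = a \<odot>\<^bsub>M\<^esub> (b \<odot>\<^bsub>M\<^esub> x)"
    and smult_one:
      "x \<in> carrier M \<Longrightarrow> \<one>\<^bsub>R\<^esub> \<odot>\<^bsub>M\<^esub> x = x"

text \<open>\<^const>\<open>Module.submodule\<close> makes sense over any ring; its namesake in
  \<open>VectorSpace.LinearCombinations\<close> includes the commutativity of the ring.\<close>

definition simple_left_module ::
  "('r, 'b) ring_scheme \<Rightarrow> ('r, 'm, 'c) module_scheme \<Rightarrow> bool" where
  "simple_left_module R M \<longleftrightarrow>
    left_module R M \<and> carrier M \<noteq> {\<zero>\<^bsub>M\<^esub>} \<and>
    (\<forall>H. Module.submodule H R M \<longrightarrow> H = {\<zero>\<^bsub>M\<^esub>} \<or> H = carrier M)"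

text \<open>The same additive group with another scalar multiplication, possibly over another ring.\<close>

definition with_smult ::
  "('r, 'm, 'c) module_scheme \<Rightarrow> ('q \<Rightarrow> 'm \<Rightarrow> 'm) \<Rightarrow> ('q, 'm) module" where
  "with_smult M \<sigma> =
    \<lparr>carrier = carrier M, monoid.mult = monoid.mult M, one = one M,
     ring.zero = ring.zero M, ring.add = ring.add M,
     smult = \<sigma>\<rparr>"

text \<open>The \<open>K\<close>-linear space underlying a left module over the monoid algebra of \<open>M\<close>.\<close>

definition underlying_space ::
  "('a, 'b) ring_scheme \<Rightarrow> ('m, 'c) monoid_scheme \<Rightarrow> ('m \<Rightarrow> 'a, 'u, 'd) module_scheme
    \<Rightarrow> ('a, 'u) module" where
  "underlying_space K M U = with_smult U (\<lambda>\<alpha> u. monomial K \<alpha> \<one>\<^bsub>M\<^esub> \<odot>\<^bsub>U\<^esub> u)"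

definition basis_family ::
  "('a, 'b) ring_scheme \<Rightarrow> ('a, 'v, 'c) module_scheme \<Rightarrow> 'i set \<Rightarrow> ('i \<Rightarrow> 'v) \<Rightarrow> bool" where
  "basis_family K V I b \<longleftrightarrow> inj_on b I \<and> vectorspace.basis K V (b ` I)"


subsection \<open>Tensor products\<close>

text \<open>\<open>U \<otimes>\<^sub>K V\<close> is the quotient of the free \<open>K\<close>-module on \<open>U \<times> V\<close> by the
  submodule generated by the usual bilinearity relations.
  The fields \<open>mult\<close> and \<open>one\<close> of a module record play no role.\<close>

definition free_module :: "('a, 'b) ring_scheme \<Rightarrow> 's set \<Rightarrow> ('a, 's \<Rightarrow> 'a) module" where
  "free_module K S =
    \<lparr>carrier = finsupp K S, monoid.mult = undefined, one = undefined,
     ring.zero = (\<lambda>x. \<zero>\<^bsub>K\<^esub>), ring.add = (\<lambda>f g x. f x \<oplus>\<^bsub>K\<^esub> g x),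
     smult = (\<lambda>\<alpha> f x. \<alpha> \<otimes>\<^bsub>K\<^esub> f x)\<rparr>"

definition quotient_module ::
  "('a, 'm, 'c) module_scheme \<Rightarrow> 'm set \<Rightarrow> ('a, 'm set) module" where
  "quotient_module M N =
    \<lparr>carrier = a_rcosets\<^bsub>M\<^esub> N, monoid.mult = undefined, one = undefined,
     ring.zero = N, ring.add = set_add M,
     smult = (\<lambda>\<alpha> A. \<Union>x\<in>A. N +>\<^bsub>M\<^esub> (\<alpha> \<odot>\<^bsub>M\<^esub> x))\<rparr>"

definition tensor_rels ::
  "('a, 'b) ring_scheme \<Rightarrow> ('a, 'u, 'c) module_scheme \<Rightarrow> ('a, 'v, 'd) module_scheme
    \<Rightarrow> ('u \<times> 'v \<Rightarrow> 'a) set" where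
  "tensor_rels K U V =
    (let F = free_module K (carrier U \<times> carrier V); \<delta> = monomial K \<one>\<^bsub>K\<^esub> in
      {\<delta> (u \<oplus>\<^bsub>U\<^esub> u', v) \<ominus>\<^bsub>F\<^esub> (\<delta> (u, v) \<oplus>\<^bsub>F\<^esub> \<delta> (u', v)) | u u' v.
        u \<in> carrier U \<and> u' \<in> carrier U \<and> v \<in> carrier V} \<union>
      {\<delta> (u, v \<oplus>\<^bsub>V\<^esub> v') \<ominus>\<^bsub>F\<^esub> (\<delta> (u, v) \<oplus>\<^bsub>F\<^esub> \<delta> (u, v')) | u v v'.
        u \<in> carrier U \<and> v \<in> carrier V \<and> v' \<in> carrier V} \<union>
      {\<delta> (\<alpha> \<odot>\<^bsub>U\<^esub> u, v) \<ominus>\<^bsub>F\<^esub> \<alpha> \<odot>\<^bsub>F\<^esub> \<delta> (u, v) | \<alpha> u v.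
        \<alpha> \<in> carrier K \<and> u \<in> carrier U \<and> v \<in> carrier V} \<union>
      {\<delta> (u, \<alpha> \<odot>\<^bsub>V\<^esub> v) \<ominus>\<^bsub>F\<^esub> \<alpha> \<odot>\<^bsub>F\<^esub> \<delta> (u, v) | \<alpha> u v.
        \<alpha> \<in> carrier K \<and> u \<in> carrier U \<and> v \<in> carrier V})"

definition tensor_null ::
  "('a, 'b) ring_scheme \<Rightarrow> ('a, 'u, 'c) module_scheme \<Rightarrow> ('a, 'v, 'd) module_scheme
    \<Rightarrow> ('u \<times> 'v \<Rightarrow> 'a) set" where
  "tensor_null K U V =
    (\<lambda>H. Module.submodule H K (free_module K (carrier U \<times> carrier V))) hull tensor_rels K U V"

definition tensor_product ::
  "('a, 'b) ring_scheme \<Rightarrow> ('a, 'u, 'c) module_scheme \<Rightarrow> ('a, 'v, 'd) module_scheme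
    \<Rightarrow> ('a, ('u \<times> 'v \<Rightarrow> 'a) set) module" where
  "tensor_product K U V =
    quotient_module (free_module K (carrier U \<times> carrier V)) (tensor_null K U V)"

definition pure_tensor ::
  "('a, 'b) ring_scheme \<Rightarrow> ('a, 'u, 'c) module_scheme \<Rightarrow> ('a, 'v, 'd) module_scheme
    \<Rightarrow> 'u \<Rightarrow> 'v \<Rightarrow> ('u \<times> 'v \<Rightarrow> 'a) set" where
  "pure_tensor K U V u v =
    tensor_null K U V +>\<^bsub>free_module K (carrier U \<times> carrier V)\<^esub> monomial K \<one>\<^bsub>K\<^esub> (u, v)"


subsection \<open>The action on \<open>U \<otimes> V\<close>\<close>

text \<open>\<open>\<sigma>\<close> is a scalar multiplication turning the \<open>K\<close>-linear space \<open>U \<otimes>\<^sub>K V\<close> into a left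
  module over the algebra of the Chinese monoid (inducing the given \<open>K\<close>-linear structure), and the
  generators act on the vectors \<open>e I \<otimes> f i\<close> as prescribed.  The multi-index
  \<open>(i\<^sub>1, \<dots>, i\<^sub>s)\<close> is encoded as the list \<open>I\<close> of its first \<open>s - 1\<close> entries together with \<open>i = i\<^sub>s\<close>.\<close>

definition chinese_tensor_action ::
  "('a, 'b) ring_scheme \<Rightarrow> nat \<Rightarrow> nat \<Rightarrow> (nat list set \<Rightarrow> 'a, 'u, 'c) module_scheme
    \<Rightarrow> ('a, 'v, 'd) module_scheme \<Rightarrow> (nat list \<Rightarrow> 'u) \<Rightarrow> (nat \<Rightarrow> 'v) \<Rightarrow> 'a
    \<Rightarrow> ((nat list set \<Rightarrow> 'a) \<Rightarrow> ('u \<times> 'v \<Rightarrow> 'a) set \<Rightarrow> ('u \<times> 'v \<Rightarrow> 'a) set) \<Rightarrow> bool" where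
  "chinese_tensor_action K n s U V e f lam \<sigma> \<longleftrightarrow>
    (let U\<^sub>K = underlying_space K (chinese_submonoid n s) U;
         W = tensor_product K U\<^sub>K V;
         t = pure_tensor K U\<^sub>K V;
         a = gen_elem K n
     in
      left_module (monoid_algebra K (chinese_monoid n)) (with_smult W \<sigma>) \<and>
      (\<forall>\<alpha>\<in>carrier K. \<forall>w\<in>carrier W. \<sigma> (monomial K \<alpha> \<one>\<^bsub>chinese_monoid n\<^esub>) w = \<alpha> \<odot>\<^bsub>W\<^esub> w) \<and>
      (\<forall>I i. length I = s - 1 \<longrightarrow> (\<forall>j\<in>{1..n}.
        \<sigma> (a j) (t (e I) (f i)) =
          (if j < s then t (a j \<odot>\<^bsub>U\<^esub> e I) (f (i + 1))
           else if j = s then lam \<odot>\<^bsub>W\<^esub> t (e I) (f (i + 1))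
           else if j = s + 1 \<and> i > 0 then t (e I) (f (i - 1))
           else if j > s + 1 \<and> i > 0 then t (a j \<odot>\<^bsub>U\<^esub> e I) (f (i - 1))
           else \<zero>\<^bsub>W\<^esub>))))"

end

theory Submission
  imports Defs
begin

text \<open>
  Write \<open>x\<close> for the shift \<open>f\<^sub>i \<mapsto> f\<^sub>i\<^sub>+\<^sub>1\<close> of \<open>V\<close> and \<open>y\<close> for the shift \<open>f\<^sub>i \<mapsto> f\<^sub>i\<^sub>-\<^sub>1\<close>,
  \<open>f\<^sub>0 \<mapsto> 0\<close>, so that \<open>y x = 1\<close>. Put \<open>A\<^sub>s = \<lambda>\<^sub>s\<close> and \<open>A\<^sub>s\<^sub>+\<^sub>1 = 1\<close> on \<open>U\<close>, and let \<open>A\<^sub>j\<close> be the action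
  of \<open>a\<^sub>j\<close> otherwise. The prescribed operators are then \<open>T\<^sub>j = A\<^sub>j \<otimes> x\<close> for \<open>j \<le> s\<close> and
  \<open>T\<^sub>j = A\<^sub>j \<otimes> y\<close> for \<open>j > s\<close>.

  The \<open>A\<^sub>j\<close> commute among the indices \<open>\<le> s\<close> and among the indices \<open>> s\<close>, hence so do the \<open>T\<^sub>j\<close>;
  this settles the Chinese relations whose three indices lie on one side of \<open>s\<close>. In a relation with
  indices on both sides, \<open>y x = 1\<close> makes the factors on \<open>V\<close> of its three members equal
  (to \<open>x\<close> or to \<open>y\<close>), and what remains is the same relation for the \<open>A\<^sub>j\<close>. It follows from
  commutation, or is given on \<open>U\<close>, or is trivial because a scalar occurs (\<open>A_rel_low\<close>,
  \<open>A_rel_high\<close>, \<open>T_rels\<close>). A representation of the monoid extends linearly to its algebra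
  (\<open>representation_extends\<close>), and the values on the basis vectors determine the module
  (\<open>module_determined\<close>).

  For the transitivity, let \<open>w = u\<^sub>0 \<otimes> f\<^sub>0 + \<dots> + u\<^sub>m \<otimes> f\<^sub>m\<close> with \<open>u\<^sub>m \<noteq> 0\<close>. Then \<open>a\<^sub>s\<^sub>+\<^sub>1\<close> applied
  \<open>m\<close> times gives \<open>u\<^sub>m \<otimes> f\<^sub>0\<close> (\<open>reach_bottom\<close>). Some scalar multiple of a word in the
  generators other than \<open>a\<^sub>s, a\<^sub>s\<^sub>+\<^sub>1\<close> takes \<open>u\<^sub>m\<close> to the wanted basis vector of \<open>U\<close>. Raising the second
  factor by a power of \<open>a\<^sub>s\<close> beforehand leaves enough room for that word to act on \<open>W\<close> without
  being annihilated, and powers of \<open>a\<^sub>s\<^sub>+\<^sub>1\<close> and \<open>a\<^sub>s\<close> finally adjust the second factor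
  (\<open>word_pure\<close>, \<open>reach\<close>). The powers of \<open>\<lambda>\<^sub>s\<close> that appear are invertible. Since every
  nonzero submodule then contains a basis, simplicity follows (\<open>simple_if_reaches_basis\<close>).

  The linear algebra underneath rests on one construction, the linear extension \<open>lin_ext\<close> of a
  map from an index set to a module along finitely supported functions. It describes bases
  (\<open>basis_family_iff\<close>), gives the universal property of the tensor product
  (\<open>tensor_lift\<close>) and thereby the basis of \<open>U \<otimes> V\<close> (\<open>tensor_basis\<close>).
\<close>

section \<open>Finitely supported functions\<close>

lemma (in abelian_group) minus_eq_zeroD:
  assumes "x \<in> carrier G" "y \<in> carrier G" "x \<ominus> y = \<zero>"
  shows "x = y"
proof -
  have "x = x \<ominus> y \<oplus> y" using assms(1,2) by (simp add: minus_eq a_assoc l_neg)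
  with assms show ?thesis by simp
qed

lemma finsuppI:
  assumes "\<And>x. f x \<in> carrier R" "finite A" "A \<subseteq> S" "\<And>x. x \<notin> A \<Longrightarrow> f x = \<zero>\<^bsub>R\<^esub>"
  shows "f \<in> finsupp R S"
proof -
  have "{x. f x \<noteq> \<zero>\<^bsub>R\<^esub>} \<subseteq> A" using assms(4) by auto
  with assms show ?thesis unfolding finsupp_def by (auto intro: finite_subset)
qed

lemma finsuppD:
  assumes "f \<in> finsupp R S"
  shows "f x \<in> carrier R" "x \<notin> S \<Longrightarrow> f x = \<zero>\<^bsub>R\<^esub>" "finite {x. f x \<noteq> \<zero>\<^bsub>R\<^esub>}" "{x. f x \<noteq> \<zero>\<^bsub>R\<^esub>} \<subseteq> S"
  using assms unfolding finsupp_def by auto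

context ring
begin

lemma finsupp_zero: "(\<lambda>x. \<zero>) \<in> finsupp R S"
  by (rule finsuppI[of _ _ "{}"]) auto

lemma finsupp_monomial: "a \<in> carrier R \<Longrightarrow> x \<in> S \<Longrightarrow> monomial R a x \<in> finsupp R S"
  by (rule finsuppI[of _ _ "{x}"]) (auto simp: monomial_def)

lemma finsupp_add:
  assumes "f \<in> finsupp R S" "g \<in> finsupp R S"
  shows "(\<lambda>x. f x \<oplus> g x) \<in> finsupp R S"
  by (rule finsuppI[of _ _ "{x. f x \<noteq> \<zero>} \<union> {x. g x \<noteq> \<zero>}"])
    (use finsuppD[OF assms(1)] finsuppD[OF assms(2)] in auto)

lemma finsupp_smult:
  assumes "a \<in> carrier R" "f \<in> finsupp R S"
  shows "(\<lambda>x. a \<otimes> f x) \<in> finsupp R S"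
  by (rule finsuppI[of _ _ "{x. f x \<noteq> \<zero>}"]) (use finsuppD[OF assms(2)] assms(1) in auto)

lemma finsupp_uminus:
  assumes "f \<in> finsupp R S"
  shows "(\<lambda>x. \<ominus> f x) \<in> finsupp R S"
  by (rule finsuppI[of _ _ "{x. f x \<noteq> \<zero>}"]) (use finsuppD[OF assms] in auto)

text \<open>Proofs about finitely supported functions reduce to monomials: split off one point of the support
  at a time.\<close>
lemma finsupp_induct [consumes 1, case_names zero monomial add]:
  assumes "h \<in> finsupp R S"
    and "P (\<lambda>x. \<zero>)"
    and "\<And>a x. a \<in> carrier R \<Longrightarrow> x \<in> S \<Longrightarrow> P (monomial R a x)"
    and "\<And>f g. f \<in> finsupp R S \<Longrightarrow> g \<in> finsupp R S \<Longrightarrow> P f \<Longrightarrow> P g \<Longrightarrow> P (\<lambda>x. f x \<oplus> g x)"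
  shows "P h"
proof -
  have "\<forall>h. h \<in> finsupp R S \<longrightarrow> {x. h x \<noteq> \<zero>} \<subseteq> A \<longrightarrow> P h" if "finite A" "A \<subseteq> S" for A
    using that
  proof (induction A)
    case empty
    have "h = (\<lambda>x. \<zero>)" if "{x. h x \<noteq> \<zero>} \<subseteq> {}" for h :: "'c \<Rightarrow> 'a" using that by auto
    then show ?case using assms(2) by metis
  next
    case (insert y A)
    show ?case
    proof (intro allI impI)
      fix h assume h: "h \<in> finsupp R S" "{x. h x \<noteq> \<zero>} \<subseteq> insert y A"
      let ?h = "\<lambda>x. if x = y then \<zero> else h x"
      have 1: "?h \<in> finsupp R S"
        by (rule finsuppI[of _ _ "{x. h x \<noteq> \<zero>}"]) (use finsuppD[OF h(1)] in auto)
      have "{x. ?h x \<noteq> \<zero>} \<subseteq> A" using h(2) by auto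
      then have "P ?h" using insert.IH insert.prems 1 by blast
      moreover have "y \<in> S" using insert by auto
      moreover have "h = (\<lambda>x. monomial R (h y) y x \<oplus> ?h x)"
        by (rule ext) (use finsuppD[OF h(1)] in \<open>simp add: monomial_def\<close>)
      ultimately show "P h"
        using assms(3)[of "h y" y] assms(4)[of "monomial R (h y) y" ?h] 1 finsuppD(1)[OF h(1)]
          finsupp_monomial[of "h y" y S] by auto
    qed
  qed
  with finsuppD(3,4)[OF assms(1)] assms(1) show ?thesis by blast
qed

end

lemma free_module_simps [simp]:
  "carrier (free_module R S) = finsupp R S"
  "\<zero>\<^bsub>free_module R S\<^esub> = (\<lambda>x. \<zero>\<^bsub>R\<^esub>)"
  "f \<oplus>\<^bsub>free_module R S\<^esub> g = (\<lambda>x. f x \<oplus>\<^bsub>R\<^esub> g x)"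
  "a \<odot>\<^bsub>free_module R S\<^esub> f = (\<lambda>x. a \<otimes>\<^bsub>R\<^esub> f x)"
  by (simp_all add: free_module_def)

lemma (in cring) free_module_is_module: "module R (free_module R S)"
proof (rule moduleI)
  have c: "f x \<in> carrier R" if "f \<in> finsupp R S" for f :: "'c \<Rightarrow> 'a" and x
    using finsuppD(1)[OF that] .
  show "abelian_group (free_module R S)"
  proof (rule abelian_groupI)
    fix f assume "f \<in> carrier (free_module R S)"
    then have "f \<in> finsupp R S" by simp
    then show "\<exists>y\<in>carrier (free_module R S). y \<oplus>\<^bsub>free_module R S\<^esub> f = \<zero>\<^bsub>free_module R S\<^esub>"
      using c[of f] by (intro bexI[of _ "\<lambda>x. \<ominus> f x"]) (simp_all add: finsupp_uminus l_neg)
  next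
    fix f g h
    assume "f \<in> carrier (free_module R S)" "g \<in> carrier (free_module R S)"
      "h \<in> carrier (free_module R S)"
    then show "f \<oplus>\<^bsub>free_module R S\<^esub> g \<oplus>\<^bsub>free_module R S\<^esub> h =
        f \<oplus>\<^bsub>free_module R S\<^esub> (g \<oplus>\<^bsub>free_module R S\<^esub> h)"
      by (auto simp: c a_assoc)
  next
    fix f g assume "f \<in> carrier (free_module R S)" "g \<in> carrier (free_module R S)"
    then show "f \<oplus>\<^bsub>free_module R S\<^esub> g = g \<oplus>\<^bsub>free_module R S\<^esub> f"
      using finsuppD(1)[of f R S] finsuppD(1)[of g R S] by (auto intro: a_comm)
  qed (simp_all add: finsupp_zero finsupp_add c)
  fix a b f g
  assume "a \<in> carrier R" "b \<in> carrier R" "f \<in> carrier (free_module R S)"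
  then show "(a \<oplus> b) \<odot>\<^bsub>free_module R S\<^esub> f =
      a \<odot>\<^bsub>free_module R S\<^esub> f \<oplus>\<^bsub>free_module R S\<^esub> b \<odot>\<^bsub>free_module R S\<^esub> f"
    "(a \<otimes> b) \<odot>\<^bsub>free_module R S\<^esub> f = a \<odot>\<^bsub>free_module R S\<^esub> (b \<odot>\<^bsub>free_module R S\<^esub> f)"
    by (simp_all add: c l_distr m_assoc)
next
  fix a f g
  assume "a \<in> carrier R" "f \<in> carrier (free_module R S)" "g \<in> carrier (free_module R S)"
  then show "a \<odot>\<^bsub>free_module R S\<^esub> (f \<oplus>\<^bsub>free_module R S\<^esub> g) =
      a \<odot>\<^bsub>free_module R S\<^esub> f \<oplus>\<^bsub>free_module R S\<^esub> a \<odot>\<^bsub>free_module R S\<^esub> g"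
    using finsuppD(1)[of f R S] finsuppD(1)[of g R S] by (simp add: r_distr)
next
  fix f assume "f \<in> carrier (free_module R S)"
  then show "\<one> \<odot>\<^bsub>free_module R S\<^esub> f = f"
    using finsuppD(1)[of f R S] by simp
qed (simp_all add: finsupp_smult is_cring)

lemma (in cring) smult_monomial:
  assumes "a \<in> carrier R" "b \<in> carrier R"
  shows "(\<lambda>x. a \<otimes> monomial R b m x) = monomial R (a \<otimes> b) m"
  using assms by (auto simp: monomial_def)

lemma (in ring) add_monomial:
  "(\<lambda>x. monomial R a m x \<oplus> monomial R b m x) = monomial R (a \<oplus> b) m"
  by (auto simp: monomial_def)

section \<open>Linear maps\<close>

lemma module_homI:
  assumes "\<And>x. x \<in> carrier M \<Longrightarrow> h x \<in> carrier N"
    and "\<And>x y. x \<in> carrier M \<Longrightarrow> y \<in> carrier M \<Longrightarrow> h (x \<oplus>\<^bsub>M\<^esub> y) = h x \<oplus>\<^bsub>N\<^esub> h y"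
    and "\<And>a x. a \<in> carrier R \<Longrightarrow> x \<in> carrier M \<Longrightarrow> h (a \<odot>\<^bsub>M\<^esub> x) = a \<odot>\<^bsub>N\<^esub> h x"
  shows "h \<in> module_hom R M N"
  using assms unfolding module_hom_def by auto

lemma module_hom_in: "h \<in> module_hom R M N \<Longrightarrow> x \<in> carrier M \<Longrightarrow> h x \<in> carrier N"
  using module_hom_closed by blast

lemma module_hom_id: "(\<lambda>x. x) \<in> module_hom R M M"
  by (rule module_homI) auto

lemma module_hom_comp:
  assumes "h \<in> module_hom R M N" "k \<in> module_hom R N L"
  shows "(\<lambda>x. k (h x)) \<in> module_hom R M L"
  by (rule module_homI)
    (simp_all add: module_hom_in[OF assms(1)] module_hom_in[OF assms(2)]
      module_hom_add[OF assms(1)] module_hom_add[OF assms(2)]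
      module_hom_smult[OF assms(1)] module_hom_smult[OF assms(2)])

lemma module_hom_zero:
  assumes "module R M" "module R N" "h \<in> module_hom R M N"
  shows "h \<zero>\<^bsub>M\<^esub> = \<zero>\<^bsub>N\<^esub>"
proof -
  interpret mod_hom R M N h using assms by (auto simp: mod_hom_def mod_hom_axioms_def)
  show ?thesis by (rule f0_is_0)
qed

lemma foldr_module_hom:
  assumes "\<And>j. j \<in> set u \<Longrightarrow> T j \<in> module_hom K M M"
  shows "foldr T u \<in> module_hom K M M"
  using assms
proof (induction u)
  case Nil
  show ?case by (rule module_homI) simp_all
next
  case (Cons j u)
  have "(\<lambda>x. T j (foldr T u x)) \<in> module_hom K M M"
    by (rule module_hom_comp[of _ _ _ M]) (use Cons in auto)
  then show ?case by (simp add: comp_def)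
qed

lemma module_hom_cong:
  assumes "h \<in> module_hom K M N" "\<And>x. x \<in> carrier M \<Longrightarrow> k x = h x" "module K M"
  shows "k \<in> module_hom K M N"
proof -
  interpret module K M by fact
  show ?thesis
    by (rule module_homI)
      (simp_all add: assms(2) module_hom_in[OF assms(1)] module_hom_add[OF assms(1)]
        module_hom_smult[OF assms(1)])
qed

lemma module_hom_smult_const:
  assumes "module R M" "a \<in> carrier R"
  shows "(\<lambda>x. a \<odot>\<^bsub>M\<^esub> x) \<in> module_hom R M M"
proof -
  interpret module R M by fact
  show ?thesis using assms(2)
    by (intro module_homI) (auto simp: smult_r_distr smult_assoc1[symmetric] m_comm)
qed

text \<open>Used with the zero map, this exhibits kernels as submodules.\<close>
lemma module_homs_agree_submodule:
  assumes "module R M" "module R N" "h \<in> module_hom R M N" "k \<in> module_hom R M N"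
  shows "Module.submodule {x \<in> carrier M. h x = k x} R M"
proof -
  interpret M: module R M by fact
  interpret N: module R N by fact
  interpret h: mod_hom R M N h using assms by (auto simp: mod_hom_def mod_hom_axioms_def)
  interpret k: mod_hom R M N k using assms by (auto simp: mod_hom_def mod_hom_axioms_def)
  show ?thesis
    by (rule M.submoduleI) auto
qed

section \<open>Linear extension and bases\<close>

text \<open>The value at \<open>f\<close> of the linear map on the free module that sends the \<open>i\<close>-th basis vector to \<open>g i\<close>.\<close>
definition lin_ext ::
  "('a, 'b) ring_scheme \<Rightarrow> ('a, 'm, 'c) module_scheme \<Rightarrow> ('i \<Rightarrow> 'm) \<Rightarrow> ('i \<Rightarrow> 'a) \<Rightarrow> 'm" where
  "lin_ext R M g f = (\<Oplus>\<^bsub>M\<^esub>i\<in>{i. f i \<noteq> \<zero>\<^bsub>R\<^esub>}. f i \<odot>\<^bsub>M\<^esub> g i)"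

context module
begin

text \<open>Two finitely supported functions have different supports; their values can be compared after
  enlarging both sums to a common index set.\<close>
lemma lin_ext_superset:
  assumes "f \<in> finsupp R S" "g \<in> S \<rightarrow> carrier M" "finite A" "{i. f i \<noteq> \<zero>} \<subseteq> A" "A \<subseteq> S"
  shows "lin_ext R M g f = (\<Oplus>\<^bsub>M\<^esub>i\<in>A. f i \<odot>\<^bsub>M\<^esub> g i)"
  unfolding lin_ext_def using assms finsuppD(1)[OF assms(1)]
  by (intro M.add.finprod_mono_neutral_cong_left) (auto simp: Pi_def)

lemma lin_ext_monomial:
  assumes "a \<in> carrier R" "x \<in> S" "g \<in> S \<rightarrow> carrier M"
  shows "lin_ext R M g (monomial R a x) = a \<odot>\<^bsub>M\<^esub> g x"
proof -
  have "lin_ext R M g (monomial R a x) = (\<Oplus>\<^bsub>M\<^esub>i\<in>{x}. monomial R a x i \<odot>\<^bsub>M\<^esub> g i)"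
    using assms by (intro lin_ext_superset[of _ S] finsupp_monomial) (auto simp: monomial_def)
  also have "\<dots> = a \<odot>\<^bsub>M\<^esub> g x"
    using assms by (simp add: monomial_def Pi_iff)
  finally show ?thesis .
qed

lemma lin_ext_one:
  assumes "x \<in> S" "g \<in> S \<rightarrow> carrier M"
  shows "lin_ext R M g (monomial R \<one> x) = g x"
  using assms by (simp add: lin_ext_monomial[OF R.one_closed assms] Pi_iff)

lemma lin_ext_hom:
  assumes g: "g \<in> S \<rightarrow> carrier M"
  shows "lin_ext R M g \<in> module_hom R (free_module R S) M"
proof (rule module_homI)
  fix f assume "f \<in> carrier (free_module R S)"
  then have f: "f \<in> finsupp R S" by simp
  from f g finsuppD[OF f] show "lin_ext R M g f \<in> carrier M"
    unfolding lin_ext_def by (intro M.finsum_closed) (auto simp: Pi_def)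
  fix a assume a: "a \<in> carrier R"
  have 1: "finite {i. f i \<noteq> \<zero>}" "{i. f i \<noteq> \<zero>} \<subseteq> S" using finsuppD[OF f] by auto
  have "lin_ext R M g (\<lambda>x. a \<otimes> f x) = (\<Oplus>\<^bsub>M\<^esub>i\<in>{i. f i \<noteq> \<zero>}. (a \<otimes> f i) \<odot>\<^bsub>M\<^esub> g i)"
    using a 1 by (intro lin_ext_superset[OF finsupp_smult[OF a f] g]) auto
  also have "\<dots> = (\<Oplus>\<^bsub>M\<^esub>i\<in>{i. f i \<noteq> \<zero>}. a \<odot>\<^bsub>M\<^esub> (f i \<odot>\<^bsub>M\<^esub> g i))"
    using g 1(2) finsuppD(1)[OF f] a
    by (intro M.finsum_cong') (auto intro!: smult_assoc1 smult_closed)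
  also have "\<dots> = a \<odot>\<^bsub>M\<^esub> lin_ext R M g f" unfolding lin_ext_def
    using g 1 finsuppD(1)[OF f] a
    by (intro finsum_smult_ldistr[symmetric]) (auto intro!: smult_closed)
  finally show "lin_ext R M g (a \<odot>\<^bsub>free_module R S\<^esub> f) = a \<odot>\<^bsub>M\<^esub> lin_ext R M g f" by simp
next
  fix f h assume "f \<in> carrier (free_module R S)" "h \<in> carrier (free_module R S)"
  then have f: "f \<in> finsupp R S" and h: "h \<in> finsupp R S" by auto
  define A where "A = {i. f i \<noteq> \<zero>} \<union> {i. h i \<noteq> \<zero>}"
  have A: "finite A" "A \<subseteq> S" using finsuppD(3,4)[OF f] finsuppD(3,4)[OF h] by (auto simp: A_def)
  have "lin_ext R M g (\<lambda>x. f x \<oplus> h x) = (\<Oplus>\<^bsub>M\<^esub>i\<in>A. (f i \<oplus> h i) \<odot>\<^bsub>M\<^esub> g i)"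
    by (intro lin_ext_superset[OF finsupp_add[OF f h] g A(1) _ A(2)]) (auto simp: A_def)
  also have "\<dots> = (\<Oplus>\<^bsub>M\<^esub>i\<in>A. f i \<odot>\<^bsub>M\<^esub> g i \<oplus>\<^bsub>M\<^esub> h i \<odot>\<^bsub>M\<^esub> g i)"
    using g A(2) finsuppD(1)[OF f] finsuppD(1)[OF h]
    by (intro M.finsum_cong') (auto simp: smult_l_distr Pi_iff subset_iff)
  also have "\<dots> = (\<Oplus>\<^bsub>M\<^esub>i\<in>A. f i \<odot>\<^bsub>M\<^esub> g i) \<oplus>\<^bsub>M\<^esub> (\<Oplus>\<^bsub>M\<^esub>i\<in>A. h i \<odot>\<^bsub>M\<^esub> g i)"
    using g A finsuppD(1)[OF f] finsuppD(1)[OF h]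
    by (intro M.finsum_addf) (auto simp: Pi_iff subset_iff)
  also have "\<dots> = lin_ext R M g f \<oplus>\<^bsub>M\<^esub> lin_ext R M g h"
    using lin_ext_superset[OF f g A(1) _ A(2)] lin_ext_superset[OF h g A(1) _ A(2)]
    by (auto simp: A_def)
  finally show "lin_ext R M g (f \<oplus>\<^bsub>free_module R S\<^esub> h) = lin_ext R M g f \<oplus>\<^bsub>M\<^esub> lin_ext R M g h"
    by simp
qed

lemma free_module_hom_eqI:
  assumes "h \<in> module_hom R (free_module R S) M" "k \<in> module_hom R (free_module R S) M"
    and "\<And>x. x \<in> S \<Longrightarrow> h (monomial R \<one> x) = k (monomial R \<one> x)"
    and "f \<in> finsupp R S"
  shows "h f = k f"
  using assms(4)
proof (induction rule: finsupp_induct)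
  case zero
  interpret F: module R "free_module R S" by (rule free_module_is_module)
  show ?case using module_hom_zero[OF F.module_axioms module_axioms assms(1)]
      module_hom_zero[OF F.module_axioms module_axioms assms(2)] by simp
next
  case (monomial a x)
  have "monomial R a x = a \<odot>\<^bsub>free_module R S\<^esub> monomial R \<one> x"
    using monomial by (simp add: smult_monomial)
  then show ?case
    using module_hom_smult[OF assms(1) monomial(1)] module_hom_smult[OF assms(2) monomial(1)]
      assms(3)[OF monomial(2)] finsupp_monomial[OF R.one_closed monomial(2)] by simp
next
  case (add f g)
  then show ?case using module_hom_add[OF assms(1)] module_hom_add[OF assms(2)] by simp
qed

text \<open>Linear combinations over a set of vectors and over an injective family of vectors are the same thing.
  This connects the set-based notions of span and independence with \<open>lin_ext\<close>.\<close>
lemma lincomb_eq_lin_ext: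
  assumes b: "b \<in> I \<rightarrow> carrier M" "inj_on b I"
    and A: "A \<subseteq> b ` I" "finite A" "a \<in> A \<rightarrow> carrier R"
    and f: "f = (\<lambda>i. if i \<in> I \<and> b i \<in> A then a (b i) else \<zero>)"
  shows "f \<in> finsupp R I" "lincomb a A = lin_ext R M b f"
proof -
  let ?J = "{i \<in> I. b i \<in> A}"
  have bJ: "b ` ?J = A" using A(1) by auto
  have inj: "inj_on b ?J" using b(2) by (auto simp: inj_on_def)
  have fin: "finite ?J" using bJ A(2) inj finite_imageD by metis
  show f': "f \<in> finsupp R I"
    by (rule finsuppI[of _ _ ?J]) (use A(3) fin f in auto)
  have "lin_ext R M b f = (\<Oplus>\<^bsub>M\<^esub>i\<in>?J. f i \<odot>\<^bsub>M\<^esub> b i)"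
    by (rule lin_ext_superset[OF f' b(1) fin]) (auto simp: f)
  also have "\<dots> = (\<Oplus>\<^bsub>M\<^esub>i\<in>?J. a (b i) \<odot>\<^bsub>M\<^esub> b i)"
    using A(3) b(1) by (intro M.finsum_cong') (auto simp: f intro!: smult_closed)
  also have "\<dots> = (\<Oplus>\<^bsub>M\<^esub>v\<in>b ` ?J. a v \<odot>\<^bsub>M\<^esub> v)"
    using A(3) b(1) inj by (intro M.finsum_reindex[symmetric]) (auto intro!: smult_closed)
  finally show "lincomb a A = lin_ext R M b f" unfolding lincomb_def bJ by simp
qed

end

text \<open>Surjectivity of \<open>lin_ext\<close> is spanning, injectivity is independence together with
  injectivity of the family.\<close>
lemma (in vectorspace) basis_family_iff:
  "basis_family K V I b \<longleftrightarrow>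
    b \<in> I \<rightarrow> carrier V \<and> bij_betw (lin_ext K V b) (finsupp K I) (carrier V)"
proof -
  interpret F: module K "free_module K I" by (rule free_module_is_module)
  have one_zero: "\<one>\<^bsub>K\<^esub> \<noteq> \<zero>\<^bsub>K\<^esub>" by simp
  have as_lincomb: "\<exists>a. a \<in> b ` {i. f i \<noteq> \<zero>\<^bsub>K\<^esub>} \<rightarrow> carrier K \<and> finite (b ` {i. f i \<noteq> \<zero>\<^bsub>K\<^esub>}) \<and>
       b ` {i. f i \<noteq> \<zero>\<^bsub>K\<^esub>} \<subseteq> b ` I \<and>
       lincomb a (b ` {i. f i \<noteq> \<zero>\<^bsub>K\<^esub>}) = lin_ext K V b f \<and> (\<forall>i\<in>I. a (b i) = f i)"
    if b: "b \<in> I \<rightarrow> carrier V" "inj_on b I" and f: "f \<in> finsupp K I" for f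
  proof (intro exI conjI ballI)
    note fd = finsuppD[OF f]
    let ?A = "b ` {i. f i \<noteq> \<zero>\<^bsub>K\<^esub>}"
    show 1: "(\<lambda>v. f (inv_into I b v)) \<in> ?A \<rightarrow> carrier K" using fd by auto
    show 2: "finite ?A" using fd by auto
    show 3: "?A \<subseteq> b ` I" using fd by auto
    show 4: "f (inv_into I b (b i)) = f i" if "i \<in> I" for i
      using that b(2) by simp
    have *: "f = (\<lambda>i. if i \<in> I \<and> b i \<in> ?A then f (inv_into I b (b i)) else \<zero>\<^bsub>K\<^esub>)"
      using fd 4 by (auto simp: fun_eq_iff)
    show "lincomb (\<lambda>v. f (inv_into I b v)) ?A = lin_ext K V b f"
      by (rule lincomb_eq_lin_ext(2)[OF b 3 2 1 *])
  qed
  show ?thesis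
  proof
    assume "basis_family K V I b"
    then have inj: "inj_on b I" and li: "lin_indpt (b ` I)" and gen: "span (b ` I) = carrier V"
      and b: "b \<in> I \<rightarrow> carrier V"
      by (auto simp: basis_family_def basis_def)
    note hom = lin_ext_hom[OF b]
    interpret h: mod_hom K "free_module K I" V "lin_ext K V b"
      using hom by (simp add: mod_hom_def mod_hom_axioms_def F.module_axioms module_axioms)
    have ker: "f = (\<lambda>x. \<zero>\<^bsub>K\<^esub>)" if f: "f \<in> finsupp K I" "lin_ext K V b f = \<zero>\<^bsub>V\<^esub>" for f
    proof (rule ccontr)
      assume "f \<noteq> (\<lambda>x. \<zero>\<^bsub>K\<^esub>)"
      then obtain i where i: "f i \<noteq> \<zero>\<^bsub>K\<^esub>" by auto
      then have "i \<in> I" using finsuppD[OF f(1)] by auto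
      moreover obtain a where "a \<in> b ` {i. f i \<noteq> \<zero>\<^bsub>K\<^esub>} \<rightarrow> carrier K"
        "finite (b ` {i. f i \<noteq> \<zero>\<^bsub>K\<^esub>})" "b ` {i. f i \<noteq> \<zero>\<^bsub>K\<^esub>} \<subseteq> b ` I"
        "lincomb a (b ` {i. f i \<noteq> \<zero>\<^bsub>K\<^esub>}) = lin_ext K V b f" "\<forall>i\<in>I. a (b i) = f i"
        using as_lincomb[OF b inj f(1)] by (elim exE conjE)
      ultimately have "lin_dep (b ` I)"
        using f(2) i by (intro lin_dep_crit[of "b ` {i. f i \<noteq> \<zero>\<^bsub>K\<^esub>}" _ a "b i"]) auto
      with li show False by contradiction
    qed
    have "inj_on (lin_ext K V b) (finsupp K I)"
    proof (rule inj_onI)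
      fix f g assume fg: "f \<in> finsupp K I" "g \<in> finsupp K I" "lin_ext K V b f = lin_ext K V b g"
      then have "lin_ext K V b (f \<ominus>\<^bsub>free_module K I\<^esub> g) = \<zero>\<^bsub>V\<^esub>"
        using h.f_minus[of f g] module_hom_in[OF hom, of g] by (simp add: M.r_neg M.minus_eq)
      moreover have "f \<ominus>\<^bsub>free_module K I\<^esub> g \<in> finsupp K I" using fg F.minus_closed by simp
      ultimately have "f \<ominus>\<^bsub>free_module K I\<^esub> g = \<zero>\<^bsub>free_module K I\<^esub>" using ker by simp
      then show "f = g" using fg F.M.minus_eq_zeroD[of f g] by simp
    qed
    moreover have "carrier V \<subseteq> lin_ext K V b ` finsupp K I"
    proof
      fix v assume "v \<in> carrier V"
      then have "v \<in> span (b ` I)" using gen by simp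
      then obtain a A where "v = lincomb a A" "finite A" "A \<subseteq> b ` I" "a \<in> A \<rightarrow> carrier K"
        unfolding span_def by auto
      then show "v \<in> lin_ext K V b ` finsupp K I"
        using lincomb_eq_lin_ext[OF b inj _ _ _ HOL.refl] by blast
    qed
    ultimately show "b \<in> I \<rightarrow> carrier V \<and> bij_betw (lin_ext K V b) (finsupp K I) (carrier V)"
      using b module_hom_in[OF hom] by (auto simp: bij_betw_def)
  next
    assume "b \<in> I \<rightarrow> carrier V \<and> bij_betw (lin_ext K V b) (finsupp K I) (carrier V)"
    then have b: "b \<in> I \<rightarrow> carrier V" and inj: "inj_on (lin_ext K V b) (finsupp K I)"
      and surj: "lin_ext K V b ` finsupp K I = carrier V" by (auto simp: bij_betw_def)
    note hom = lin_ext_hom[OF b]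
    have inj_b: "inj_on b I"
    proof (rule inj_onI)
      fix i j assume ij: "i \<in> I" "j \<in> I" "b i = b j"
      then have "lin_ext K V b (monomial K \<one>\<^bsub>K\<^esub> i) = lin_ext K V b (monomial K \<one>\<^bsub>K\<^esub> j)"
        by (simp add: lin_ext_one[OF _ b])
      then have "monomial K \<one>\<^bsub>K\<^esub> i = monomial K \<one>\<^bsub>K\<^esub> j"
        using inj ij by (auto simp: inj_on_def finsupp_monomial)
      then show "i = j" using one_zero by (auto simp: monomial_def fun_eq_iff split: if_splits)
    qed
    have "carrier V \<subseteq> span (b ` I)"
    proof
      fix v assume "v \<in> carrier V"
      then obtain f where "f \<in> finsupp K I" "v = lin_ext K V b f" using surj by auto
      moreover from as_lincomb[OF b inj_b this(1)] obtain a where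
        "a \<in> b ` {i. f i \<noteq> \<zero>\<^bsub>K\<^esub>} \<rightarrow> carrier K" "finite (b ` {i. f i \<noteq> \<zero>\<^bsub>K\<^esub>})"
        "b ` {i. f i \<noteq> \<zero>\<^bsub>K\<^esub>} \<subseteq> b ` I" "lincomb a (b ` {i. f i \<noteq> \<zero>\<^bsub>K\<^esub>}) = lin_ext K V b f"
        by (elim exE conjE)
      ultimately show "v \<in> span (b ` I)" unfolding span_def
        by (intro CollectI exI[of _ a] exI[of _ "b ` {i. f i \<noteq> \<zero>\<^bsub>K\<^esub>}"]) auto
    qed
    moreover have "span (b ` I) \<subseteq> carrier V" using b by (intro span_is_subset2) auto
    moreover have "lin_indpt (b ` I)"
    proof
      assume "lin_dep (b ` I)"
      then obtain A a v where A: "finite A" "A \<subseteq> b ` I" "a \<in> A \<rightarrow> carrier K"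
        "lincomb a A = \<zero>\<^bsub>V\<^esub>" "v \<in> A" "a v \<noteq> \<zero>\<^bsub>K\<^esub>" unfolding lin_dep_def by auto
      define f where "f = (\<lambda>i. if i \<in> I \<and> b i \<in> A then a (b i) else \<zero>\<^bsub>K\<^esub>)"
      note f = lincomb_eq_lin_ext[OF b inj_b A(2,1,3) f_def]
      have "lin_ext K V b f = lin_ext K V b (\<lambda>x. \<zero>\<^bsub>K\<^esub>)"
        using f(2) A(4) module_hom_zero[OF F.module_axioms module_axioms hom] by simp
      then have "f = (\<lambda>x. \<zero>\<^bsub>K\<^esub>)" using inj f(1) finsupp_zero by (auto simp: inj_on_def)
      moreover obtain i where "i \<in> I" "v = b i" using A by auto
      ultimately show False using A by (auto simp: f_def fun_eq_iff split: if_splits)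
    qed
    ultimately show "basis_family K V I b"
      using inj_b b by (auto simp: basis_family_def basis_def)
  qed
qed

text \<open>Take coordinates, that is the inverse of \<open>lin_ext K V b\<close>, and follow them by the linear extension
  of \<open>g\<close>.\<close>
lemma basis_extension:
  assumes V: "vectorspace K V" and b: "basis_family K V I b" and Z: "module K Z" and g: "g \<in> I \<rightarrow> carrier Z"
  shows "\<exists>h\<in>module_hom K V Z. \<forall>i\<in>I. h (b i) = g i"
proof -
  interpret vectorspace K V by fact
  interpret Z: module K Z by fact
  interpret F: module K "free_module K I" by (rule free_module_is_module)
  from b have bI: "b \<in> I \<rightarrow> carrier V" and bij: "bij_betw (lin_ext K V b) (finsupp K I) (carrier V)"
    by (auto simp: basis_family_iff)
  note hom = lin_ext_hom[OF bI]
  define c where "c = inv_into (finsupp K I) (lin_ext K V b)"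
  have c: "c v \<in> finsupp K I" "lin_ext K V b (c v) = v" if "v \<in> carrier V" for v
    using bij that bij_betw_inv_into_right[OF bij that] inv_into_into[of v "lin_ext K V b" "finsupp K I"]
    by (auto simp: c_def bij_betw_def)
  have c': "c v = f" if "f \<in> finsupp K I" "lin_ext K V b f = v" for v f
    using bij that bij_betw_inv_into_left[OF bij] by (auto simp: c_def)
  have "c \<in> module_hom K V (free_module K I)"
  proof (rule module_homI)
    fix v w assume vw: "v \<in> carrier V" "w \<in> carrier V"
    then show "c (v \<oplus>\<^bsub>V\<^esub> w) = c v \<oplus>\<^bsub>free_module K I\<^esub> c w"
      using c module_hom_add[OF hom] F.a_closed by (intro c') auto
  next
    fix a v assume "a \<in> carrier K" "v \<in> carrier V"
    then show "c (a \<odot>\<^bsub>V\<^esub> v) = a \<odot>\<^bsub>free_module K I\<^esub> c v"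
      using c module_hom_smult[OF hom] F.smult_closed by (intro c') auto
  qed (simp add: c)
  from module_hom_comp[OF this Z.lin_ext_hom[OF g]]
  show ?thesis
  proof (rule bexI[rotated], intro ballI)
    fix i assume i: "i \<in> I"
    then have "c (b i) = monomial K \<one>\<^bsub>K\<^esub> i"
      using bI by (intro c') (auto simp: finsupp_monomial lin_ext_one[OF _ bI])
    then show "lin_ext K Z g (c (b i)) = g i"
      using i g by (auto simp: Z.lin_ext_one[OF _ g])
  qed
qed

lemma basis_hom_eqI:
  assumes V: "vectorspace K V" and b: "basis_family K V I b" and Z: "module K Z"
    and h: "h \<in> module_hom K V Z" "k \<in> module_hom K V Z"
    and eq: "\<And>i. i \<in> I \<Longrightarrow> h (b i) = k (b i)" and v: "v \<in> carrier V"
  shows "h v = k v"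
proof -
  interpret vectorspace K V by fact
  interpret Z: module K Z by fact
  from b have bI: "b \<in> I \<rightarrow> carrier V" and bij: "bij_betw (lin_ext K V b) (finsupp K I) (carrier V)"
    by (auto simp: basis_family_iff)
  note hom = lin_ext_hom[OF bI]
  obtain f where f: "f \<in> finsupp K I" "v = lin_ext K V b f" using bij v by (auto simp: bij_betw_def)
  have "h (lin_ext K V b f) = k (lin_ext K V b f)"
    using bI eq
    by (intro Z.free_module_hom_eqI[OF module_hom_comp[OF hom h(1)] module_hom_comp[OF hom h(2)] _ f(1)])
      (auto simp: lin_ext_one[OF _ bI])
  then show ?thesis using f by simp
qed

lemma basis_induct [consumes 3, case_names zero smult add]:
  assumes V: "vectorspace K V" and b: "basis_family K V I b" and v: "v \<in> carrier V"
    and zero: "P \<zero>\<^bsub>V\<^esub>"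
    and smult: "\<And>a i. a \<in> carrier K \<Longrightarrow> i \<in> I \<Longrightarrow> P (a \<odot>\<^bsub>V\<^esub> b i)"
    and add: "\<And>v w. v \<in> carrier V \<Longrightarrow> w \<in> carrier V \<Longrightarrow> P v \<Longrightarrow> P w \<Longrightarrow> P (v \<oplus>\<^bsub>V\<^esub> w)"
  shows "P v"
proof -
  interpret vectorspace K V by fact
  from b have bI: "b \<in> I \<rightarrow> carrier V" and bij: "bij_betw (lin_ext K V b) (finsupp K I) (carrier V)"
    by (auto simp: basis_family_iff)
  note hom = lin_ext_hom[OF bI]
  obtain f where f: "f \<in> finsupp K I" "v = lin_ext K V b f" using bij v by (auto simp: bij_betw_def)
  from f(1) have "P (lin_ext K V b f)"
  proof (induction rule: finsupp_induct)
    case zero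
    then show ?case
      using module_hom_zero[OF free_module_is_module module_axioms hom] assms(4) by simp
  next
    case (monomial a i)
    then show ?case using smult by (simp add: lin_ext_monomial[OF _ _ bI])
  next
    case (add f g)
    then show ?case
      using assms(6) module_hom_add[OF hom, of f g] module_hom_in[OF hom] by simp
  qed
  with f show ?thesis by simp
qed

lemma basis_nonzero:
  assumes V: "vectorspace K V" and b: "basis_family K V I b" and i: "i \<in> I"
  shows "b i \<noteq> \<zero>\<^bsub>V\<^esub>"
proof
  assume 0: "b i = \<zero>\<^bsub>V\<^esub>"
  interpret vectorspace K V by fact
  from b have bI: "b \<in> I \<rightarrow> carrier V" and inj: "inj_on (lin_ext K V b) (finsupp K I)"
    by (auto simp: basis_family_iff bij_betw_def)
  have "lin_ext K V b (monomial K \<one>\<^bsub>K\<^esub> i) = lin_ext K V b (\<lambda>x. \<zero>\<^bsub>K\<^esub>)"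
    using module_hom_zero[OF free_module_is_module module_axioms lin_ext_hom[OF bI]] 0 i
    by (simp add: lin_ext_one[OF _ bI])
  then have "monomial K \<one>\<^bsub>K\<^esub> i = (\<lambda>x. \<zero>\<^bsub>K\<^esub>)"
    using inj i by (auto simp: inj_on_def finsupp_monomial finsupp_zero)
  then have "\<one>\<^bsub>K\<^esub> = \<zero>\<^bsub>K\<^esub>" by (auto simp: monomial_def fun_eq_iff split: if_splits)
  then show False by simp
qed

section \<open>Quotient modules\<close>

text \<open>All operations of the quotient are computed on representatives, so each law is inherited from \<open>M\<close>.\<close>
locale module_quotient = module K M for K and M (structure) +
  fixes N
  assumes N: "Module.submodule N K M"
begin

sublocale N: Module.submodule N K M by (rule N)

lemma N_subset: "N \<subseteq> carrier M"
  using N.subset by simp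

lemma N_subgroup: "subgroup N (add_monoid M)"
  by (rule N.subgroup_axioms)

lemma N_abelian_subgroup: "abelian_subgroup N M"
  by (rule abelian_subgroupI3[OF additive_subgroupI[OF N_subgroup] M.abelian_group_axioms])

lemma coset_eq_iff:
  assumes "x \<in> carrier M" "y \<in> carrier M"
  shows "N +> x = N +> y \<longleftrightarrow> x \<ominus> y \<in> N"
proof
  assume "N +> x = N +> y"
  moreover have "x \<in> N +> x"
    using assms N.one_closed by (auto simp: a_r_coset_def' intro!: bexI[of _ \<zero>])
  ultimately obtain h where "h \<in> N" "x = h \<oplus> y" by (auto simp: a_r_coset_def')
  with N_subset assms show "x \<ominus> y \<in> N"
    by (auto simp: M.minus_eq M.a_assoc M.r_neg)
next
  assume "x \<ominus> y \<in> N"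
  moreover have "x = (x \<ominus> y) \<oplus> y" using assms by (simp add: M.minus_eq M.a_assoc M.l_neg)
  ultimately have "x \<in> N +> y" by (auto simp: a_r_coset_def')
  then show "N +> x = N +> y" using M.a_repr_independence[OF _ assms(2) N_subgroup] by simp
qed

lemma quotient_carrier: "carrier (quotient_module M N) = (\<lambda>x. N +> x) ` carrier M"
  by (auto simp: quotient_module_def A_RCOSETS_def')

lemma quotient_zero: "\<zero>\<^bsub>quotient_module M N\<^esub> = N +> \<zero>"
  using N_subset by (simp add: quotient_module_def)

lemma quotient_add:
  assumes "x \<in> carrier M" "y \<in> carrier M"
  shows "(N +> x) \<oplus>\<^bsub>quotient_module M N\<^esub> (N +> y) = N +> (x \<oplus> y)"
  using abelian_subgroup.a_rcos_sum[OF N_abelian_subgroup assms] by (simp add: quotient_module_def)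

lemma quotient_smult:
  assumes a: "a \<in> carrier K" and x: "x \<in> carrier M"
  shows "a \<odot>\<^bsub>quotient_module M N\<^esub> (N +> x) = N +> (a \<odot> x)"
proof -
  have "N +> (a \<odot> z) = N +> (a \<odot> x)" if z: "z \<in> N +> x" for z
  proof -
    obtain h where h: "h \<in> N" "z = h \<oplus> x" using z by (auto simp: a_r_coset_def')
    then have hM: "h \<in> carrier M" using N_subset by auto
    have "a \<odot> z \<ominus> a \<odot> x = a \<odot> h"
      using a x hM by (simp add: h smult_r_distr M.minus_eq M.a_assoc M.r_neg)
    then show ?thesis using a h hM x by (subst coset_eq_iff) auto
  qed
  moreover have "N +> x \<noteq> {}" using N.one_closed by (auto simp: a_r_coset_def')
  ultimately show ?thesis by (auto simp: quotient_module_def)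
qed

lemma quotient_is_module: "module K (quotient_module M N)"
proof (rule moduleI)
  show "abelian_group (quotient_module M N)"
  proof (rule abelian_groupI)
    fix A assume "A \<in> carrier (quotient_module M N)"
    then obtain x where x: "x \<in> carrier M" "A = N +> x" by (auto simp: quotient_carrier)
    then show "\<exists>B\<in>carrier (quotient_module M N).
        B \<oplus>\<^bsub>quotient_module M N\<^esub> A = \<zero>\<^bsub>quotient_module M N\<^esub>"
      by (intro bexI[of _ "N +> (\<ominus> x)"])
        (auto simp: quotient_carrier quotient_add quotient_zero M.l_neg)
  next
    fix A B assume "A \<in> carrier (quotient_module M N)" "B \<in> carrier (quotient_module M N)"
    then show "A \<oplus>\<^bsub>quotient_module M N\<^esub> B = B \<oplus>\<^bsub>quotient_module M N\<^esub> A"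
      by (auto simp only: quotient_carrier quotient_add M.a_comm)
  qed (auto simp: quotient_carrier quotient_add quotient_zero M.a_assoc)
qed (auto simp: quotient_carrier quotient_add quotient_smult smult_l_distr smult_r_distr smult_assoc1
      is_cring)

lemma coset_hom: "(\<lambda>x. N +> x) \<in> module_hom K M (quotient_module M N)"
  by (rule module_homI) (auto simp: quotient_carrier quotient_add quotient_smult)

lemma quotient_lift:
  assumes Z: "module K Z" and h: "h \<in> module_hom K M Z" and 0: "\<And>x. x \<in> N \<Longrightarrow> h x = \<zero>\<^bsub>Z\<^esub>"
  shows "\<exists>k\<in>module_hom K (quotient_module M N) Z. \<forall>x\<in>carrier M. k (N +> x) = h x"
proof -
  interpret Z: module K Z by fact
  interpret h: mod_hom K M Z h
    using h by (simp add: mod_hom_def mod_hom_axioms_def Z.module_axioms module_axioms)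
  have eq: "h x = h y" if "x \<in> carrier M" "y \<in> carrier M" "N +> x = N +> y" for x y
  proof -
    have "h (x \<ominus> y) = \<zero>\<^bsub>Z\<^esub>" using that coset_eq_iff 0 by blast
    then show ?thesis using that Z.minus_eq_zeroD[of "h x" "h y"] by simp
  qed
  define k where "k = (\<lambda>A. h (SOME x. x \<in> carrier M \<and> N +> x = A))"
  have k: "k (N +> x) = h x" if x: "x \<in> carrier M" for x
  proof -
    have "(SOME y. y \<in> carrier M \<and> N +> y = N +> x) \<in> carrier M \<and>
        N +> (SOME y. y \<in> carrier M \<and> N +> y = N +> x) = N +> x"
      by (rule someI[of "\<lambda>y. y \<in> carrier M \<and> N +> y = N +> x" x]) (simp add: x)
    then show ?thesis unfolding k_def using eq x by blast
  qed
  have "k \<in> module_hom K (quotient_module M N) Z"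
    by (rule module_homI) (auto simp: quotient_carrier quotient_add quotient_smult k)
  with k show ?thesis by blast
qed

end

section \<open>Tensor products\<close>

text \<open>The free module underlying the tensor product is treated as an abstract module; unfolding its operations
  into functions would hide the module laws.\<close>
declare free_module_simps [simp del]

locale tensor = U: module K U + V: module K V
  for K :: "('a, 'b) ring_scheme" and U :: "('a, 'u, 'c) module_scheme"
    and V :: "('a, 'v, 'd) module_scheme"
begin

abbreviation "F \<equiv> free_module K (carrier U \<times> carrier V)"
abbreviation "W \<equiv> tensor_product K U V"
abbreviation "t \<equiv> pure_tensor K U V"
abbreviation "\<delta> \<equiv> monomial K \<one>\<^bsub>K\<^esub> :: 'u \<times> 'v \<Rightarrow> 'u \<times> 'v \<Rightarrow> 'a"

sublocale F: module K F by (rule U.free_module_is_module)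

lemma delta_closed: "u \<in> carrier U \<Longrightarrow> v \<in> carrier V \<Longrightarrow> \<delta> (u, v) \<in> carrier F"
  by (simp add: U.finsupp_monomial free_module_simps)

lemma tensor_rels_cases [consumes 1, case_names add_l add_r smult_l smult_r]:
  assumes "r \<in> tensor_rels K U V"
    and "\<And>u u' v. u \<in> carrier U \<Longrightarrow> u' \<in> carrier U \<Longrightarrow> v \<in> carrier V \<Longrightarrow>
      P (\<delta> (u \<oplus>\<^bsub>U\<^esub> u', v) \<ominus>\<^bsub>F\<^esub> (\<delta> (u, v) \<oplus>\<^bsub>F\<^esub> \<delta> (u', v)))"
    and "\<And>u v v'. u \<in> carrier U \<Longrightarrow> v \<in> carrier V \<Longrightarrow> v' \<in> carrier V \<Longrightarrow>
      P (\<delta> (u, v \<oplus>\<^bsub>V\<^esub> v') \<ominus>\<^bsub>F\<^esub> (\<delta> (u, v) \<oplus>\<^bsub>F\<^esub> \<delta> (u, v')))"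
    and "\<And>a u v. a \<in> carrier K \<Longrightarrow> u \<in> carrier U \<Longrightarrow> v \<in> carrier V \<Longrightarrow>
      P (\<delta> (a \<odot>\<^bsub>U\<^esub> u, v) \<ominus>\<^bsub>F\<^esub> a \<odot>\<^bsub>F\<^esub> \<delta> (u, v))"
    and "\<And>a u v. a \<in> carrier K \<Longrightarrow> u \<in> carrier U \<Longrightarrow> v \<in> carrier V \<Longrightarrow>
      P (\<delta> (u, a \<odot>\<^bsub>V\<^esub> v) \<ominus>\<^bsub>F\<^esub> a \<odot>\<^bsub>F\<^esub> \<delta> (u, v))"
  shows "P r"
  using assms(1) unfolding tensor_rels_def Let_def
  apply (elim UnE CollectE exE conjE)
     apply (hypsubst, rule assms(2); assumption)
    apply (hypsubst, rule assms(3); assumption)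
   apply (hypsubst, rule assms(4); assumption)
  apply (hypsubst, rule assms(5); assumption)
  done

lemma tensor_rels_in:
  "u \<in> carrier U \<Longrightarrow> u' \<in> carrier U \<Longrightarrow> v \<in> carrier V \<Longrightarrow>
    \<delta> (u \<oplus>\<^bsub>U\<^esub> u', v) \<ominus>\<^bsub>F\<^esub> (\<delta> (u, v) \<oplus>\<^bsub>F\<^esub> \<delta> (u', v)) \<in> tensor_rels K U V"
  "u \<in> carrier U \<Longrightarrow> v \<in> carrier V \<Longrightarrow> v' \<in> carrier V \<Longrightarrow>
    \<delta> (u, v \<oplus>\<^bsub>V\<^esub> v') \<ominus>\<^bsub>F\<^esub> (\<delta> (u, v) \<oplus>\<^bsub>F\<^esub> \<delta> (u, v')) \<in> tensor_rels K U V"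
  "a \<in> carrier K \<Longrightarrow> u \<in> carrier U \<Longrightarrow> v \<in> carrier V \<Longrightarrow>
    \<delta> (a \<odot>\<^bsub>U\<^esub> u, v) \<ominus>\<^bsub>F\<^esub> a \<odot>\<^bsub>F\<^esub> \<delta> (u, v) \<in> tensor_rels K U V"
  "a \<in> carrier K \<Longrightarrow> u \<in> carrier U \<Longrightarrow> v \<in> carrier V \<Longrightarrow>
    \<delta> (u, a \<odot>\<^bsub>V\<^esub> v) \<ominus>\<^bsub>F\<^esub> a \<odot>\<^bsub>F\<^esub> \<delta> (u, v) \<in> tensor_rels K U V"
  unfolding tensor_rels_def Let_def Un_iff mem_Collect_eq
     apply (rule disjI1, rule disjI1, rule disjI1, intro exI conjI, rule HOL.refl; assumption)
    apply (rule disjI1, rule disjI1, rule disjI2, intro exI conjI, rule HOL.refl; assumption)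
   apply (rule disjI1, rule disjI2, intro exI conjI, rule HOL.refl; assumption)
  apply (rule disjI2, intro exI conjI, rule HOL.refl; assumption)
  done

lemma tensor_rels_subset: "tensor_rels K U V \<subseteq> carrier F"
proof
  fix r assume "r \<in> tensor_rels K U V"
  then show "r \<in> carrier F"
    by (induction rule: tensor_rels_cases)
      (intro F.M.minus_closed F.M.a_closed F.smult_closed delta_closed U.M.a_closed V.M.a_closed
        U.smult_closed V.smult_closed; assumption)+
qed

lemma submodule_carrier: "Module.submodule (carrier F) K F"
  by (rule F.submoduleI)
    (rule subset_refl F.M.zero_closed F.M.a_inv_closed F.M.a_closed F.smult_closed | assumption)+

text \<open>An intersection of submodules is a submodule. The family is inhabited by the whole module, because
  the bilinearity relations lie in it.\<close>
lemma tensor_null_submodule: "Module.submodule (tensor_null K U V) K F"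
proof -
  let ?T = "{H. Module.submodule H K F \<and> tensor_rels K U V \<subseteq> H}"
  have eq: "tensor_null K U V = \<Inter>?T" by (simp add: tensor_null_def hull_def)
  have c: "carrier F \<in> ?T" using submodule_carrier tensor_rels_subset by simp
  have H: "H \<subseteq> carrier F" "\<zero>\<^bsub>F\<^esub> \<in> H" "\<And>x. x \<in> H \<Longrightarrow> \<ominus>\<^bsub>F\<^esub> x \<in> H"
    "\<And>x y. x \<in> H \<Longrightarrow> y \<in> H \<Longrightarrow> x \<oplus>\<^bsub>F\<^esub> y \<in> H"
    "\<And>a x. a \<in> carrier K \<Longrightarrow> x \<in> H \<Longrightarrow> a \<odot>\<^bsub>F\<^esub> x \<in> H"
    if "Module.submodule H K F" for H
  proof -
    interpret H: Module.submodule H K F by fact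
    show "H \<subseteq> carrier F" "\<zero>\<^bsub>F\<^esub> \<in> H" "\<And>x. x \<in> H \<Longrightarrow> \<ominus>\<^bsub>F\<^esub> x \<in> H"
      "\<And>x y. x \<in> H \<Longrightarrow> y \<in> H \<Longrightarrow> x \<oplus>\<^bsub>F\<^esub> y \<in> H"
      "\<And>a x. a \<in> carrier K \<Longrightarrow> x \<in> H \<Longrightarrow> a \<odot>\<^bsub>F\<^esub> x \<in> H"
      using H.subset H.one_closed H.m_inv_closed H.m_closed H.smult_closed
      by (auto simp: a_inv_def)
  qed
  show ?thesis unfolding eq
  proof (rule F.submoduleI)
    show "\<Inter>?T \<subseteq> carrier F" using c by blast
    show "\<zero>\<^bsub>F\<^esub> \<in> \<Inter>?T" using H(2) by blast
    show "\<ominus>\<^bsub>F\<^esub> x \<in> \<Inter>?T" if "x \<in> \<Inter>?T" for x using H(3) that by blast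
    show "x \<oplus>\<^bsub>F\<^esub> y \<in> \<Inter>?T" if "x \<in> \<Inter>?T" "y \<in> \<Inter>?T" for x y
      using H(4) that by blast
    show "a \<odot>\<^bsub>F\<^esub> x \<in> \<Inter>?T" if "a \<in> carrier K" "x \<in> \<Inter>?T" for a x
      using H(5) that by blast
  qed
qed

lemma tensor_rels_null: "tensor_rels K U V \<subseteq> tensor_null K U V"
  unfolding tensor_null_def by (rule hull_subset)

sublocale Q: module_quotient K F "tensor_null K U V"
  by (intro module_quotient.intro module_quotient_axioms.intro F.module_axioms tensor_null_submodule)

lemma pure_tensor_eq: "t u v = tensor_null K U V +>\<^bsub>F\<^esub> \<delta> (u, v)"
  by (simp add: pure_tensor_def)

sublocale W: module K W
  unfolding tensor_product_def by (rule Q.quotient_is_module)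

lemma coset_hom_tensor: "(\<lambda>x. tensor_null K U V +>\<^bsub>F\<^esub> x) \<in> module_hom K F W"
  unfolding tensor_product_def by (rule Q.coset_hom)

lemma pure_tensor_closed [simp]: "u \<in> carrier U \<Longrightarrow> v \<in> carrier V \<Longrightarrow> t u v \<in> carrier W"
  unfolding pure_tensor_eq by (rule module_hom_in[OF coset_hom_tensor delta_closed])

lemma coset_eqI:
  assumes "x \<in> carrier F" "y \<in> carrier F" "x \<ominus>\<^bsub>F\<^esub> y \<in> tensor_rels K U V"
  shows "tensor_null K U V +>\<^bsub>F\<^esub> x = tensor_null K U V +>\<^bsub>F\<^esub> y"
  using assms tensor_rels_null by (subst Q.coset_eq_iff) auto

lemma pure_tensor_add_left:
  assumes "u \<in> carrier U" "u' \<in> carrier U" "v \<in> carrier V"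
  shows "t (u \<oplus>\<^bsub>U\<^esub> u') v = t u v \<oplus>\<^bsub>W\<^esub> t u' v"
  unfolding pure_tensor_eq
  using coset_eqI[OF _ _ tensor_rels_in(1)[OF assms]] assms
  by (simp add: module_hom_add[OF coset_hom_tensor, symmetric] delta_closed)

lemma pure_tensor_add_right:
  assumes "u \<in> carrier U" "v \<in> carrier V" "v' \<in> carrier V"
  shows "t u (v \<oplus>\<^bsub>V\<^esub> v') = t u v \<oplus>\<^bsub>W\<^esub> t u v'"
  unfolding pure_tensor_eq
  using coset_eqI[OF _ _ tensor_rels_in(2)[OF assms]] assms
  by (simp add: module_hom_add[OF coset_hom_tensor, symmetric] delta_closed)

lemma pure_tensor_smult_left:
  assumes "a \<in> carrier K" "u \<in> carrier U" "v \<in> carrier V"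
  shows "t (a \<odot>\<^bsub>U\<^esub> u) v = a \<odot>\<^bsub>W\<^esub> t u v"
  unfolding pure_tensor_eq
  using coset_eqI[OF _ _ tensor_rels_in(3)[OF assms]] assms
  by (simp add: module_hom_smult[OF coset_hom_tensor, symmetric] delta_closed)

lemma pure_tensor_smult_right:
  assumes "a \<in> carrier K" "u \<in> carrier U" "v \<in> carrier V"
  shows "t u (a \<odot>\<^bsub>V\<^esub> v) = a \<odot>\<^bsub>W\<^esub> t u v"
  unfolding pure_tensor_eq
  using coset_eqI[OF _ _ tensor_rels_in(4)[OF assms]] assms
  by (simp add: module_hom_smult[OF coset_hom_tensor, symmetric] delta_closed)

lemma pure_tensor_hom_left: "v \<in> carrier V \<Longrightarrow> (\<lambda>u. t u v) \<in> module_hom K U W"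
  by (rule module_homI) (simp_all add: pure_tensor_add_left pure_tensor_smult_left)

lemma pure_tensor_hom_right: "u \<in> carrier U \<Longrightarrow> (\<lambda>v. t u v) \<in> module_hom K V W"
  by (rule module_homI) (simp_all add: pure_tensor_add_right pure_tensor_smult_right)

lemma pure_tensor_zero_left [simp]: "v \<in> carrier V \<Longrightarrow> t \<zero>\<^bsub>U\<^esub> v = \<zero>\<^bsub>W\<^esub>"
  by (rule module_hom_zero[OF U.module_axioms W.module_axioms pure_tensor_hom_left])

lemma pure_tensor_zero_right [simp]: "u \<in> carrier U \<Longrightarrow> t u \<zero>\<^bsub>V\<^esub> = \<zero>\<^bsub>W\<^esub>"
  by (rule module_hom_zero[OF V.module_axioms W.module_axioms pure_tensor_hom_right])

text \<open>A monomial \<open>\<alpha> (u, v)\<close> represents the pure tensor \<open>\<alpha> u \<otimes> v\<close>, so no scalar multiples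
  occur among the cases.\<close>
lemma tensor_induct [consumes 1, case_names zero pure add]:
  assumes "w \<in> carrier W"
    and "P \<zero>\<^bsub>W\<^esub>"
    and "\<And>u v. u \<in> carrier U \<Longrightarrow> v \<in> carrier V \<Longrightarrow> P (t u v)"
    and "\<And>w w'. w \<in> carrier W \<Longrightarrow> w' \<in> carrier W \<Longrightarrow> P w \<Longrightarrow> P w' \<Longrightarrow> P (w \<oplus>\<^bsub>W\<^esub> w')"
  shows "P w"
proof -
  obtain x where x: "x \<in> finsupp K (carrier U \<times> carrier V)" "w = tensor_null K U V +>\<^bsub>F\<^esub> x"
    using assms(1) unfolding tensor_product_def Q.quotient_carrier by (auto simp: free_module_simps)
  from x(1) have "P (tensor_null K U V +>\<^bsub>F\<^esub> x)"
  proof (induction rule: U.finsupp_induct)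
    case zero
    then show ?case using assms(2) Q.quotient_zero by (simp add: tensor_product_def free_module_simps)
  next
    case (monomial a p)
    obtain u v where p: "p = (u, v)" "u \<in> carrier U" "v \<in> carrier V" using monomial(2) by auto
    have "monomial K a p = a \<odot>\<^bsub>F\<^esub> \<delta> (u, v)" using monomial(1) p by (simp add: U.smult_monomial free_module_simps)
    then have "tensor_null K U V +>\<^bsub>F\<^esub> monomial K a p = t (a \<odot>\<^bsub>U\<^esub> u) v"
      using module_hom_smult[OF coset_hom_tensor monomial(1) delta_closed[OF p(2,3)]]
        pure_tensor_smult_left[OF monomial(1) p(2,3)] by (simp add: pure_tensor_eq)
    then show ?case using assms(3) p monomial(1) by simp
  next
    case (add f g)
    then show ?case
      using assms(4)[of "tensor_null K U V +>\<^bsub>F\<^esub> f" "tensor_null K U V +>\<^bsub>F\<^esub> g"]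
        module_hom_add[OF coset_hom_tensor, of f g]
        module_hom_in[OF coset_hom_tensor, of f] module_hom_in[OF coset_hom_tensor, of g]
      by (simp add: free_module_simps)
  qed
  with x show ?thesis by simp
qed

lemma tensor_hom_eqI:
  assumes Z: "module K Z" and h: "h \<in> module_hom K W Z" and k: "k \<in> module_hom K W Z"
    and "\<And>u v. u \<in> carrier U \<Longrightarrow> v \<in> carrier V \<Longrightarrow> h (t u v) = k (t u v)"
    and "w \<in> carrier W"
  shows "h w = k w"
  using assms(5)
proof (induction rule: tensor_induct)
  case zero
  then show ?case
    using module_hom_zero[OF W.module_axioms Z h] module_hom_zero[OF W.module_axioms Z k] by simp
qed (use assms(4) module_hom_add[OF h] module_hom_add[OF k] in auto)

text \<open>The universal property: the linear extension of a bilinear map kills the bilinearity relations, hence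
  the submodule that they generate.\<close>
lemma tensor_lift:
  assumes Z: "module K Z"
    and left: "\<And>v. v \<in> carrier V \<Longrightarrow> (\<lambda>u. b u v) \<in> module_hom K U Z"
    and right: "\<And>u. u \<in> carrier U \<Longrightarrow> (\<lambda>v. b u v) \<in> module_hom K V Z"
  shows "\<exists>h\<in>module_hom K W Z. \<forall>u\<in>carrier U. \<forall>v\<in>carrier V. h (t u v) = b u v"
proof -
  interpret Z: module K Z by fact
  have g: "(\<lambda>(u, v). b u v) \<in> carrier U \<times> carrier V \<rightarrow> carrier Z"
    using module_hom_in[OF left] by auto
  define L where "L = lin_ext K Z (\<lambda>(u, v). b u v)"
  have hom: "L \<in> module_hom K F Z" unfolding L_def by (rule Z.lin_ext_hom[OF g])
  interpret L: mod_hom K F Z L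
    using hom by (simp add: mod_hom_def mod_hom_axioms_def Z.module_axioms F.module_axioms)
  have delta: "L (\<delta> (u, v)) = b u v" if "u \<in> carrier U" "v \<in> carrier V" for u v
    unfolding L_def using that by (subst Z.lin_ext_one[OF _ g]) auto
  have b: "b u v \<in> carrier Z" if "u \<in> carrier U" "v \<in> carrier V" for u v
    using that module_hom_in[OF left] by blast
  have rels: "L r = \<zero>\<^bsub>Z\<^esub>" if "r \<in> tensor_rels K U V" for r
    using that
  proof (induction rule: tensor_rels_cases)
    case (add_l u u' v)
    then show ?case
      using module_hom_add[OF left[of v], of u u']
      by (simp add: delta_closed delta b Z.minus_eq Z.r_neg L.f_add)
  next
    case (add_r u v v')
    then show ?case
      using module_hom_add[OF right[of u], of v v']
      by (simp add: delta_closed delta b Z.minus_eq Z.r_neg L.f_add)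
  next
    case (smult_l a u v)
    then show ?case
      using module_hom_smult[OF left[of v], of a u]
      by (simp add: delta_closed delta b Z.minus_eq Z.r_neg L.f_smult)
  next
    case (smult_r a u v)
    then show ?case
      using module_hom_smult[OF right[of u], of a v]
      by (simp add: delta_closed delta b Z.minus_eq Z.r_neg L.f_smult)
  qed
  have zero_hom: "(\<lambda>x. \<zero>\<^bsub>Z\<^esub>) \<in> module_hom K F Z" by (rule module_homI) auto
  have "tensor_null K U V \<subseteq> {x \<in> carrier F. L x = \<zero>\<^bsub>Z\<^esub>}"
    unfolding tensor_null_def
    using rels tensor_rels_subset
      module_homs_agree_submodule[OF F.module_axioms Z hom zero_hom]
    by (intro hull_minimal) auto
  then obtain h where "h \<in> module_hom K (quotient_module F (tensor_null K U V)) Z"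
    "\<forall>x\<in>carrier F. h (tensor_null K U V +>\<^bsub>F\<^esub> x) = L x"
    using Q.quotient_lift[OF Z hom] by blast
  then show ?thesis
    using delta delta_closed by (intro bexI[of _ h]) (auto simp: pure_tensor_eq tensor_product_def)
qed

lemma tensor_map:
  assumes A: "A \<in> module_hom K U U" and B: "B \<in> module_hom K V V"
  shows "\<exists>h\<in>module_hom K W W. \<forall>u\<in>carrier U. \<forall>v\<in>carrier V. h (t u v) = t (A u) (B v)"
  by (rule tensor_lift[OF W.module_axioms])
    (use module_hom_comp[OF A pure_tensor_hom_left] module_hom_comp[OF B pure_tensor_hom_right]
      module_hom_in[OF A] module_hom_in[OF B] in blast)+

end

text \<open>The coordinates of \<open>u\<close> and \<open>v\<close> multiply to a bilinear map, whose lift to the tensor product is inverse to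
  \<open>lin_ext\<close> of the family of products. One composite is the identity on monomials, the other on
  the products of basis vectors, which suffices by linearity in each factor.\<close>
lemma tensor_basis:
  assumes "field K" "module K U" "module K V"
    and e: "basis_family K U I e" and f: "basis_family K V J f"
  shows "basis_family K (tensor_product K U V) (I \<times> J) (\<lambda>(i, j). pure_tensor K U V (e i) (f j))"
proof -
  interpret tensor K U V using assms by (simp add: tensor_def)
  have vs: "vectorspace K U" "vectorspace K V" "vectorspace K W"
    using assms W.module_axioms by (auto simp: vectorspace_def)
  interpret U': vectorspace K U by (rule vs)
  interpret V': vectorspace K V by (rule vs)
  interpret W': vectorspace K W by (rule vs)
  have eI: "e \<in> I \<rightarrow> carrier U" and fJ: "f \<in> J \<rightarrow> carrier V"
    using e f by (simp_all add: U'.basis_family_iff V'.basis_family_iff)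
  define E where "E = (\<lambda>(i, j). t (e i) (f j))"
  have E: "E \<in> I \<times> J \<rightarrow> carrier W" using eI fJ by (auto simp: E_def Pi_iff)
  let ?FI = "free_module K I" and ?FJ = "free_module K J" and ?FIJ = "free_module K (I \<times> J)"
  note mods = U.free_module_is_module
  interpret FIJ: module K ?FIJ by (rule mods)
  note homE = W.lin_ext_hom[OF E]
  obtain c where c: "c \<in> module_hom K U ?FI" "\<And>i. i \<in> I \<Longrightarrow> c (e i) = monomial K \<one>\<^bsub>K\<^esub> i"
    using basis_extension[OF vs(1) e mods[of I], of "monomial K \<one>\<^bsub>K\<^esub>"]
    by (auto simp: U.finsupp_monomial free_module_simps)
  obtain d where d: "d \<in> module_hom K V ?FJ" "\<And>j. j \<in> J \<Longrightarrow> d (f j) = monomial K \<one>\<^bsub>K\<^esub> j"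
    using basis_extension[OF vs(2) f mods[of J], of "monomial K \<one>\<^bsub>K\<^esub>"]
    by (auto simp: U.finsupp_monomial free_module_simps)
  define b where "b = (\<lambda>u v. \<lambda>(i, j). c u i \<otimes>\<^bsub>K\<^esub> d v j)"
  have cc: "c u \<in> finsupp K I" if "u \<in> carrier U" for u using module_hom_in[OF c(1) that] by (simp add: free_module_simps)
  have dd: "d v \<in> finsupp K J" if "v \<in> carrier V" for v using module_hom_in[OF d(1) that] by (simp add: free_module_simps)
  note ccK = finsuppD(1)[OF cc] and ddK = finsuppD(1)[OF dd]
  have bb: "b u v \<in> finsupp K (I \<times> J)" if "u \<in> carrier U" "v \<in> carrier V" for u v
    using finsuppD[OF cc[OF that(1)]] finsuppD[OF dd[OF that(2)]]
    by (intro finsuppI[of _ _ "{i. c u i \<noteq> \<zero>\<^bsub>K\<^esub>} \<times> {j. d v j \<noteq> \<zero>\<^bsub>K\<^esub>}"])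
      (auto simp: b_def)
  obtain h where h: "h \<in> module_hom K W ?FIJ"
    "\<And>u v. u \<in> carrier U \<Longrightarrow> v \<in> carrier V \<Longrightarrow> h (t u v) = b u v"
  proof -
    have "\<exists>h\<in>module_hom K W ?FIJ. \<forall>u\<in>carrier U. \<forall>v\<in>carrier V. h (t u v) = b u v"
    proof (rule tensor_lift[OF mods])
      fix v assume v: "v \<in> carrier V"
      show "(\<lambda>u. b u v) \<in> module_hom K U ?FIJ"
        using v ccK ddK bb
        by (intro module_homI) (auto simp: free_module_simps b_def module_hom_add[OF c(1)] module_hom_smult[OF c(1)]
            fun_eq_iff U.l_distr U.m_assoc)
    next
      fix u assume u: "u \<in> carrier U"
      show "(\<lambda>v. b u v) \<in> module_hom K V ?FIJ"
        using u ccK ddK bb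
        by (intro module_homI) (auto simp: free_module_simps b_def module_hom_add[OF d(1)] module_hom_smult[OF d(1)]
            fun_eq_iff U.r_distr U.m_lcomm)
    qed
    then show thesis using that by blast
  qed
  have hE: "h (E p) = monomial K \<one>\<^bsub>K\<^esub> p" if "p \<in> I \<times> J" for p
    using that eI fJ c(2) d(2) h(2) by (auto simp: E_def b_def monomial_def Pi_iff fun_eq_iff split: if_splits)
  have left_inv: "h (lin_ext K W E x) = x" if "x \<in> finsupp K (I \<times> J)" for x
    by (rule FIJ.free_module_hom_eqI[OF module_hom_comp[OF homE h(1)] module_hom_id _ that])
      (simp add: W.lin_ext_one[OF _ E] hE)
  have right_inv: "lin_ext K W E (h w) = w" if w: "w \<in> carrier W" for w
  proof (rule tensor_hom_eqI[OF W.module_axioms module_hom_comp[OF h(1) homE] module_hom_id _ w])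
    fix u v assume u: "u \<in> carrier U" and v: "v \<in> carrier V"
    have basis: "lin_ext K W E (h (t (e i) (f j))) = t (e i) (f j)" if "i \<in> I" "j \<in> J" for i j
      using hE[of "(i, j)"] W.lin_ext_one[OF _ E, of "(i, j)"] that by (simp add: E_def)
    have "lin_ext K W E (h (t (e i) v)) = t (e i) v" if i: "i \<in> I" for i
    proof -
      have ei: "e i \<in> carrier U" using i eI by auto
      show ?thesis
        by (rule basis_hom_eqI[OF vs(2) f W.module_axioms
              module_hom_comp[OF pure_tensor_hom_right[OF ei] module_hom_comp[OF h(1) homE]]
              pure_tensor_hom_right[OF ei] _ v])
          (rule basis[OF i])
    qed
    then show "lin_ext K W E (h (t u v)) = t u v"
      by (rule basis_hom_eqI[OF vs(1) e W.module_axioms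
            module_hom_comp[OF pure_tensor_hom_left[OF v] module_hom_comp[OF h(1) homE]]
            pure_tensor_hom_left[OF v] _ u])
  qed
  have "bij_betw (lin_ext K W E) (finsupp K (I \<times> J)) (carrier W)"
    by (rule bij_betw_byWitness[of _ h])
      (use left_inv right_inv module_hom_in[OF homE] module_hom_in[OF h(1)] in \<open>auto simp: free_module_simps\<close>)
  then show ?thesis using E W'.basis_family_iff unfolding E_def by blast
qed

section \<open>Monoids given by generators and relations\<close>

lemma monoid_cong_context:
  assumes "monoid_cong R u v"
  shows "monoid_cong R (x @ u @ y) (x @ v @ y)"
  using assms
proof induction
  case (rel u v x' y')
  then show ?case using monoid_cong.rel[of u v R "x @ x'" "y' @ y"] by simp
next
  case (refl u)
  show ?case by (rule monoid_cong.refl)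
next
  case (sym u v)
  show ?case by (rule monoid_cong.sym) (rule sym.IH)
next
  case (trans u v w)
  show ?case by (rule monoid_cong.trans) (rule trans.IH)+
qed

lemma monoid_cong_append:
  assumes "monoid_cong R u u'" "monoid_cong R v v'"
  shows "monoid_cong R (u @ v) (u' @ v')"
proof (rule monoid_cong.trans)
  show "monoid_cong R (u @ v) (u' @ v)" using monoid_cong_context[OF assms(1), of "[]" v] by simp
  show "monoid_cong R (u' @ v) (u' @ v')" using monoid_cong_context[OF assms(2), of u' "[]"] by simp
qed

lemma equiv_word_rel: "equiv (lists G) (word_rel G R)"
proof (rule equivI)
  show "word_rel G R \<subseteq> lists G \<times> lists G" by (auto simp: word_rel_def)
  show "refl_on (lists G) (word_rel G R)"
    by (auto simp: refl_on_def word_rel_def monoid_cong.refl)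
  show "sym (word_rel G R)"
    unfolding sym_def word_rel_def using monoid_cong.sym by fast
  show "trans (word_rel G R)"
    unfolding trans_def word_rel_def using monoid_cong.trans by fast
qed

abbreviation word_class :: "'g set \<Rightarrow> ('g list \<times> 'g list) set \<Rightarrow> 'g list \<Rightarrow> 'g list set" where
  "word_class G R u \<equiv> word_rel G R `` {u}"

lemma word_class_eq_iff:
  assumes "u \<in> lists G" "v \<in> lists G"
  shows "word_class G R u = word_class G R v \<longleftrightarrow> monoid_cong R u v"
  using eq_equiv_class_iff[OF equiv_word_rel assms, of R] assms by (simp add: word_rel_def)

lemma presented_monoid_carrier:
  "carrier (presented_monoid G R) = word_class G R ` lists G"
  by (auto simp: presented_monoid_def quotient_def)

lemma presented_monoid_one: "\<one>\<^bsub>presented_monoid G R\<^esub> = word_class G R []"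
  by (simp add: presented_monoid_def)

lemma presented_monoid_mult:
  assumes "u \<in> lists G" "v \<in> lists G"
  shows "word_class G R u \<otimes>\<^bsub>presented_monoid G R\<^esub> word_class G R v = word_class G R (u @ v)"
proof -
  have eq: "word_class G R (u' @ v') = word_class G R (u @ v)"
    if "u' \<in> word_class G R u" "v' \<in> word_class G R v" for u' v'
  proof -
    from that have l: "u' \<in> lists G" "v' \<in> lists G" and c: "monoid_cong R u u'" "monoid_cong R v v'"
      by (simp_all add: word_rel_def)
    have "u' @ v' \<in> lists G" "u @ v \<in> lists G" using l assms by simp_all
    with monoid_cong.sym[OF monoid_cong_append[OF c]] show ?thesis
      by (simp only: word_class_eq_iff)
  qed
  have "u \<in> word_class G R u" "v \<in> word_class G R v"
    using assms by (simp_all add: word_rel_def monoid_cong.refl)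
  then have "(\<Union>u'\<in>word_class G R u. \<Union>v'\<in>word_class G R v. word_class G R (u @ v)) =
      word_class G R (u @ v)" by blast
  moreover have "(\<Union>u'\<in>word_class G R u. \<Union>v'\<in>word_class G R v. word_class G R (u' @ v')) =
      (\<Union>u'\<in>word_class G R u. \<Union>v'\<in>word_class G R v. word_class G R (u @ v))"
    using eq by (intro SUP_cong HOL.refl)
  ultimately show ?thesis by (simp add: presented_monoid_def)
qed

lemma presented_monoid_is_monoid: "monoid (presented_monoid G R)"
proof (rule monoidI)
  fix a b c assume abc: "a \<in> carrier (presented_monoid G R)" "b \<in> carrier (presented_monoid G R)"
    "c \<in> carrier (presented_monoid G R)"
  then obtain u v w where uvw: "u \<in> lists G" "v \<in> lists G" "w \<in> lists G"
    "a = word_class G R u" "b = word_class G R v" "c = word_class G R w"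
    by (auto simp: presented_monoid_carrier)
  then have "u @ v \<in> lists G" "v @ w \<in> lists G" by auto
  with uvw show "a \<otimes>\<^bsub>presented_monoid G R\<^esub> b \<otimes>\<^bsub>presented_monoid G R\<^esub> c =
      a \<otimes>\<^bsub>presented_monoid G R\<^esub> (b \<otimes>\<^bsub>presented_monoid G R\<^esub> c)"
    by (simp add: presented_monoid_mult)
next
  fix a b assume "a \<in> carrier (presented_monoid G R)" "b \<in> carrier (presented_monoid G R)"
  then obtain u v where uv: "u \<in> lists G" "v \<in> lists G"
    "a = word_class G R u" "b = word_class G R v"
    by (auto simp: presented_monoid_carrier)
  then have "u @ v \<in> lists G" by auto
  with uv show "a \<otimes>\<^bsub>presented_monoid G R\<^esub> b \<in> carrier (presented_monoid G R)"
    by (simp add: presented_monoid_carrier presented_monoid_mult)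
next
  fix a assume "a \<in> carrier (presented_monoid G R)"
  then obtain u where u: "u \<in> lists G" "a = word_class G R u" by (auto simp: presented_monoid_carrier)
  then show "\<one>\<^bsub>presented_monoid G R\<^esub> \<otimes>\<^bsub>presented_monoid G R\<^esub> a = a"
    "a \<otimes>\<^bsub>presented_monoid G R\<^esub> \<one>\<^bsub>presented_monoid G R\<^esub> = a"
    using presented_monoid_mult[of "[]" G u R] presented_monoid_mult[of u G "[]" R]
    by (simp_all add: presented_monoid_one)
next
  show "\<one>\<^bsub>presented_monoid G R\<^esub> \<in> carrier (presented_monoid G R)"
    by (auto simp: presented_monoid_carrier presented_monoid_one)
qed

lemma foldr_closed:
  assumes closed: "\<And>j w. j \<in> set u \<Longrightarrow> w \<in> D \<Longrightarrow> T j w \<in> D" and w: "w \<in> D"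
  shows "foldr T u w \<in> D"
  using closed
proof (induction u)
  case Nil
  show ?case using w by simp
next
  case (Cons j u)
  have "foldr T u w \<in> D" by (rule Cons.IH) (rule Cons.prems, rule list.set_intros(2))
  then show ?case using Cons.prems[of j] by simp
qed

text \<open>A word acts by applying its letters from right to left; operators satisfying the defining relations
  therefore identify congruent words.\<close>
lemma foldr_respects_monoid_cong:
  assumes closed: "\<And>j w. w \<in> D \<Longrightarrow> T j w \<in> D"
    and rels: "\<And>u v w. (u, v) \<in> R \<Longrightarrow> w \<in> D \<Longrightarrow> foldr T u w = foldr T v w"
    and "monoid_cong R u v"
  shows "\<forall>w\<in>D. foldr T u w = foldr T v w"
  using assms(3)
proof induction
  case (rel u v x y)
  show ?case
  proof
    fix w assume w: "w \<in> D"
    have "foldr T y w \<in> D" by (rule foldr_closed[OF closed w])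
    from rels[OF rel this] show "foldr T (x @ u @ y) w = foldr T (x @ v @ y) w" by simp
  qed
qed (simp_all (no_asm_simp))

lemma presented_monoid_action:
  assumes closed: "\<And>j w. j \<in> G \<Longrightarrow> w \<in> D \<Longrightarrow> T j w \<in> D"
    and R: "\<And>u v. (u, v) \<in> R \<Longrightarrow> u \<in> lists G \<and> v \<in> lists G"
    and rels: "\<And>u v w. (u, v) \<in> R \<Longrightarrow> w \<in> D \<Longrightarrow> foldr T u w = foldr T v w"
  shows "\<exists>\<rho>. \<forall>u\<in>lists G. \<forall>w\<in>D. \<rho> (word_class G R u) w = foldr T u w"
proof -
  \<comment> \<open>Congruence allows arbitrary letters in the context of a relation, so the operators are extended trivially.\<close>
  define T' where "T' = (\<lambda>j w. if j \<in> G then T j w else w)"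
  have T': "foldr T' u w = foldr T u w" if "u \<in> lists G" for u w
    using that by (induction u) (auto simp: T'_def)
  have cong: "foldr T u w = foldr T v w"
    if "u \<in> lists G" "v \<in> lists G" "monoid_cong R u v" "w \<in> D" for u v w
  proof -
    have "\<forall>w\<in>D. foldr T' u w = foldr T' v w"
    proof (rule foldr_respects_monoid_cong[of D T' R])
      fix u v w assume uv: "(u, v) \<in> R" and w: "w \<in> D"
      show "foldr T' u w = foldr T' v w" using rels[OF uv w] R[OF uv] T' by simp
    qed (simp_all add: T'_def closed that)
    then show ?thesis using T' that by auto
  qed
  define \<rho> where "\<rho> = (\<lambda>c. foldr T (SOME u. u \<in> lists G \<and> word_class G R u = c))"
  have "\<rho> (word_class G R u) w = foldr T u w" if u: "u \<in> lists G" and w: "w \<in> D" for u w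
  proof -
    have "(SOME v. v \<in> lists G \<and> word_class G R v = word_class G R u) \<in> lists G \<and>
      word_class G R (SOME v. v \<in> lists G \<and> word_class G R v = word_class G R u) = word_class G R u"
      by (rule someI[of "\<lambda>v. v \<in> lists G \<and> word_class G R v = word_class G R u" u]) (simp add: u)
    then show ?thesis unfolding \<rho>_def using word_class_eq_iff[OF _ u] cong[OF _ u _ w] by blast
  qed
  then show ?thesis by blast
qed

section \<open>Monoid algebras\<close>

declare free_module_simps [simp]

text \<open>Transports the group laws between records of different types that share carrier, zero and addition.\<close>
lemma abelian_group_cong:
  fixes M :: "('a, 'm) ring_scheme" and N :: "('a, 'n) ring_scheme"
  assumes "abelian_group M" and carrier: "carrier N = carrier M" and zero: "\<zero>\<^bsub>N\<^esub> = \<zero>\<^bsub>M\<^esub>"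
    and add: "\<And>x y. x \<oplus>\<^bsub>N\<^esub> y = x \<oplus>\<^bsub>M\<^esub> y"
  shows "abelian_group N"
proof -
  interpret abelian_group M by fact
  show ?thesis
  proof (rule abelian_groupI)
    fix x assume "x \<in> carrier N"
    then have "x \<in> carrier M" by (simp add: carrier)
    then show "\<exists>y\<in>carrier N. y \<oplus>\<^bsub>N\<^esub> x = \<zero>\<^bsub>N\<^esub>"
      unfolding carrier add zero by (intro bexI[of _ "\<ominus>\<^bsub>M\<^esub> x"] l_neg a_inv_closed)
  next
    fix x y z assume "x \<in> carrier N" "y \<in> carrier N" "z \<in> carrier N"
    then show "x \<oplus>\<^bsub>N\<^esub> y \<oplus>\<^bsub>N\<^esub> z = x \<oplus>\<^bsub>N\<^esub> (y \<oplus>\<^bsub>N\<^esub> z)" by (simp add: carrier add a_assoc)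
  next
    fix x y assume "x \<in> carrier N" "y \<in> carrier N"
    then show "x \<oplus>\<^bsub>N\<^esub> y = y \<oplus>\<^bsub>N\<^esub> x" by (simp add: carrier add a_comm)
  qed (simp_all add: carrier add zero)
qed

lemma monoid_algebra_simps [simp]:
  "carrier (monoid_algebra K M) = finsupp K (carrier M)"
  "\<zero>\<^bsub>monoid_algebra K M\<^esub> = (\<lambda>x. \<zero>\<^bsub>K\<^esub>)"
  "\<one>\<^bsub>monoid_algebra K M\<^esub> = monomial K \<one>\<^bsub>K\<^esub> \<one>\<^bsub>M\<^esub>"
  "f \<oplus>\<^bsub>monoid_algebra K M\<^esub> g = (\<lambda>x. f x \<oplus>\<^bsub>K\<^esub> g x)"
  by (simp_all add: monoid_algebra_def)

locale monoid_alg = K: cring K + M: monoid M for K (structure) and M (structure)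
begin

abbreviation "A \<equiv> monoid_algebra K M"

text \<open>The sum defining the product depends on the supports. Over a common box containing them, additivity in
  each factor is a termwise statement.\<close>
lemma mult_superset:
  assumes f: "f \<in> finsupp K (carrier M)" and g: "g \<in> finsupp K (carrier M)"
    and "finite S" "{y. f y \<noteq> \<zero>\<^bsub>K\<^esub>} \<subseteq> S" "finite T" "{z. g z \<noteq> \<zero>\<^bsub>K\<^esub>} \<subseteq> T"
  shows "(f \<otimes>\<^bsub>A\<^esub> g) x =
    (\<Oplus>\<^bsub>K\<^esub>p\<in>S \<times> T. if fst p \<otimes>\<^bsub>M\<^esub> snd p = x then f (fst p) \<otimes>\<^bsub>K\<^esub> g (snd p) else \<zero>\<^bsub>K\<^esub>)"
proof -
  have "(f \<otimes>\<^bsub>A\<^esub> g) x = (\<Oplus>\<^bsub>K\<^esub>p\<in>{(y, z). f y \<noteq> \<zero>\<^bsub>K\<^esub> \<and> g z \<noteq> \<zero>\<^bsub>K\<^esub> \<and> y \<otimes>\<^bsub>M\<^esub> z = x}.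
      f (fst p) \<otimes>\<^bsub>K\<^esub> g (snd p))"
    by (simp add: monoid_algebra_def)
  also have "\<dots> = (\<Oplus>\<^bsub>K\<^esub>p\<in>S \<times> T.
      if fst p \<otimes>\<^bsub>M\<^esub> snd p = x then f (fst p) \<otimes>\<^bsub>K\<^esub> g (snd p) else \<zero>\<^bsub>K\<^esub>)"
    using assms finsuppD(1)[OF f] finsuppD(1)[OF g]
    by (intro K.add.finprod_mono_neutral_cong_left) auto
  finally show ?thesis .
qed

lemma mult_add_left:
  assumes f: "f \<in> carrier A" and g: "g \<in> carrier A" and h: "h \<in> carrier A"
  shows "(f \<oplus>\<^bsub>A\<^esub> g) \<otimes>\<^bsub>A\<^esub> h = (f \<otimes>\<^bsub>A\<^esub> h) \<oplus>\<^bsub>A\<^esub> (g \<otimes>\<^bsub>A\<^esub> h)"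
proof
  fix x
  note fgh = f[simplified] g[simplified] h[simplified]
  define S where "S = {y. f y \<noteq> \<zero>\<^bsub>K\<^esub>} \<union> {y. g y \<noteq> \<zero>\<^bsub>K\<^esub>}"
  define T where "T = {z. h z \<noteq> \<zero>\<^bsub>K\<^esub>}"
  have fin: "finite S" "finite T"
    using finsuppD(3)[OF fgh(1)] finsuppD(3)[OF fgh(2)] finsuppD(3)[OF fgh(3)]
    by (auto simp: S_def T_def)
  note c [simp] = finsuppD(1)[OF fgh(1)] finsuppD(1)[OF fgh(2)] finsuppD(1)[OF fgh(3)]
  have "((f \<oplus>\<^bsub>A\<^esub> g) \<otimes>\<^bsub>A\<^esub> h) x = (\<Oplus>\<^bsub>K\<^esub>p\<in>S \<times> T.
      if fst p \<otimes>\<^bsub>M\<^esub> snd p = x then (f \<oplus>\<^bsub>A\<^esub> g) (fst p) \<otimes>\<^bsub>K\<^esub> h (snd p) else \<zero>\<^bsub>K\<^esub>)"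
    using fin by (intro mult_superset) (auto simp: fgh S_def T_def K.finsupp_add)
  also have "\<dots> = (\<Oplus>\<^bsub>K\<^esub>p\<in>S \<times> T.
      (if fst p \<otimes>\<^bsub>M\<^esub> snd p = x then f (fst p) \<otimes>\<^bsub>K\<^esub> h (snd p) else \<zero>\<^bsub>K\<^esub>) \<oplus>\<^bsub>K\<^esub>
      (if fst p \<otimes>\<^bsub>M\<^esub> snd p = x then g (fst p) \<otimes>\<^bsub>K\<^esub> h (snd p) else \<zero>\<^bsub>K\<^esub>))"
    by (intro K.finsum_cong') (auto simp: K.l_distr)
  also have "\<dots> = (f \<otimes>\<^bsub>A\<^esub> h) x \<oplus>\<^bsub>K\<^esub> (g \<otimes>\<^bsub>A\<^esub> h) x"
    using fin mult_superset[OF fgh(1,3) fin(1) _ fin(2)] mult_superset[OF fgh(2,3) fin(1) _ fin(2)]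
    by (subst K.finsum_addf) (auto simp: S_def T_def)
  finally show "((f \<oplus>\<^bsub>A\<^esub> g) \<otimes>\<^bsub>A\<^esub> h) x = ((f \<otimes>\<^bsub>A\<^esub> h) \<oplus>\<^bsub>A\<^esub> (g \<otimes>\<^bsub>A\<^esub> h)) x" by simp
qed

lemma mult_add_right:
  assumes f: "f \<in> carrier A" and g: "g \<in> carrier A" and h: "h \<in> carrier A"
  shows "h \<otimes>\<^bsub>A\<^esub> (f \<oplus>\<^bsub>A\<^esub> g) = (h \<otimes>\<^bsub>A\<^esub> f) \<oplus>\<^bsub>A\<^esub> (h \<otimes>\<^bsub>A\<^esub> g)"
proof
  fix x
  note fgh = f[simplified] g[simplified] h[simplified]
  define S where "S = {y. f y \<noteq> \<zero>\<^bsub>K\<^esub>} \<union> {y. g y \<noteq> \<zero>\<^bsub>K\<^esub>}"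
  define T where "T = {z. h z \<noteq> \<zero>\<^bsub>K\<^esub>}"
  have fin: "finite T" "finite S"
    using finsuppD(3)[OF fgh(1)] finsuppD(3)[OF fgh(2)] finsuppD(3)[OF fgh(3)]
    by (auto simp: S_def T_def)
  note c [simp] = finsuppD(1)[OF fgh(1)] finsuppD(1)[OF fgh(2)] finsuppD(1)[OF fgh(3)]
  have "(h \<otimes>\<^bsub>A\<^esub> (f \<oplus>\<^bsub>A\<^esub> g)) x = (\<Oplus>\<^bsub>K\<^esub>p\<in>T \<times> S.
      if fst p \<otimes>\<^bsub>M\<^esub> snd p = x then h (fst p) \<otimes>\<^bsub>K\<^esub> (f \<oplus>\<^bsub>A\<^esub> g) (snd p) else \<zero>\<^bsub>K\<^esub>)"
    using fin by (intro mult_superset) (auto simp: fgh S_def T_def K.finsupp_add)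
  also have "\<dots> = (\<Oplus>\<^bsub>K\<^esub>p\<in>T \<times> S.
      (if fst p \<otimes>\<^bsub>M\<^esub> snd p = x then h (fst p) \<otimes>\<^bsub>K\<^esub> f (snd p) else \<zero>\<^bsub>K\<^esub>) \<oplus>\<^bsub>K\<^esub>
      (if fst p \<otimes>\<^bsub>M\<^esub> snd p = x then h (fst p) \<otimes>\<^bsub>K\<^esub> g (snd p) else \<zero>\<^bsub>K\<^esub>))"
    by (intro K.finsum_cong') (auto simp: K.r_distr)
  also have "\<dots> = (h \<otimes>\<^bsub>A\<^esub> f) x \<oplus>\<^bsub>K\<^esub> (h \<otimes>\<^bsub>A\<^esub> g) x"
    using fin mult_superset[OF fgh(3,1) fin(1) _ fin(2)] mult_superset[OF fgh(3,2) fin(1) _ fin(2)]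
    by (subst K.finsum_addf) (auto simp: S_def T_def)
  finally show "(h \<otimes>\<^bsub>A\<^esub> (f \<oplus>\<^bsub>A\<^esub> g)) x = ((h \<otimes>\<^bsub>A\<^esub> f) \<oplus>\<^bsub>A\<^esub> (h \<otimes>\<^bsub>A\<^esub> g)) x" by simp
qed

lemma mult_monomial:
  assumes ab: "a \<in> carrier K" "b \<in> carrier K" and mm: "m \<in> carrier M" "m' \<in> carrier M"
  shows "monomial K a m \<otimes>\<^bsub>A\<^esub> monomial K b m' = monomial K (a \<otimes>\<^bsub>K\<^esub> b) (m \<otimes>\<^bsub>M\<^esub> m')"
proof
  fix x
  have "(monomial K a m \<otimes>\<^bsub>A\<^esub> monomial K b m') x = (\<Oplus>\<^bsub>K\<^esub>p\<in>{m} \<times> {m'}.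
    if fst p \<otimes>\<^bsub>M\<^esub> snd p = x then monomial K a m (fst p) \<otimes>\<^bsub>K\<^esub> monomial K b m' (snd p) else \<zero>\<^bsub>K\<^esub>)"
    using assms by (intro mult_superset K.finsupp_monomial) (auto simp: monomial_def)
  also have "\<dots> = monomial K (a \<otimes>\<^bsub>K\<^esub> b) (m \<otimes>\<^bsub>M\<^esub> m') x"
    using ab by (auto simp: monomial_def)
  finally show "(monomial K a m \<otimes>\<^bsub>A\<^esub> monomial K b m') x =
      monomial K (a \<otimes>\<^bsub>K\<^esub> b) (m \<otimes>\<^bsub>M\<^esub> m') x" .
qed

lemma mult_zero:
  assumes "f \<in> carrier A"
  shows "(\<lambda>x. \<zero>\<^bsub>K\<^esub>) \<otimes>\<^bsub>A\<^esub> f = (\<lambda>x. \<zero>\<^bsub>K\<^esub>)" "f \<otimes>\<^bsub>A\<^esub> (\<lambda>x. \<zero>\<^bsub>K\<^esub>) = (\<lambda>x. \<zero>\<^bsub>K\<^esub>)"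
  by (simp_all add: monoid_algebra_def)

lemma mult_closed:
  assumes "f \<in> carrier A" "g \<in> carrier A"
  shows "f \<otimes>\<^bsub>A\<^esub> g \<in> carrier A"
proof -
  from assms have "f \<in> finsupp K (carrier M)" "g \<in> finsupp K (carrier M)" by auto
  then show ?thesis
  proof (induction f rule: K.finsupp_induct)
    case zero
    then show ?case by (simp add: mult_zero K.finsupp_zero)
  next
    case (monomial a m)
    from monomial(3) show ?case
    proof (induction g rule: K.finsupp_induct)
      case zero
      then show ?case using monomial(1,2) by (simp add: mult_zero K.finsupp_zero K.finsupp_monomial)
    next
      case (monomial b m')
      with \<open>a \<in> carrier K\<close> \<open>m \<in> carrier M\<close> show ?case
        by (simp add: mult_monomial K.finsupp_monomial)
    next
      case (add f g)
      then show ?case using mult_add_right[of f g "monomial K a m"] monomial(1,2)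
        by (simp add: K.finsupp_monomial K.finsupp_add)
    qed
  next
    case (add f h)
    then show ?case using mult_add_left[of f h g] by (simp add: K.finsupp_add)
  qed
qed

text \<open>Identities that are additive in an element of the algebra need only be checked on monomials. The codomain
  is arbitrary so that both elements of the algebra and vectors of a module are covered.\<close>
lemma additive_eqI:
  assumes zero: "F (\<lambda>x. \<zero>\<^bsub>K\<^esub>) = G (\<lambda>x. \<zero>\<^bsub>K\<^esub>)"
    and monomial: "\<And>a m. a \<in> carrier K \<Longrightarrow> m \<in> carrier M \<Longrightarrow> F (monomial K a m) = G (monomial K a m)"
    and F: "\<And>f g. f \<in> carrier A \<Longrightarrow> g \<in> carrier A \<Longrightarrow> F (f \<oplus>\<^bsub>A\<^esub> g) = add_op (F f) (F g)"
    and G: "\<And>f g. f \<in> carrier A \<Longrightarrow> g \<in> carrier A \<Longrightarrow> G (f \<oplus>\<^bsub>A\<^esub> g) = add_op (G f) (G g)"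
    and f: "f \<in> carrier A"
  shows "F f = G f"
proof -
  from f have "f \<in> finsupp K (carrier M)" by simp
  then show ?thesis
  proof (induction rule: K.finsupp_induct)
    case (add f g)
    then show ?case using F[of f g] G[of f g] by simp
  qed (use zero monomial in auto)
qed

lemma monomial_in [simp]: "a \<in> carrier K \<Longrightarrow> m \<in> carrier M \<Longrightarrow> monomial K a m \<in> carrier A"
  by (simp add: K.finsupp_monomial)

lemma zero_in [simp]: "(\<lambda>x. \<zero>\<^bsub>K\<^esub>) \<in> carrier A"
  by (simp add: K.finsupp_zero)

lemma add_in [simp]: "f \<in> carrier A \<Longrightarrow> g \<in> carrier A \<Longrightarrow> f \<oplus>\<^bsub>A\<^esub> g \<in> carrier A"
  by (simp add: K.finsupp_add)

text \<open>Associativity is reduced to monomials in one factor after the other, where it is associativity in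
  \<open>K\<close> and in \<open>M\<close>.\<close>
lemma mult_assoc:
  assumes f: "f \<in> carrier A" and g: "g \<in> carrier A" and h: "h \<in> carrier A"
  shows "f \<otimes>\<^bsub>A\<^esub> g \<otimes>\<^bsub>A\<^esub> h = f \<otimes>\<^bsub>A\<^esub> (g \<otimes>\<^bsub>A\<^esub> h)"
proof -
  note [simp del] = monoid_algebra_simps
  have 1: "monomial K a m \<otimes>\<^bsub>A\<^esub> monomial K b m' \<otimes>\<^bsub>A\<^esub> h =
      monomial K a m \<otimes>\<^bsub>A\<^esub> (monomial K b m' \<otimes>\<^bsub>A\<^esub> h)"
    if "a \<in> carrier K" "m \<in> carrier M" "b \<in> carrier K" "m' \<in> carrier M" for a m b m'
    by (rule additive_eqI[OF _ _ _ _ h, where add_op = "\<lambda>f g. f \<oplus>\<^bsub>A\<^esub> g"])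
      (use that in \<open>simp_all add: mult_zero mult_closed mult_monomial mult_add_right K.m_assoc M.m_assoc\<close>)
  have 2: "monomial K a m \<otimes>\<^bsub>A\<^esub> g \<otimes>\<^bsub>A\<^esub> h = monomial K a m \<otimes>\<^bsub>A\<^esub> (g \<otimes>\<^bsub>A\<^esub> h)"
    if "a \<in> carrier K" "m \<in> carrier M" for a m
    by (rule additive_eqI[OF _ _ _ _ g, where add_op = "\<lambda>f g. f \<oplus>\<^bsub>A\<^esub> g"])
      (use that h in \<open>simp_all add: 1 mult_zero mult_closed mult_add_right mult_add_left\<close>)
  show ?thesis
    by (rule additive_eqI[OF _ _ _ _ f, where add_op = "\<lambda>f g. f \<oplus>\<^bsub>A\<^esub> g"])
      (use g h in \<open>simp_all add: 2 mult_zero mult_closed mult_add_left\<close>)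
qed

lemma mult_one:
  assumes f: "f \<in> carrier A"
  shows "\<one>\<^bsub>A\<^esub> \<otimes>\<^bsub>A\<^esub> f = f" "f \<otimes>\<^bsub>A\<^esub> \<one>\<^bsub>A\<^esub> = f"
proof -
  have one: "\<one>\<^bsub>A\<^esub> = monomial K \<one>\<^bsub>K\<^esub> \<one>\<^bsub>M\<^esub>" by simp
  note [simp del] = monoid_algebra_simps
  show "\<one>\<^bsub>A\<^esub> \<otimes>\<^bsub>A\<^esub> f = f"
    by (rule additive_eqI[OF _ _ _ _ f, where add_op = "\<lambda>f g. f \<oplus>\<^bsub>A\<^esub> g"])
      (simp_all add: one mult_zero mult_monomial mult_add_right)
  show "f \<otimes>\<^bsub>A\<^esub> \<one>\<^bsub>A\<^esub> = f"
    by (rule additive_eqI[OF _ _ _ _ f, where add_op = "\<lambda>f g. f \<oplus>\<^bsub>A\<^esub> g"])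
      (simp_all add: one mult_zero mult_monomial mult_add_left)
qed

lemma monoid_algebra_ring: "ring A"
proof (rule ringI)
  interpret F: module K "free_module K (carrier M)" by (rule K.free_module_is_module)
  show "abelian_group A"
    by (rule abelian_group_cong[OF F.M.abelian_group_axioms]) simp_all
  show "monoid A"
    by (rule monoidI) (simp_all only: mult_closed mult_assoc mult_one, simp add: K.finsupp_monomial)
qed (simp_all only: mult_add_left mult_add_right)

end

lemma with_smult_simps [simp]:
  "carrier (with_smult M s) = carrier M"
  "\<zero>\<^bsub>with_smult M s\<^esub> = \<zero>\<^bsub>M\<^esub>"
  "x \<oplus>\<^bsub>with_smult M s\<^esub> y = x \<oplus>\<^bsub>M\<^esub> y"
  "a \<odot>\<^bsub>with_smult M s\<^esub> x = s a x"
  by (simp_all add: with_smult_def)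

lemma with_smult_abelian_group:
  assumes "abelian_group M"
  shows "abelian_group (with_smult M s)"
  by (rule abelian_group_cong[OF assms]) simp_all

context monoid_alg
begin

text \<open>The element \<open>\<Sum> \<alpha>\<^sub>m m\<close> acts as \<open>\<Sum> \<alpha>\<^sub>m \<rho>(m)\<close>; multiplicativity is checked on monomials.\<close>
lemma representation_extends:
  assumes Z: "module K Z"
    and hom: "\<And>m. m \<in> carrier M \<Longrightarrow> \<rho> m \<in> module_hom K Z Z"
    and one: "\<And>z. z \<in> carrier Z \<Longrightarrow> \<rho> \<one>\<^bsub>M\<^esub> z = z"
    and mult: "\<And>m m' z. m \<in> carrier M \<Longrightarrow> m' \<in> carrier M \<Longrightarrow> z \<in> carrier Z \<Longrightarrow>
      \<rho> (m \<otimes>\<^bsub>M\<^esub> m') z = \<rho> m (\<rho> m' z)"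
  shows "\<exists>\<sigma>. left_module A (with_smult Z \<sigma>) \<and>
    (\<forall>a\<in>carrier K. \<forall>m\<in>carrier M. \<forall>z\<in>carrier Z. \<sigma> (monomial K a m) z = a \<odot>\<^bsub>Z\<^esub> \<rho> m z)"
proof -
  interpret Z: module K Z by fact
  define \<sigma> where "\<sigma> = (\<lambda>f z. lin_ext K Z (\<lambda>m. \<rho> m z) f)"
  have rho: "\<rho> m z \<in> carrier Z" if "m \<in> carrier M" "z \<in> carrier Z" for m z
    using module_hom_in[OF hom] that by blast
  have s_hom: "(\<lambda>f. \<sigma> f z) \<in> module_hom K (free_module K (carrier M)) Z" if "z \<in> carrier Z" for z
    unfolding \<sigma>_def using rho that by (intro Z.lin_ext_hom) auto
  have mon: "\<sigma> (monomial K a m) z = a \<odot>\<^bsub>Z\<^esub> \<rho> m z"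
    if "a \<in> carrier K" "m \<in> carrier M" "z \<in> carrier Z" for a m z
    unfolding \<sigma>_def using rho that by (intro Z.lin_ext_monomial[OF that(1,2)]) auto
  have s_in: "\<sigma> f z \<in> carrier Z" if "f \<in> carrier A" "z \<in> carrier Z" for f z
    using module_hom_in[OF s_hom[OF that(2)]] that(1) by simp
  have s_add: "\<sigma> (f \<oplus>\<^bsub>A\<^esub> g) z = \<sigma> f z \<oplus>\<^bsub>Z\<^esub> \<sigma> g z"
    if "f \<in> carrier A" "g \<in> carrier A" "z \<in> carrier Z" for f g z
    using module_hom_add[OF s_hom[OF that(3)], of f g] that(1,2) by simp
  have s_zero: "\<sigma> (\<lambda>x. \<zero>\<^bsub>K\<^esub>) z = \<zero>\<^bsub>Z\<^esub>" if "z \<in> carrier Z" for z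
    using module_hom_zero[OF K.free_module_is_module Z s_hom[OF that]] by simp
  note [simp del] = monoid_algebra_simps
  have s_add_r: "\<sigma> f (y \<oplus>\<^bsub>Z\<^esub> z) = \<sigma> f y \<oplus>\<^bsub>Z\<^esub> \<sigma> f z"
    if f: "f \<in> carrier A" and y: "y \<in> carrier Z" and z: "z \<in> carrier Z" for f y z
  proof (rule additive_eqI[OF _ _ _ _ f, where add_op = "\<lambda>y z. y \<oplus>\<^bsub>Z\<^esub> z"])
    fix a m assume "a \<in> carrier K" "m \<in> carrier M"
    then show "\<sigma> (monomial K a m) (y \<oplus>\<^bsub>Z\<^esub> z) = \<sigma> (monomial K a m) y \<oplus>\<^bsub>Z\<^esub> \<sigma> (monomial K a m) z"
      using y z by (simp add: mon module_hom_add[OF hom] Z.smult_r_distr rho)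
  next
    fix f g assume "f \<in> carrier A" "g \<in> carrier A"
    then show "\<sigma> (f \<oplus>\<^bsub>A\<^esub> g) y \<oplus>\<^bsub>Z\<^esub> \<sigma> (f \<oplus>\<^bsub>A\<^esub> g) z = (\<sigma> f y \<oplus>\<^bsub>Z\<^esub> \<sigma> f z) \<oplus>\<^bsub>Z\<^esub> (\<sigma> g y \<oplus>\<^bsub>Z\<^esub> \<sigma> g z)"
      using y z s_in by (simp add: s_add Z.M.a_ac)
  qed (use y z in \<open>simp_all add: s_zero s_add\<close>)
  have smult_zero: "\<sigma> f \<zero>\<^bsub>Z\<^esub> = \<zero>\<^bsub>Z\<^esub>" if f: "f \<in> carrier A" for f
    using s_add_r[OF f, of "\<zero>\<^bsub>Z\<^esub>" "\<zero>\<^bsub>Z\<^esub>"] s_in[OF f, of "\<zero>\<^bsub>Z\<^esub>"] by simp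
  have mon_mult: "\<sigma> (monomial K a m \<otimes>\<^bsub>A\<^esub> g) z = \<sigma> (monomial K a m) (\<sigma> g z)"
    if am: "a \<in> carrier K" "m \<in> carrier M" and g: "g \<in> carrier A" and z: "z \<in> carrier Z" for a m g z
  proof (rule additive_eqI[OF _ _ _ _ g, where add_op = "\<lambda>y z. y \<oplus>\<^bsub>Z\<^esub> z"])
    fix b m' assume "b \<in> carrier K" "m' \<in> carrier M"
    then show "\<sigma> (monomial K a m \<otimes>\<^bsub>A\<^esub> monomial K b m') z = \<sigma> (monomial K a m) (\<sigma> (monomial K b m') z)"
      using am z by (simp add: mult_monomial mon mult rho module_hom_smult[OF hom] Z.smult_assoc1)
  qed (use am z in \<open>simp_all add: s_zero s_add mult_zero mult_add_right mult_closed smult_zero s_add_r s_in\<close>)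
  have assoc: "\<sigma> (f \<otimes>\<^bsub>A\<^esub> g) z = \<sigma> f (\<sigma> g z)"
    if f: "f \<in> carrier A" and g: "g \<in> carrier A" and z: "z \<in> carrier Z" for f g z
    by (rule additive_eqI[OF _ _ _ _ f, where add_op = "\<lambda>y z. y \<oplus>\<^bsub>Z\<^esub> z"])
      (use g z in \<open>simp_all add: s_zero s_add mult_zero mult_add_left mult_closed mon_mult s_in\<close>)
  have "left_module A (with_smult Z \<sigma>)"
  proof (intro left_module.intro left_module_axioms.intro monoid_algebra_ring with_smult_abelian_group
      Z.M.abelian_group_axioms)
    fix z assume "z \<in> carrier (with_smult Z \<sigma>)"
    then show "\<one>\<^bsub>A\<^esub> \<odot>\<^bsub>with_smult Z \<sigma>\<^esub> z = z"
      by (simp add: monoid_algebra_simps mon one)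
  qed (simp_all add: s_in s_add s_add_r assoc)
  with mon show ?thesis by blast
qed

lemma underlying_space_module:
  assumes U: "left_module A U"
  shows "module K (underlying_space K M U)"
proof -
  interpret U: left_module A U by fact
  note [simp] = U.smult_closed monomial_in[unfolded monoid_algebra_simps]
  have closed: "monomial K a \<one>\<^bsub>M\<^esub> \<in> carrier A" if "a \<in> carrier K" for a
    using that by (simp only: monomial_in M.one_closed)
  show ?thesis
  proof (rule moduleI)
    show "abelian_group (underlying_space K M U)"
      unfolding underlying_space_def by (rule with_smult_abelian_group[OF U.M.abelian_group_axioms])
    fix a b u assume ab: "a \<in> carrier K" "b \<in> carrier K" and "u \<in> carrier (underlying_space K M U)"
    then have u: "u \<in> carrier U" by (simp add: underlying_space_def)
    show "(a \<oplus>\<^bsub>K\<^esub> b) \<odot>\<^bsub>underlying_space K M U\<^esub> u =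
        a \<odot>\<^bsub>underlying_space K M U\<^esub> u \<oplus>\<^bsub>underlying_space K M U\<^esub> b \<odot>\<^bsub>underlying_space K M U\<^esub> u"
      using U.smult_l_distr[OF closed[OF ab(1)] closed[OF ab(2)] u]
      by (simp add: underlying_space_def K.add_monomial)
    show "(a \<otimes>\<^bsub>K\<^esub> b) \<odot>\<^bsub>underlying_space K M U\<^esub> u =
        a \<odot>\<^bsub>underlying_space K M U\<^esub> (b \<odot>\<^bsub>underlying_space K M U\<^esub> u)"
      using U.smult_assoc[OF closed[OF ab(1)] closed[OF ab(2)] u] ab
      by (simp add: underlying_space_def mult_monomial)
  next
    fix a u v assume a: "a \<in> carrier K" and "u \<in> carrier (underlying_space K M U)"
      "v \<in> carrier (underlying_space K M U)"
    then have uv: "u \<in> carrier U" "v \<in> carrier U" by (simp_all add: underlying_space_def)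
    show "a \<odot>\<^bsub>underlying_space K M U\<^esub> (u \<oplus>\<^bsub>underlying_space K M U\<^esub> v) =
        a \<odot>\<^bsub>underlying_space K M U\<^esub> u \<oplus>\<^bsub>underlying_space K M U\<^esub> a \<odot>\<^bsub>underlying_space K M U\<^esub> v"
      using U.smult_r_distr[OF closed[OF a] uv] by (simp add: underlying_space_def)
    show "a \<odot>\<^bsub>underlying_space K M U\<^esub> u \<in> carrier (underlying_space K M U)"
      using U.smult_closed[OF closed[OF a] uv(1)] by (simp add: underlying_space_def)
  next
    fix u assume "u \<in> carrier (underlying_space K M U)"
    then have u: "u \<in> carrier U" by (simp add: underlying_space_def)
    show "\<one>\<^bsub>K\<^esub> \<odot>\<^bsub>underlying_space K M U\<^esub> u = u"
      using U.smult_one[OF u] by (simp add: underlying_space_def)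
  qed (rule K.cring_axioms)
qed

text \<open>Elements of the monoid act linearly because the scalars, being multiples of \<open>1\<close>, commute with them.\<close>
lemma underlying_space_hom:
  assumes U: "left_module A U" and m: "m \<in> carrier M"
  shows "(\<lambda>u. monomial K \<one>\<^bsub>K\<^esub> m \<odot>\<^bsub>U\<^esub> u) \<in>
    module_hom K (underlying_space K M U) (underlying_space K M U)"
proof -
  interpret U: left_module A U by fact
  have 1: "monomial K \<one>\<^bsub>K\<^esub> m \<in> carrier A"
    using m by (simp only: monomial_in K.one_closed)
  show ?thesis
  proof (rule module_homI)
    fix a u assume a: "a \<in> carrier K" and "u \<in> carrier (underlying_space K M U)"
    then have u: "u \<in> carrier U" by (simp add: underlying_space_def)
    have 2: "monomial K a \<one>\<^bsub>M\<^esub> \<in> carrier A" using a by (simp only: monomial_in M.one_closed)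
    have "monomial K \<one>\<^bsub>K\<^esub> m \<otimes>\<^bsub>A\<^esub> monomial K a \<one>\<^bsub>M\<^esub> = monomial K a \<one>\<^bsub>M\<^esub> \<otimes>\<^bsub>A\<^esub> monomial K \<one>\<^bsub>K\<^esub> m"
      using a m by (simp add: mult_monomial)
    then show "monomial K \<one>\<^bsub>K\<^esub> m \<odot>\<^bsub>U\<^esub> (a \<odot>\<^bsub>underlying_space K M U\<^esub> u) =
        a \<odot>\<^bsub>underlying_space K M U\<^esub> (monomial K \<one>\<^bsub>K\<^esub> m \<odot>\<^bsub>U\<^esub> u)"
      using U.smult_assoc[OF 1 2 u] U.smult_assoc[OF 2 1 u] by (simp add: underlying_space_def)
  qed (use U.smult_closed[OF 1] U.smult_r_distr[OF 1] in \<open>simp_all add: underlying_space_def\<close>)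
qed

end

lemma (in left_module) minus_smult_eq_zero_iff:
  assumes x: "x \<in> carrier R" and y: "y \<in> carrier R" and u: "u \<in> carrier M"
  shows "(x \<ominus>\<^bsub>R\<^esub> y) \<odot>\<^bsub>M\<^esub> u = \<zero>\<^bsub>M\<^esub> \<longleftrightarrow> x \<odot>\<^bsub>M\<^esub> u = y \<odot>\<^bsub>M\<^esub> u"
proof -
  have xy: "x \<ominus>\<^bsub>R\<^esub> y \<in> carrier R" using x y by simp
  have "x = (x \<ominus>\<^bsub>R\<^esub> y) \<oplus>\<^bsub>R\<^esub> y" using x y by (simp add: R.minus_eq R.a_assoc R.l_neg)
  then have eq: "x \<odot>\<^bsub>M\<^esub> u = (x \<ominus>\<^bsub>R\<^esub> y) \<odot>\<^bsub>M\<^esub> u \<oplus>\<^bsub>M\<^esub> y \<odot>\<^bsub>M\<^esub> u"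
    using smult_l_distr[OF xy y u] by simp
  show ?thesis unfolding eq using smult_closed[OF xy u] smult_closed[OF y u]
    by (simp add: M.add.r_cancel_one)
qed

lemma (in left_module) commutator_smult_iff:
  assumes x: "x \<in> carrier R" and y: "y \<in> carrier R" and u: "u \<in> carrier M"
  shows "(x \<otimes>\<^bsub>R\<^esub> y \<ominus>\<^bsub>R\<^esub> y \<otimes>\<^bsub>R\<^esub> x) \<odot>\<^bsub>M\<^esub> u = \<zero>\<^bsub>M\<^esub> \<longleftrightarrow>
    x \<odot>\<^bsub>M\<^esub> (y \<odot>\<^bsub>M\<^esub> u) = y \<odot>\<^bsub>M\<^esub> (x \<odot>\<^bsub>M\<^esub> u)"
  using minus_smult_eq_zero_iff[of "x \<otimes>\<^bsub>R\<^esub> y" "y \<otimes>\<^bsub>R\<^esub> x" u] smult_assoc assms by simp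

context monoid_alg
begin

lemma monomial_carrier: "a \<in> carrier K \<Longrightarrow> m \<in> carrier M \<Longrightarrow> monomial K a m \<in> carrier A"
  by (simp add: K.finsupp_monomial)

lemma monomial_mult_smult:
  assumes U: "left_module A U" and m: "m \<in> carrier M" "m' \<in> carrier M" and u: "u \<in> carrier U"
  shows "monomial K \<one>\<^bsub>K\<^esub> (m \<otimes>\<^bsub>M\<^esub> m') \<odot>\<^bsub>U\<^esub> u =
    monomial K \<one>\<^bsub>K\<^esub> m \<odot>\<^bsub>U\<^esub> (monomial K \<one>\<^bsub>K\<^esub> m' \<odot>\<^bsub>U\<^esub> u)"
proof -
  interpret U: left_module A U by fact
  show ?thesis
    using U.smult_assoc[OF monomial_carrier[OF K.one_closed m(1)] monomial_carrier[OF K.one_closed m(2)] u]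
      mult_monomial[OF K.one_closed K.one_closed m] by simp
qed

lemma monomial_smult:
  assumes U: "left_module A U" and a: "a \<in> carrier K" and m: "m \<in> carrier M" and u: "u \<in> carrier U"
  shows "monomial K a m \<odot>\<^bsub>U\<^esub> u = monomial K a \<one>\<^bsub>M\<^esub> \<odot>\<^bsub>U\<^esub> (monomial K \<one>\<^bsub>K\<^esub> m \<odot>\<^bsub>U\<^esub> u)"
proof -
  interpret U: left_module A U by fact
  show ?thesis
    using U.smult_assoc[OF monomial_carrier[OF a M.one_closed] monomial_carrier[OF K.one_closed m] u]
      mult_monomial[OF a K.one_closed M.one_closed m] a m by simp
qed

text \<open>A nonzero submodule contains every basis vector that can be reached from one of its elements, and it is
  closed under the scalars, so it is everything.\<close>
lemma simple_if_reaches_basis: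
  assumes Z: "vectorspace K Z" and W: "left_module A (with_smult Z \<sigma>)"
    and scalar: "\<And>a z. a \<in> carrier K \<Longrightarrow> z \<in> carrier Z \<Longrightarrow> \<sigma> (monomial K a \<one>\<^bsub>M\<^esub>) z = a \<odot>\<^bsub>Z\<^esub> z"
    and b: "basis_family K Z I b" and I: "I \<noteq> {}"
    and reach: "\<And>z i. z \<in> carrier Z \<Longrightarrow> z \<noteq> \<zero>\<^bsub>Z\<^esub> \<Longrightarrow> i \<in> I \<Longrightarrow> \<exists>x\<in>carrier A. \<sigma> x z = b i"
  shows "simple_left_module A (with_smult Z \<sigma>)"
proof -
  interpret Z: vectorspace K Z by fact
  have bI: "b \<in> I \<rightarrow> carrier Z" using b by (simp add: Z.basis_family_iff)
  show ?thesis
    unfolding simple_left_module_def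
  proof (intro conjI allI impI W)
    obtain i where "i \<in> I" using I by blast
    then have "b i \<in> carrier Z" "b i \<noteq> \<zero>\<^bsub>Z\<^esub>" using bI basis_nonzero[OF Z b] by auto
    then show "carrier (with_smult Z \<sigma>) \<noteq> {\<zero>\<^bsub>with_smult Z \<sigma>\<^esub>}" by auto
  next
    fix H assume H: "Module.submodule H A (with_smult Z \<sigma>)"
    interpret H: Module.submodule H A "with_smult Z \<sigma>" by fact
    have sub: "H \<subseteq> carrier Z" and zero: "\<zero>\<^bsub>Z\<^esub> \<in> H"
      and add: "\<And>x y. x \<in> H \<Longrightarrow> y \<in> H \<Longrightarrow> x \<oplus>\<^bsub>Z\<^esub> y \<in> H"
      and act: "\<And>x z. x \<in> carrier A \<Longrightarrow> z \<in> H \<Longrightarrow> \<sigma> x z \<in> H"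
      using H.subset H.one_closed H.m_closed H.smult_closed by simp_all
    show "H = {\<zero>\<^bsub>with_smult Z \<sigma>\<^esub>} \<or> H = carrier (with_smult Z \<sigma>)"
    proof (cases "H = {\<zero>\<^bsub>Z\<^esub>}")
      case False
      then obtain z where z: "z \<in> H" "z \<noteq> \<zero>\<^bsub>Z\<^esub>" using zero by blast
      have bH: "b i \<in> H" if i: "i \<in> I" for i
      proof -
        obtain x where "x \<in> carrier A" "\<sigma> x z = b i" using reach[OF _ z(2) i] z(1) sub by blast
        then show ?thesis using act[OF _ z(1)] by force
      qed
      have "v \<in> H" if "v \<in> carrier Z" for v
        using Z b that
      proof (induction rule: basis_induct)
        case (smult a i)
        have "b i \<in> carrier Z" using bH[OF smult(2)] sub by blast
        then show ?case
          using scalar[OF smult(1)] act[OF monomial_carrier[OF smult(1) M.one_closed] bH[OF smult(2)]]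
          by simp
      qed (use zero add in auto)
      with sub show ?thesis by auto
    qed simp
  qed
qed

end

section \<open>The Chinese monoid\<close>

definition chinese_class :: "nat \<Rightarrow> nat list \<Rightarrow> nat list set" where
  "chinese_class n u = word_class {1..n} (chinese_rels n) u"

lemma chinese_rels_lists:
  assumes "(u, v) \<in> chinese_rels n"
  shows "u \<in> lists {1..n} \<and> v \<in> lists {1..n}"
  using assms by (auto simp: chinese_rels_def)

lemma chinese_class_eqI:
  assumes "(u, v) \<in> chinese_rels n"
  shows "chinese_class n u = chinese_class n v"
  using chinese_rels_lists[OF assms] monoid_cong.rel[OF assms, of "[]" "[]"]
  by (simp only: chinese_class_def word_class_eq_iff append.simps append_Nil2)

lemma chinese_monoid_is_monoid: "monoid (chinese_monoid n)"
  unfolding chinese_monoid_def by (rule presented_monoid_is_monoid)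

lemma chinese_monoid_carrier: "carrier (chinese_monoid n) = chinese_class n ` lists {1..n}"
  unfolding chinese_monoid_def chinese_class_def by (rule presented_monoid_carrier)

lemma chinese_monoid_one: "\<one>\<^bsub>chinese_monoid n\<^esub> = chinese_class n []"
  unfolding chinese_monoid_def chinese_class_def by (rule presented_monoid_one)

lemma chinese_monoid_mult:
  "u \<in> lists {1..n} \<Longrightarrow> v \<in> lists {1..n} \<Longrightarrow>
    chinese_class n u \<otimes>\<^bsub>chinese_monoid n\<^esub> chinese_class n v = chinese_class n (u @ v)"
  unfolding chinese_monoid_def chinese_class_def by (rule presented_monoid_mult)

lemma chinese_gen_eq: "chinese_gen n j = chinese_class n [j]"
  by (simp add: chinese_gen_def chinese_class_def)

lemma lists_subset: "G \<subseteq> H \<Longrightarrow> u \<in> lists G \<Longrightarrow> u \<in> lists H"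
  using lists_mono by blast

text \<open>The classes of words in the chosen generators form a submonoid, and each of them is a product of these
  generators.\<close>
lemma submonoid_generated:
  assumes G: "G \<subseteq> {1..n}"
  shows "(\<lambda>H. submonoid H (chinese_monoid n)) hull (chinese_gen n ` G) = chinese_class n ` lists G"
    and "submonoid (chinese_class n ` lists G) (chinese_monoid n)"
proof -
  note sub = lists_subset[OF G]
  show sm: "submonoid (chinese_class n ` lists G) (chinese_monoid n)"
  proof
    show "chinese_class n ` lists G \<subseteq> carrier (chinese_monoid n)"
      unfolding chinese_monoid_carrier using sub by (intro image_mono subsetI)
    fix x y assume "x \<in> chinese_class n ` lists G" "y \<in> chinese_class n ` lists G"
    then obtain u v where uv: "x = chinese_class n u" "y = chinese_class n v" "u \<in> lists G" "v \<in> lists G"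
      by (elim imageE)
    then have "u @ v \<in> lists G" by simp
    then show "x \<otimes>\<^bsub>chinese_monoid n\<^esub> y \<in> chinese_class n ` lists G"
      using uv sub by (simp add: chinese_monoid_mult)
  next
    show "\<one>\<^bsub>chinese_monoid n\<^esub> \<in> chinese_class n ` lists G" by (simp add: chinese_monoid_one)
  qed
  show "(\<lambda>H. submonoid H (chinese_monoid n)) hull (chinese_gen n ` G) = chinese_class n ` lists G"
  proof (rule hull_unique)
    show "submonoid (chinese_class n ` lists G) (chinese_monoid n)" by (rule sm)
    show "chinese_gen n ` G \<subseteq> chinese_class n ` lists G"
      by (auto simp: chinese_gen_eq intro!: imageI)
  next
    fix H assume gens: "chinese_gen n ` G \<subseteq> H" and H: "submonoid H (chinese_monoid n)"
    have "chinese_class n u \<in> H" if "set u \<subseteq> G" for u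
      using that
    proof (induction u)
      case Nil
      show ?case using submonoid.one_closed[OF H] by (simp add: chinese_monoid_one)
    next
      case (Cons j u)
      then have "[j] \<in> lists {1..n}" "u \<in> lists {1..n}" using G by (auto simp: lists_eq_set)
      then have "chinese_class n (j # u) = chinese_gen n j \<otimes>\<^bsub>chinese_monoid n\<^esub> chinese_class n u"
        using chinese_monoid_mult[of "[j]" n u] by (simp add: chinese_gen_eq)
      moreover have "chinese_gen n j \<in> H" using gens Cons.prems by auto
      ultimately show ?case using submonoid.m_closed[OF H] Cons by simp
    qed
    then show "chinese_class n ` lists G \<subseteq> H" by (auto simp: lists_eq_set)
  qed
qed

lemma chinese_submonoid_carrier:
  "carrier (chinese_submonoid n s) = chinese_class n ` lists ({1..n} - {s, s + 1})"
  unfolding chinese_submonoid_def by (simp add: submonoid_generated(1))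

lemma chinese_submonoid_is_monoid: "monoid (chinese_submonoid n s)"
proof -
  have "submonoid (chinese_class n ` lists ({1..n} - {s, s + 1})) (chinese_monoid n)"
    by (rule submonoid_generated(2)) blast
  from submonoid.submonoid_is_monoid[OF this chinese_monoid_is_monoid] show ?thesis
    unfolding chinese_submonoid_def by (simp add: submonoid_generated(1))
qed

lemma chinese_submonoid_simps:
  "\<one>\<^bsub>chinese_submonoid n s\<^esub> = \<one>\<^bsub>chinese_monoid n\<^esub>"
  "x \<otimes>\<^bsub>chinese_submonoid n s\<^esub> y = x \<otimes>\<^bsub>chinese_monoid n\<^esub> y"
  by (simp_all add: chinese_submonoid_def)

text \<open>Stated for any monoid sharing its operations with the Chinese monoid, so that it covers the action of the
  submonoid on \<open>U\<close> as well as that of the full monoid on \<open>W\<close>.\<close>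
lemma chinese_word_smult:
  assumes M: "monoid_alg K M" and U: "left_module (monoid_algebra K M) U" and G: "G \<subseteq> {1..n}"
    and carrier: "carrier M = chinese_class n ` lists G"
    and one: "\<one>\<^bsub>M\<^esub> = \<one>\<^bsub>chinese_monoid n\<^esub>"
    and mult: "\<And>x y. x \<otimes>\<^bsub>M\<^esub> y = x \<otimes>\<^bsub>chinese_monoid n\<^esub> y"
    and ws: "set ws \<subseteq> G" and u: "u \<in> carrier U"
  shows "monomial K \<one>\<^bsub>K\<^esub> (chinese_class n ws) \<odot>\<^bsub>U\<^esub> u =
    foldr (\<lambda>j z. gen_elem K n j \<odot>\<^bsub>U\<^esub> z) ws u"
  using ws
proof (induction ws)
  case Nil
  interpret U: left_module "monoid_algebra K M" U by fact
  show ?case using U.smult_one[OF u] by (simp add: one chinese_monoid_one)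
next
  case (Cons j ws)
  have mem: "chinese_class n [j] \<in> carrier M" "chinese_class n ws \<in> carrier M"
    using Cons.prems by (auto simp: carrier lists_eq_set)
  have "chinese_class n (j # ws) = chinese_class n [j] \<otimes>\<^bsub>M\<^esub> chinese_class n ws"
    unfolding mult using Cons.prems G by (subst chinese_monoid_mult) (auto simp: lists_eq_set)
  then show ?case
    using monoid_alg.monomial_mult_smult[OF M U mem u] Cons by (simp add: gen_elem_def chinese_gen_eq)
qed

section \<open>The operators on the tensor product\<close>

lemma replicate_in_lists: "a \<in> G \<Longrightarrow> replicate k a \<in> lists G"
  by (induction k) auto

declare foldr_replicate [simp del]

text \<open>\<open>B\<close> is the given action of the generators on \<open>U\<close>, and \<open>A\<close> completes it by the scalar \<open>lam\<close> at index \<open>s\<close> and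
  by the identity at \<open>s + 1\<close>. The maps \<open>up\<close> and \<open>down\<close> are the two shifts of \<open>V\<close>, and \<open>T j\<close> is the tensor
  product of \<open>A j\<close> with the appropriate shift.\<close>
locale chinese_tensor = tensor K U V + field K
  for K :: "('a, 'b) ring_scheme" and U :: "('a, 'u, 'c) module_scheme"
    and V :: "('a, 'v, 'd) module_scheme" +
  fixes s n :: nat and f :: "nat \<Rightarrow> 'v" and lam :: 'a
    and B :: "nat \<Rightarrow> 'u \<Rightarrow> 'u" and A :: "nat \<Rightarrow> 'u \<Rightarrow> 'u" and up down :: "'v \<Rightarrow> 'v"
    and T :: "nat \<Rightarrow> ('u \<times> 'v \<Rightarrow> 'a) set \<Rightarrow> ('u \<times> 'v \<Rightarrow> 'a) set"
  assumes s: "1 \<le> s" and n: "n = 2 * s"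
    and f: "basis_family K V UNIV f"
    and lam: "lam \<in> carrier K" "lam \<noteq> \<zero>\<^bsub>K\<^esub>"
    and B: "\<And>j. j \<in> {1..n} - {s, s + 1} \<Longrightarrow> B j \<in> module_hom K U U"
    and B_rels: "\<And>u v z. (u, v) \<in> chinese_rels n \<Longrightarrow> u \<in> lists ({1..n} - {s, s + 1}) \<Longrightarrow>
        v \<in> lists ({1..n} - {s, s + 1}) \<Longrightarrow> z \<in> carrier U \<Longrightarrow> foldr B u z = foldr B v z"
    and B_comm: "\<And>i j z. (i \<in> {1..<s} \<and> j \<in> {1..<s}) \<or> (i \<in> {s+2..n} \<and> j \<in> {s+2..n}) \<Longrightarrow>
        z \<in> carrier U \<Longrightarrow> B i (B j z) = B j (B i z)"
    and A_def: "A = (\<lambda>j z. if j = s then lam \<odot>\<^bsub>U\<^esub> z else if j = s + 1 then z else B j z)"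
    and up: "up \<in> module_hom K V V" "\<And>i. up (f i) = f (Suc i)"
    and down: "down \<in> module_hom K V V" "down (f 0) = \<zero>\<^bsub>V\<^esub>" "\<And>i. down (f (Suc i)) = f i"
    and T: "\<And>j. j \<in> {1..n} \<Longrightarrow> T j \<in> module_hom K W W"
    and T_pure: "\<And>j u v. j \<in> {1..n} \<Longrightarrow> u \<in> carrier U \<Longrightarrow> v \<in> carrier V \<Longrightarrow>
        T j (t u v) = t (A j u) (if j \<le> s then up v else down v)"
begin

lemma f_in [simp]: "f i \<in> carrier V"
proof -
  interpret V': vectorspace K V by (simp add: vectorspace_def V.module_axioms field_axioms)
  show ?thesis using f by (auto simp: V'.basis_family_iff)
qed

lemma V_space: "vectorspace K V"
  by (simp add: vectorspace_def V.module_axioms field_axioms)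

lemmas up_in [simp] = module_hom_in[OF up(1)] and down_in [simp] = module_hom_in[OF down(1)]

lemma down_up: "v \<in> carrier V \<Longrightarrow> down (up v) = v"
  by (rule basis_hom_eqI[OF V_space f V.module_axioms module_hom_comp[OF up(1) down(1)] module_hom_id])
    (simp_all add: up down)

lemma A_hom: "j \<in> {1..n} \<Longrightarrow> A j \<in> module_hom K U U"
  using B[of j] module_hom_smult_const[OF U.module_axioms lam(1)] module_hom_id[of K U]
  by (cases "j = s"; cases "j = s + 1") (simp_all add: A_def)

lemma A_in [simp]: "j \<in> {1..n} \<Longrightarrow> z \<in> carrier U \<Longrightarrow> A j z \<in> carrier U"
  using module_hom_in[OF A_hom] by blast

lemma A_comm_s: "j \<in> {1..n} \<Longrightarrow> z \<in> carrier U \<Longrightarrow> A j (A s z) = A s (A j z)"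
  using module_hom_smult[OF A_hom, of j lam z] lam by (simp add: A_def)

lemma A_comm:
  assumes "(i \<in> {1..s} \<and> j \<in> {1..s}) \<or> (i \<in> {s+1..n} \<and> j \<in> {s+1..n})" and z: "z \<in> carrier U"
  shows "A i (A j z) = A j (A i z)"
proof (cases "i = s \<or> j = s")
  case True
  have "i \<in> {1..n}" "j \<in> {1..n}" using assms n by auto
  with True z show ?thesis using A_comm_s by metis
next
  case False
  show ?thesis
  proof (cases "i = s + 1 \<or> j = s + 1")
    case True
    then show ?thesis using s by (auto simp: A_def)
  next
    case neq: False
    with False assms have "(i \<in> {1..<s} \<and> j \<in> {1..<s}) \<or> (i \<in> {s+2..n} \<and> j \<in> {s+2..n})" by auto
    from B_comm[OF this z] False neq show ?thesis by (simp add: A_def)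
  qed
qed

text \<open>At \<open>j = s\<close> or \<open>k = s + 1\<close> one of the operators is a scalar; otherwise this is the first Chinese relation,
  which holds on \<open>U\<close>.\<close>
lemma A_rel_low:
  assumes ij: "1 \<le> i" "i \<le> j" "j \<le> s" and k: "s < k" "k \<le> n" and z: "z \<in> carrier U"
  shows "A j (A k (A i z)) = A k (A j (A i z))"
proof -
  have mem: "i \<in> {1..n}" "j \<in> {1..n}" "k \<in> {1..n}" using assms n by auto
  consider "j = s" | "k = s + 1" | "j < s" "s + 1 < k" using ij k by linarith
  then show ?thesis
  proof cases
    case 1
    then show ?thesis using A_comm_s[OF mem(3), of "A i z"] mem z by simp
  next
    case 2
    then show ?thesis using s by (simp add: A_def)
  next
    case 3
    have "([j, k, i], [k, j, i]) \<in> chinese_rels n"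
      using ij k by (auto simp: chinese_rels_def)
    from B_rels[OF this _ _ z] 3 ij k show ?thesis by (simp add: A_def)
  qed
qed

text \<open>The same dichotomy, now with the second Chinese relation.\<close>
lemma A_rel_high:
  assumes i: "1 \<le> i" "i \<le> s" and jk: "s < j" "j \<le> k" "k \<le> n" and z: "z \<in> carrier U"
  shows "A k (A j (A i z)) = A k (A i (A j z))"
proof -
  have mem: "i \<in> {1..n}" "j \<in> {1..n}" "k \<in> {1..n}" using assms n by auto
  consider "i = s" | "j = s + 1" | "i < s" "s + 1 < j" using i jk by linarith
  then show ?thesis
  proof cases
    case 1
    then show ?thesis using A_comm_s[OF mem(2) z] by simp
  next
    case 2
    then show ?thesis using s by (simp add: A_def)
  next
    case 3
    have "([k, j, i], [k, i, j]) \<in> chinese_rels n"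
      using i jk by (auto simp: chinese_rels_def)
    from B_rels[OF this _ _ z] 3 i jk show ?thesis by (simp add: A_def)
  qed
qed

lemma T_in [simp]: "j \<in> {1..n} \<Longrightarrow> w \<in> carrier W \<Longrightarrow> T j w \<in> carrier W"
  using module_hom_in[OF T] by blast

lemma foldr_T_hom: "u \<in> lists {1..n} \<Longrightarrow> foldr T u \<in> module_hom K W W"
  using T by (intro foldr_module_hom) auto

lemma T_comm:
  assumes "(i \<in> {1..s} \<and> j \<in> {1..s}) \<or> (i \<in> {s+1..n} \<and> j \<in> {s+1..n})" and w: "w \<in> carrier W"
  shows "T i (T j w) = T j (T i w)"
proof -
  have mem: "i \<in> {1..n}" "j \<in> {1..n}" using assms n by auto
  show ?thesis
    by (rule tensor_hom_eqI[OF W.module_axioms module_hom_comp[OF T T] module_hom_comp[OF T T] _ w])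
      (use assms mem A_comm in \<open>auto simp: T_pure\<close>)
qed

text \<open>On \<open>V\<close>, a mixed relation reads \<open>x y x = y x x\<close> (two indices at most \<open>s\<close>) or \<open>y y x = y x y\<close> (two
  indices above \<open>s\<close>), and both follow from \<open>y x = 1\<close>.\<close>
lemma T_rels:
  assumes "(u, v) \<in> chinese_rels n" and w: "w \<in> carrier W"
  shows "foldr T u w = foldr T v w"
proof -
  from assms(1) obtain i j k where ijk: "1 \<le> i" "i \<le> j" "j \<le> k" "k \<le> n"
    and uv: "(u = [j, k, i] \<and> v = [k, j, i]) \<or> (u = [k, j, i] \<and> v = [k, i, j])"
    by (auto simp: chinese_rels_def)
  have mem: "i \<in> {1..n}" "j \<in> {1..n}" "k \<in> {1..n}" using ijk by auto
  have "foldr T [j, k, i] (t x y) = foldr T [k, j, i] (t x y) \<and>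
      foldr T [k, j, i] (t x y) = foldr T [k, i, j] (t x y)"
    if xy: "x \<in> carrier U" "y \<in> carrier V" for x y
  proof -
    consider "k \<le> s" | "j \<le> s" "s < k" | "i \<le> s" "s < j" | "s < i" using ijk by linarith
    then show ?thesis
    proof cases
      case 1
      then show ?thesis
        using ijk mem xy A_comm[of j k "A i x"] A_comm[of j i x] by (simp add: T_pure)
    next
      case 2
      then show ?thesis
        using ijk mem xy A_rel_low[of i j k x] A_comm[of j i x] by (simp add: T_pure down_up)
    next
      case 3
      then show ?thesis
        using ijk mem xy A_rel_high[of i j k x] A_comm[of j k "A i x"] by (simp add: T_pure down_up)
    next
      case 4
      then show ?thesis
        using ijk mem xy A_comm[of j k "A i x"] A_comm[of j i x] by (simp add: T_pure)
    qed
  qed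
  with uv have pure: "foldr T u (t x y) = foldr T v (t x y)"
    if "x \<in> carrier U" "y \<in> carrier V" for x y using that by auto
  have "u \<in> lists {1..n}" "v \<in> lists {1..n}" using uv mem by auto
  then show ?thesis
    by (intro tensor_hom_eqI[OF W.module_axioms foldr_T_hom foldr_T_hom pure w])
qed

text \<open>The subspaces \<open>U \<otimes> f\<^sub>0 + \<dots> + U \<otimes> f\<^sub>m\<^sub>-\<^sub>1\<close>. They exhaust the tensor product, and
  induction on \<open>m\<close> peels off the top component of a vector.\<close>
primrec filt :: "nat \<Rightarrow> ('u \<times> 'v \<Rightarrow> 'a) set set" where
  "filt 0 = {\<zero>\<^bsub>W\<^esub>}"
| "filt (Suc m) = {x \<oplus>\<^bsub>W\<^esub> t u (f m) | x u. x \<in> filt m \<and> u \<in> carrier U}"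

lemma filt_SucI: "w = x \<oplus>\<^bsub>W\<^esub> t u (f m) \<Longrightarrow> x \<in> filt m \<Longrightarrow> u \<in> carrier U \<Longrightarrow> w \<in> filt (Suc m)"
  by auto

lemma filt_SucE:
  assumes "w \<in> filt (Suc m)"
  obtains x u where "w = x \<oplus>\<^bsub>W\<^esub> t u (f m)" "x \<in> filt m" "u \<in> carrier U"
  using assms by auto

lemma filt_in: "x \<in> filt m \<Longrightarrow> x \<in> carrier W"
proof (induction m arbitrary: x)
  case (Suc m)
  from Suc.prems show ?case by (rule filt_SucE) (simp add: Suc.IH)
qed simp

lemma filt_Suc: "filt m \<subseteq> filt (Suc m)"
proof
  fix x assume x: "x \<in> filt m"
  show "x \<in> filt (Suc m)"
    by (rule filt_SucI[OF _ x U.M.zero_closed]) (use filt_in[OF x] in simp)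
qed

lemma filt_mono: "m \<le> k \<Longrightarrow> filt m \<subseteq> filt k"
  using lift_Suc_mono_le[of filt m k] filt_Suc by blast

lemma filt_add: "x \<in> filt m \<Longrightarrow> y \<in> filt m \<Longrightarrow> x \<oplus>\<^bsub>W\<^esub> y \<in> filt m"
proof (induction m arbitrary: x y)
  case (Suc m)
  from Suc.prems obtain x' u y' v where "x = x' \<oplus>\<^bsub>W\<^esub> t u (f m)" "y = y' \<oplus>\<^bsub>W\<^esub> t v (f m)"
    and mem: "x' \<in> filt m" "y' \<in> filt m" "u \<in> carrier U" "v \<in> carrier U"
    by (elim filt_SucE)
  then have "x \<oplus>\<^bsub>W\<^esub> y = (x' \<oplus>\<^bsub>W\<^esub> y') \<oplus>\<^bsub>W\<^esub> t (u \<oplus>\<^bsub>U\<^esub> v) (f m)"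
    using filt_in[of x'] filt_in[of y'] by (simp add: pure_tensor_add_left W.M.a_ac)
  moreover have "x' \<oplus>\<^bsub>W\<^esub> y' \<in> filt m" using Suc.IH mem by blast
  moreover have "u \<oplus>\<^bsub>U\<^esub> v \<in> carrier U" using mem by simp
  ultimately show ?case by (rule filt_SucI)
qed simp

lemma filt_Union_add:
  assumes "x \<in> (\<Union>m. filt m)" "y \<in> (\<Union>m. filt m)"
  shows "x \<oplus>\<^bsub>W\<^esub> y \<in> (\<Union>m. filt m)"
proof -
  obtain m k where "x \<in> filt m" "y \<in> filt k" using assms by blast
  then have "x \<in> filt (max m k)" "y \<in> filt (max m k)"
    using filt_mono[of m "max m k"] filt_mono[of k "max m k"] by auto
  then show ?thesis using filt_add by blast
qed

lemma filt_pure: "u \<in> carrier U \<Longrightarrow> t u (f i) \<in> filt (Suc i)"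
proof -
  assume u: "u \<in> carrier U"
  have "\<zero>\<^bsub>W\<^esub> \<in> filt i" using filt_mono[of 0 i] by auto
  moreover have "t u (f i) = \<zero>\<^bsub>W\<^esub> \<oplus>\<^bsub>W\<^esub> t u (f i)" using u by simp
  ultimately show ?thesis using u by (intro filt_SucI)
qed

lemma filt_exhaust: "w \<in> carrier W \<Longrightarrow> w \<in> (\<Union>m. filt m)"
proof (induction rule: tensor_induct)
  case zero
  have "\<zero>\<^bsub>W\<^esub> \<in> filt 0" by simp
  then show ?case by blast
next
  case (pure u v)
  from V_space f pure(2) show ?case
  proof (induction rule: basis_induct)
    case zero
    have "t u \<zero>\<^bsub>V\<^esub> \<in> filt 0" using pure by simp
    then show ?case by blast
  next
    case (smult a i)
    then have "t u (a \<odot>\<^bsub>V\<^esub> f i) = t (a \<odot>\<^bsub>U\<^esub> u) (f i)"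
      using pure by (simp add: pure_tensor_smult_left pure_tensor_smult_right)
    moreover have "t (a \<odot>\<^bsub>U\<^esub> u) (f i) \<in> filt (Suc i)" using smult pure by (intro filt_pure) simp
    ultimately show ?case by (metis UN_I UNIV_I)
  next
    case (add v w)
    then show ?case using filt_Union_add pure by (simp only: pure_tensor_add_right)
  qed
next
  case (add w w')
  then show ?case using filt_Union_add by blast
qed

lemma mem_s [simp]: "s \<in> {1..n}" "Suc s \<in> {1..n}"
  using s n by auto

lemma lam_pow: "lam [^]\<^bsub>K\<^esub> (k :: nat) \<noteq> \<zero>\<^bsub>K\<^esub>"
  using lam by (induction k) (simp_all add: integral_iff)

lemma lower_pure:
  assumes u: "u \<in> carrier U"
  shows "foldr T (replicate k (Suc s)) (t u (f (i + k))) = t u (f i)"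
proof (induction k arbitrary: i)
  case (Suc k)
  have "foldr T (replicate k (Suc s)) (t u (f (Suc i + k))) = t u (f (Suc i))" by (rule Suc)
  then show ?case using u mem_s by (simp add: T_pure A_def down)
qed simp

lemma raise_pure:
  assumes u: "u \<in> carrier U"
  shows "foldr T (replicate k s) (t u (f i)) = (lam [^]\<^bsub>K\<^esub> k) \<odot>\<^bsub>W\<^esub> t u (f (i + k))"
proof (induction k)
  case (Suc k)
  then show ?case using u mem_s lam
    by (simp add: T_pure A_def up module_hom_smult[OF T] pure_tensor_smult_left W.smult_assoc1)
qed (use u in simp)

lemma filt_killed: "x \<in> filt m \<Longrightarrow> foldr T (replicate m (Suc s)) x = \<zero>\<^bsub>W\<^esub>"
proof (induction m arbitrary: x)
  case (Suc m)
  from Suc.prems obtain x' u where x: "x = x' \<oplus>\<^bsub>W\<^esub> t u (f m)" "x' \<in> filt m" "u \<in> carrier U"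
    by (rule filt_SucE)
  have hom: "foldr T (replicate m (Suc s)) \<in> module_hom K W W"
    using mem_s by (intro foldr_T_hom replicate_in_lists)
  have "foldr T (replicate m (Suc s)) x = t u (f 0)"
    using x Suc.IH[OF x(2)] lower_pure[OF x(3), of m 0] filt_in[OF x(2)]
    by (simp add: module_hom_add[OF hom])
  then show ?case using x(3) mem_s by (simp add: T_pure A_def down)
qed simp

text \<open>With the top index \<open>m\<close> of a nonzero component, lowering \<open>m\<close> times kills everything below and leaves that
  component at \<open>f\<^sub>0\<close>.\<close>
lemma reach_bottom:
  assumes "w \<in> filt m" "w \<noteq> \<zero>\<^bsub>W\<^esub>"
  shows "\<exists>k. \<exists>u\<in>carrier U. u \<noteq> \<zero>\<^bsub>U\<^esub> \<and> foldr T (replicate k (Suc s)) w = t u (f 0)"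
  using assms
proof (induction m arbitrary: w)
  case (Suc m)
  from Suc.prems(1) obtain x u where x: "w = x \<oplus>\<^bsub>W\<^esub> t u (f m)" "x \<in> filt m" "u \<in> carrier U"
    by (rule filt_SucE)
  show ?case
  proof (cases "u = \<zero>\<^bsub>U\<^esub>")
    case True
    then have "w = x" using x filt_in by simp
    then show ?thesis using Suc x by blast
  next
    case False
    have hom: "foldr T (replicate m (Suc s)) \<in> module_hom K W W"
      using mem_s by (intro foldr_T_hom replicate_in_lists)
    have "foldr T (replicate m (Suc s)) w = t u (f 0)"
      using x filt_killed[OF x(2)] lower_pure[OF x(3), of m 0] filt_in[OF x(2)]
      by (simp add: module_hom_add[OF hom])
    with False x show ?thesis by blast
  qed
qed simp

text \<open>Each letter moves the second factor by one step. Starting at height \<open>c\<close> not less than the length of the word, it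
  is still positive before each letter, so no letter annihilates the vector.\<close>
lemma word_pure:
  assumes u: "u \<in> carrier U" and "ws \<in> lists ({1..n} - {s, s + 1})" "length ws \<le> c"
  shows "foldr B ws u \<in> carrier U \<and>
    (\<exists>c'. c \<le> c' + length ws \<and> foldr T ws (t u (f c)) = t (foldr B ws u) (f c'))"
  using assms(2,3)
proof (induction ws rule: list.induct)
  case Nil
  then show ?case using u by auto
next
  case (Cons j ws)
  then obtain c' where c': "c \<le> c' + length ws" "foldr T ws (t u (f c)) = t (foldr B ws u) (f c')"
    and b: "foldr B ws u \<in> carrier U" by auto
  have j: "j \<in> {1..n}" "j \<noteq> s" "j \<noteq> s + 1" using Cons by auto
  then have Aj: "A j = B j" by (simp add: A_def)
  obtain d where d: "c' = Suc d" using c'(1) Cons.prems(2) by (cases c') auto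
  have "foldr T (j # ws) (t u (f c)) =
      t (foldr B (j # ws) u) (f (if j \<le> s then Suc c' else d))"
    using T_pure[OF j(1) b, of "f c'"] by (simp add: c' Aj up down d)
  moreover have "foldr B (j # ws) u \<in> carrier U" using A_in[OF j(1) b] by (simp add: Aj)
  moreover have "c \<le> (if j \<le> s then Suc c' else d) + length (j # ws)" using c'(1) d by auto
  ultimately show ?case by blast
qed

text \<open>From right to left, the word lowers to \<open>f\<^sub>0\<close>, raises high enough, performs the transition in \<open>U\<close>, returns to
  \<open>f\<^sub>0\<close> and climbs to \<open>f\<^sub>i\<close>. The scalar absorbs the powers of \<open>lam\<close> from the two climbs.\<close>
lemma reach:
  assumes x: "x \<in> carrier U"
    and U_reach: "\<And>u. u \<in> carrier U \<Longrightarrow> u \<noteq> \<zero>\<^bsub>U\<^esub> \<Longrightarrow>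
      \<exists>a\<in>carrier K. \<exists>ws\<in>lists ({1..n} - {s, s + 1}). a \<odot>\<^bsub>U\<^esub> foldr B ws u = x"
    and w: "w \<in> carrier W" "w \<noteq> \<zero>\<^bsub>W\<^esub>"
  shows "\<exists>a\<in>carrier K. \<exists>ws\<in>lists {1..n}. a \<odot>\<^bsub>W\<^esub> foldr T ws w = t x (f i)"
proof -
  obtain m where "w \<in> filt m" using filt_exhaust[OF w(1)] by (elim UN_E)
  from reach_bottom[OF this w(2)] obtain k u where u: "u \<in> carrier U" "u \<noteq> \<zero>\<^bsub>U\<^esub>"
    and k: "foldr T (replicate k (Suc s)) w = t u (f 0)"
    by (elim exE bexE conjE)
  obtain a ws where a: "a \<in> carrier K" and ws: "ws \<in> lists ({1..n} - {s, s + 1})"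
    and aws: "a \<odot>\<^bsub>U\<^esub> foldr B ws u = x"
    using U_reach[OF u] by (elim bexE)
  define c where "c = length ws"
  define y where "y = foldr B ws u"
  note wp = word_pure[OF u(1) ws order.refl]
  have y: "y \<in> carrier U" using conjunct1[OF wp] by (simp add: y_def)
  obtain c' where c': "foldr T ws (t u (f c)) = t y (f c')"
    using conjunct2[OF wp] unfolding c_def y_def by blast
  have "set ws \<subseteq> {1..n}" using ws unfolding lists_eq_set by blast
  then have ws': "ws \<in> lists {1..n}" unfolding lists_eq_set by simp
  define v where "v = replicate i s @ replicate c' (Suc s) @ ws @ replicate c s @ replicate k (Suc s)"
  have "set v \<subseteq> {1..n}"
    using \<open>set ws \<subseteq> {1..n}\<close> mem_s by (simp add: v_def set_replicate_conv_if)
  then have v: "v \<in> lists {1..n}" unfolding lists_eq_set by simp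
  have lc: "lam [^]\<^bsub>K\<^esub> c \<in> carrier K" "lam [^]\<^bsub>K\<^esub> i \<in> carrier K" using lam by auto
  define b where "b = lam [^]\<^bsub>K\<^esub> c \<otimes>\<^bsub>K\<^esub> lam [^]\<^bsub>K\<^esub> i"
  have b: "b \<in> carrier K" "b \<noteq> \<zero>\<^bsub>K\<^esub>"
    using lc lam_pow by (simp_all add: b_def integral_iff)
  have rep: "foldr T (replicate c' (Suc s)) \<in> module_hom K W W"
    "foldr T (replicate i s) \<in> module_hom K W W"
    by (rule foldr_T_hom, rule replicate_in_lists, rule mem_s)+
  let ?p = "\<lambda>u i. t u (f i)"
  have yi: "?p y j \<in> carrier W" for j using y by simp
  have 1: "foldr T (replicate c s) (?p u 0) = (lam [^]\<^bsub>K\<^esub> c) \<odot>\<^bsub>W\<^esub> ?p u c"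
    using raise_pure[OF u(1), of c 0] by simp
  have 2: "foldr T ws (foldr T (replicate c s) (?p u 0)) = (lam [^]\<^bsub>K\<^esub> c) \<odot>\<^bsub>W\<^esub> ?p y c'"
    unfolding 1 using module_hom_smult[OF foldr_T_hom[OF ws'] lc(1), of "?p u c"] u(1) c' by simp
  have 3: "foldr T (replicate c' (Suc s)) (foldr T ws (foldr T (replicate c s) (?p u 0))) =
      (lam [^]\<^bsub>K\<^esub> c) \<odot>\<^bsub>W\<^esub> ?p y 0"
    unfolding 2 using module_hom_smult[OF rep(1) lc(1) yi] lower_pure[OF y, of c' 0] by simp
  have "foldr T v w = (lam [^]\<^bsub>K\<^esub> c) \<odot>\<^bsub>W\<^esub> ((lam [^]\<^bsub>K\<^esub> i) \<odot>\<^bsub>W\<^esub> ?p y i)"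
    using module_hom_smult[OF rep(2) lc(1) yi] raise_pure[OF y, of i 0]
    by (simp add: v_def k 3)
  also have "\<dots> = b \<odot>\<^bsub>W\<^esub> ?p y i" using lc yi by (simp add: b_def W.smult_assoc1)
  finally have v_eq: "foldr T v w = b \<odot>\<^bsub>W\<^esub> ?p y i" .
  have "b \<in> Units K" using b by (simp add: field_Units)
  then have inv: "inv\<^bsub>K\<^esub> b \<in> carrier K" "inv\<^bsub>K\<^esub> b \<otimes>\<^bsub>K\<^esub> b = \<one>\<^bsub>K\<^esub>" by simp_all
  have ab: "a \<otimes>\<^bsub>K\<^esub> inv\<^bsub>K\<^esub> b \<in> carrier K" using a inv(1) by (rule U.m_closed)
  have "(a \<otimes>\<^bsub>K\<^esub> inv\<^bsub>K\<^esub> b) \<odot>\<^bsub>W\<^esub> foldr T v w = (a \<otimes>\<^bsub>K\<^esub> inv\<^bsub>K\<^esub> b \<otimes>\<^bsub>K\<^esub> b) \<odot>\<^bsub>W\<^esub> ?p y i"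
    unfolding v_eq using W.smult_assoc1[OF ab b(1) yi] by simp
  also have "a \<otimes>\<^bsub>K\<^esub> inv\<^bsub>K\<^esub> b \<otimes>\<^bsub>K\<^esub> b = a"
    using U.m_assoc[OF a inv(1) b(1)] inv(2) a by simp
  also have "a \<odot>\<^bsub>W\<^esub> ?p y i = ?p (a \<odot>\<^bsub>U\<^esub> y) i"
    using pure_tensor_smult_left[OF a y f_in] by simp
  also have "a \<odot>\<^bsub>U\<^esub> y = x" using aws by (simp add: y_def)
  finally show ?thesis using v ab by (intro bexI)
qed

lemma monoid_alg: "monoid_alg K (chinese_monoid n)"
  by (intro monoid_alg.intro U.is_cring chinese_monoid_is_monoid)

text \<open>Words act through \<open>T\<close>, well defined on classes by \<open>T_rels\<close>.\<close>
lemma module_exists: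
  "\<exists>\<sigma>. left_module (monoid_algebra K (chinese_monoid n)) (with_smult W \<sigma>) \<and>
    (\<forall>a\<in>carrier K. \<forall>u\<in>lists {1..n}. \<forall>w\<in>carrier W.
      \<sigma> (monomial K a (chinese_class n u)) w = a \<odot>\<^bsub>W\<^esub> foldr T u w)"
proof -
  interpret MA: monoid_alg K "chinese_monoid n" by (rule monoid_alg)
  have "\<exists>\<rho>. \<forall>u\<in>lists {1..n}. \<forall>w\<in>carrier W. \<rho> (chinese_class n u) w = foldr T u w"
    unfolding chinese_class_def
    by (rule presented_monoid_action) (erule (1) T_in, erule chinese_rels_lists, erule (1) T_rels)
  then obtain \<rho> where \<rho>: "\<And>u w. u \<in> lists {1..n} \<Longrightarrow> w \<in> carrier W \<Longrightarrow> \<rho> (chinese_class n u) w = foldr T u w"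
    by metis
  have hom: "\<rho> m \<in> module_hom K W W" if "m \<in> carrier (chinese_monoid n)" for m
  proof -
    from that obtain u where u: "u \<in> lists {1..n}" "m = chinese_class n u"
      unfolding chinese_monoid_carrier by (elim imageE)
    show ?thesis
      by (rule module_hom_cong[OF foldr_T_hom[OF u(1)] _ W.module_axioms]) (simp only: u(2) \<rho>[OF u(1)])
  qed
  have one: "\<rho> \<one>\<^bsub>chinese_monoid n\<^esub> w = w" if "w \<in> carrier W" for w
    using \<rho>[of "[]" w] that by (simp add: chinese_monoid_one)
  have mult: "\<rho> (m \<otimes>\<^bsub>chinese_monoid n\<^esub> m') w = \<rho> m (\<rho> m' w)"
    if m: "m \<in> carrier (chinese_monoid n)" "m' \<in> carrier (chinese_monoid n)" and w: "w \<in> carrier W" for m m' w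
  proof -
    from m obtain u v where uv: "u \<in> lists {1..n}" "m = chinese_class n u"
      "v \<in> lists {1..n}" "m' = chinese_class n v"
      unfolding chinese_monoid_carrier by (elim imageE)
    then have "u @ v \<in> lists {1..n}" by simp
    with uv w show ?thesis
      using module_hom_in[OF foldr_T_hom[OF uv(3)] w] by (simp add: chinese_monoid_mult \<rho>)
  qed
  obtain \<sigma> where \<sigma>: "left_module (monoid_algebra K (chinese_monoid n)) (with_smult W \<sigma>)"
    "\<forall>a\<in>carrier K. \<forall>m\<in>carrier (chinese_monoid n). \<forall>z\<in>carrier W. \<sigma> (monomial K a m) z = a \<odot>\<^bsub>W\<^esub> \<rho> m z"
    using MA.representation_extends[OF W.module_axioms hom one mult] by blast
  moreover have "\<sigma> (monomial K a (chinese_class n u)) w = a \<odot>\<^bsub>W\<^esub> foldr T u w"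
    if "a \<in> carrier K" "u \<in> lists {1..n}" "w \<in> carrier W" for a u w
    using \<sigma>(2) that \<rho> by (simp add: chinese_monoid_carrier)
  ultimately show ?thesis by blast
qed

text \<open>The action of a generator is linear, so it agrees with \<open>T\<close> once it does so on the basis. Then words and
  their multiples act as prescribed.\<close>
lemma module_determined:
  assumes e: "basis_family K U I e"
    and \<sigma>: "left_module (monoid_algebra K (chinese_monoid n)) (with_smult W \<sigma>)"
    and scalar: "\<And>a w. a \<in> carrier K \<Longrightarrow> w \<in> carrier W \<Longrightarrow>
      \<sigma> (monomial K a \<one>\<^bsub>chinese_monoid n\<^esub>) w = a \<odot>\<^bsub>W\<^esub> w"
    and gen: "\<And>j x i. j \<in> {1..n} \<Longrightarrow> x \<in> I \<Longrightarrow>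
      \<sigma> (gen_elem K n j) (t (e x) (f i)) = T j (t (e x) (f i))"
    and a: "a \<in> carrier K" and u: "u \<in> lists {1..n}" and w: "w \<in> carrier W"
  shows "\<sigma> (monomial K a (chinese_class n u)) w = a \<odot>\<^bsub>W\<^esub> foldr T u w"
proof -
  interpret MA: monoid_alg K "chinese_monoid n" by (rule monoid_alg)
  interpret \<sigma>: left_module "monoid_algebra K (chinese_monoid n)" "with_smult W \<sigma>" by fact
  have basis: "basis_family K W (I \<times> UNIV) (\<lambda>(i, j). t (e i) (f j))"
    by (rule tensor_basis[OF field_axioms U.module_axioms V.module_axioms e f])
  have space: "vectorspace K W"
    by (simp add: vectorspace_def W.module_axioms field_axioms)
  have gen_in: "chinese_gen n j \<in> carrier (chinese_monoid n)" if "j \<in> {1..n}" for j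
    using that by (auto simp: chinese_gen_eq chinese_monoid_carrier)
  have smult_in: "\<sigma> x w \<in> carrier W" if "x \<in> carrier MA.A" "w \<in> carrier W" for x w
    using \<sigma>.smult_closed[of x w] that by simp
  have gen_hom: "(\<lambda>w. \<sigma> (gen_elem K n j) w) \<in> module_hom K W W" if j: "j \<in> {1..n}" for j
  proof -
    have US: "underlying_space K (chinese_monoid n) (with_smult W \<sigma>) =
        with_smult W (\<lambda>a w. \<sigma> (monomial K a \<one>\<^bsub>chinese_monoid n\<^esub>) w)"
      by (simp add: underlying_space_def with_smult_def)
    have h: "(\<lambda>w. \<sigma> (gen_elem K n j) w) \<in>
        module_hom K (with_smult W (\<lambda>a w. \<sigma> (monomial K a \<one>\<^bsub>chinese_monoid n\<^esub>) w))
          (with_smult W (\<lambda>a w. \<sigma> (monomial K a \<one>\<^bsub>chinese_monoid n\<^esub>) w))"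
      using MA.underlying_space_hom[OF \<sigma> gen_in[OF j]] by (simp add: US gen_elem_def)
    show ?thesis
    proof (rule module_homI)
      fix x assume x: "x \<in> carrier W"
      then show 1: "\<sigma> (gen_elem K n j) x \<in> carrier W" using module_hom_in[OF h, of x] by simp
      fix a assume a: "a \<in> carrier K"
      then show "\<sigma> (gen_elem K n j) (a \<odot>\<^bsub>W\<^esub> x) = a \<odot>\<^bsub>W\<^esub> \<sigma> (gen_elem K n j) x"
        using module_hom_smult[OF h a, of x] x scalar[OF a x] scalar[OF a 1] by simp
    next
      fix x y assume "x \<in> carrier W" "y \<in> carrier W"
      then show "\<sigma> (gen_elem K n j) (x \<oplus>\<^bsub>W\<^esub> y) = \<sigma> (gen_elem K n j) x \<oplus>\<^bsub>W\<^esub> \<sigma> (gen_elem K n j) y"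
        using module_hom_add[OF h, of x y] by simp
    qed
  qed
  have gen_T: "\<sigma> (gen_elem K n j) w = T j w" if j: "j \<in> {1..n}" and w: "w \<in> carrier W" for j w
    by (rule basis_hom_eqI[OF space basis W.module_axioms gen_hom[OF j] T[OF j] _ w])
      (use gen[OF j] in auto)
  have words: "set u \<subseteq> {1..n} \<Longrightarrow> foldr (\<lambda>j w. \<sigma> (gen_elem K n j) w) u w = foldr T u w" for u
  proof (induction u)
    case (Cons j u)
    then have "u \<in> lists {1..n}" by (auto simp: lists_eq_set)
    from module_hom_in[OF foldr_T_hom[OF this] w] Cons show ?case by (simp add: gen_T)
  qed simp
  have u': "set u \<subseteq> {1..n}" using u by (auto simp: lists_eq_set)
  have uc: "chinese_class n u \<in> carrier (chinese_monoid n)" using u by (simp add: chinese_monoid_carrier)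
  have wc: "w \<in> carrier (with_smult W \<sigma>)" using w by simp
  have 1: "\<sigma> (monomial K \<one>\<^bsub>K\<^esub> (chinese_class n u)) w = foldr T u w"
    using chinese_word_smult[OF monoid_alg \<sigma> subset_refl chinese_monoid_carrier _ _ u' wc] words[OF u'] by simp
  show ?thesis
    using MA.monomial_smult[OF \<sigma> a uc wc] scalar[OF a module_hom_in[OF foldr_T_hom[OF u] w]]
    by (simp add: 1)
qed

end

section \<open>The module over the Chinese algebra\<close>

theorem proposition3p3:
  fixes K :: "('a, 'b) ring_scheme"
    and s n :: nat
    and U :: "(nat list set \<Rightarrow> 'a, 'u, 'c) module_scheme"
    and V :: "('a, 'v, 'd) module_scheme"
    and e :: "nat list \<Rightarrow> 'u"
    and f :: "nat \<Rightarrow> 'v"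
    and lam :: 'a
  assumes "algebraically_closed K" and "uncountable (carrier K)"
    and "s \<ge> 1" and "n = 2 * s"
    and "left_module (monoid_algebra K (chinese_submonoid n s)) U"
    and "basis_family K (underlying_space K (chinese_submonoid n s) U) {I. length I = s - 1} e"
    and "\<forall>i j. (i \<in> {1..<s} \<and> j \<in> {1..<s}) \<or> (i \<in> {s+2..n} \<and> j \<in> {s+2..n}) \<longrightarrow>
      (let A = monoid_algebra K (chinese_submonoid n s); a = gen_elem K n in
        \<forall>u\<in>carrier U. (a i \<otimes>\<^bsub>A\<^esub> a j \<ominus>\<^bsub>A\<^esub> a j \<otimes>\<^bsub>A\<^esub> a i) \<odot>\<^bsub>U\<^esub> u = \<zero>\<^bsub>U\<^esub>)"
    and "\<forall>u\<in>carrier U. u \<noteq> \<zero>\<^bsub>U\<^esub> \<longrightarrow> (\<forall>I. length I = s - 1 \<longrightarrow>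
      (\<exists>x\<in>scalar_multiples K (chinese_submonoid n s). x \<odot>\<^bsub>U\<^esub> u = e I))"
    and "vectorspace K V" and "basis_family K V UNIV f"
    and "lam \<in> carrier K" and "lam \<noteq> \<zero>\<^bsub>K\<^esub>"
  shows
    "let A = monoid_algebra K (chinese_monoid n);
         a = gen_elem K n;
         U\<^sub>K = underlying_space K (chinese_submonoid n s) U;
         E = (\<lambda>(I, i). pure_tensor K U\<^sub>K V (e I) (f i))
     in
      basis_family K (tensor_product K U\<^sub>K V) ({I. length I = s - 1} \<times> UNIV) E \<and>
      (\<exists>\<sigma>. chinese_tensor_action K n s U V e f lam \<sigma>) \<and>
      (\<forall>\<sigma>. chinese_tensor_action K n s U V e f lam \<sigma> \<longrightarrow>
        (let W = with_smult (tensor_product K U\<^sub>K V) \<sigma> in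
          left_module A W \<and>
          (\<forall>i j. (i \<in> {1..s} \<and> j \<in> {1..s}) \<or> (i \<in> {s+1..n} \<and> j \<in> {s+1..n}) \<longrightarrow>
            (\<forall>w\<in>carrier W. (a i \<otimes>\<^bsub>A\<^esub> a j \<ominus>\<^bsub>A\<^esub> a j \<otimes>\<^bsub>A\<^esub> a i) \<odot>\<^bsub>W\<^esub> w = \<zero>\<^bsub>W\<^esub>)) \<and>
          (\<forall>w\<in>carrier W. w \<noteq> \<zero>\<^bsub>W\<^esub> \<longrightarrow> (\<forall>I i. length I = s - 1 \<longrightarrow>
            (\<exists>x\<in>scalar_multiples K (chinese_monoid n). x \<odot>\<^bsub>W\<^esub> w = E (I, i)))) \<and>
          simple_left_module A W))"
proof -
  let ?SM = "chinese_submonoid n s" and ?CM = "chinese_monoid n"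
  define UK where "UK = underlying_space K ?SM U"
  define G where "G = {1..n} - {s, s + 1}"
  interpret field K by (rule algebraically_closed.axioms(1)[OF assms(1)])
  have SM: "monoid_alg K ?SM"
    by (intro monoid_alg.intro is_cring chinese_submonoid_is_monoid)
  interpret SM: monoid_alg K ?SM by (rule SM)
  interpret U: left_module "monoid_algebra K ?SM" U by (rule assms(5))
  have UK: "module K UK" unfolding UK_def by (rule SM.underlying_space_module[OF assms(5)])
  interpret UK: module K UK by (rule UK)
  interpret V: vectorspace K V by (rule assms(9))
  have UK_simps: "carrier UK = carrier U" "\<zero>\<^bsub>UK\<^esub> = \<zero>\<^bsub>U\<^esub>"
    "\<And>a u. a \<odot>\<^bsub>UK\<^esub> u = monomial K a \<one>\<^bsub>?SM\<^esub> \<odot>\<^bsub>U\<^esub> u"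
    by (simp_all add: UK_def underlying_space_def)
  have e: "basis_family K UK {I. length I = s - 1} e"
    using assms(6) by (simp add: UK_def)
  have f: "basis_family K V UNIV f" by (rule assms(10))
  have f_in: "f i \<in> carrier V" for i using f by (auto simp: V.basis_family_iff)
  have UK_space: "vectorspace K UK" by (simp add: vectorspace_def UK field_axioms)
  have e_in: "e I \<in> carrier UK" if "length I = s - 1" for I
    using e that by (auto simp: vectorspace.basis_family_iff[OF UK_space])

  define B where "B = (\<lambda>j u. gen_elem K n j \<odot>\<^bsub>U\<^esub> u)"
  have G_sub: "G \<subseteq> {1..n}" by (auto simp: G_def)
  have SM_carrier: "carrier ?SM = chinese_class n ` lists G"
    unfolding G_def by (rule chinese_submonoid_carrier)
  have gen_in: "chinese_gen n j \<in> carrier ?SM" if "j \<in> G" for j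
    using that by (auto simp: chinese_gen_eq SM_carrier)
  have gen_elem_in: "gen_elem K n j \<in> carrier (monoid_algebra K ?SM)" if "j \<in> G" for j
    unfolding gen_elem_def by (rule SM.monomial_carrier[OF one_closed gen_in[OF that]])
  have B_hom: "B j \<in> module_hom K UK UK" if "j \<in> G" for j
    using SM.underlying_space_hom[OF assms(5) gen_in[OF that]]
    unfolding B_def UK_def gen_elem_def .
  have B_word: "monomial K \<one>\<^bsub>K\<^esub> (chinese_class n ws) \<odot>\<^bsub>U\<^esub> u = foldr B ws u"
    if "ws \<in> lists G" "u \<in> carrier U" for ws u
    unfolding B_def
    using that by (intro chinese_word_smult[OF SM assms(5) G_sub SM_carrier chinese_submonoid_simps])
      (auto simp: lists_eq_set)
  have B_rels: "foldr B u z = foldr B v z"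
    if "(u, v) \<in> chinese_rels n" "u \<in> lists G" "v \<in> lists G" "z \<in> carrier UK" for u v z
    using B_word[OF that(2), of z] B_word[OF that(3), of z] that(4) chinese_class_eqI[OF that(1)]
    by (simp add: UK_simps)
  \<comment> \<open>On vectors, annihilation by the commutators is commutation of the operators.\<close>
  have B_comm: "B i (B j z) = B j (B i z)"
    if ij: "(i \<in> {1..<s} \<and> j \<in> {1..<s}) \<or> (i \<in> {s+2..n} \<and> j \<in> {s+2..n})"
      and z: "z \<in> carrier UK" for i j z
  proof -
    have "i \<in> G" "j \<in> G" using ij assms(4) by (auto simp: G_def)
    from U.commutator_smult_iff[OF gen_elem_in[OF this(1)] gen_elem_in[OF this(2)], of z]
    show ?thesis using assms(7) ij z unfolding B_def Let_def UK_simps by blast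
  qed

  obtain up where up: "up \<in> module_hom K V V" "\<And>i. up (f i) = f (Suc i)"
    using basis_extension[OF assms(9) f V.module_axioms, of "\<lambda>i. f (Suc i)"] f_in by auto
  have "(\<lambda>i. case i of 0 \<Rightarrow> \<zero>\<^bsub>V\<^esub> | Suc j \<Rightarrow> f j) \<in> UNIV \<rightarrow> carrier V"
    using f_in by (auto split: nat.splits)
  from basis_extension[OF assms(9) f V.module_axioms this]
  obtain down where down: "down \<in> module_hom K V V"
    "\<And>i. down (f i) = (case i of 0 \<Rightarrow> \<zero>\<^bsub>V\<^esub> | Suc j \<Rightarrow> f j)"
    by (elim bexE) blast

  have down_f: "down (f 0) = \<zero>\<^bsub>V\<^esub>" "down (f (Suc i)) = f i" for i
    by (simp_all add: down(2))

  define A where "A = (\<lambda>j z. if j = s then lam \<odot>\<^bsub>UK\<^esub> z else if j = s + 1 then z else B j z)"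
  have A_hom: "A j \<in> module_hom K UK UK" if "j \<in> {1..n}" for j
    using B_hom[of j] that module_hom_smult_const[OF UK assms(11)] module_hom_id[of K UK]
    by (cases "j = s"; cases "j = s + 1") (simp_all add: A_def G_def)
  interpret tensor K UK V by (intro tensor.intro UK V.module_axioms)
  have "\<forall>j\<in>{1..n}. \<exists>h. h \<in> module_hom K W W \<and> (\<forall>u\<in>carrier UK. \<forall>v\<in>carrier V.
      h (t u v) = t (A j u) (if j \<le> s then up v else down v))"
  proof
    fix j assume j: "j \<in> {1..n}"
    have "(\<lambda>v. if j \<le> s then up v else down v) \<in> module_hom K V V"
      using up(1) down(1) by (cases "j \<le> s") simp_all
    from tensor_map[OF A_hom[OF j] this]
    show "\<exists>h. h \<in> module_hom K W W \<and> (\<forall>u\<in>carrier UK. \<forall>v\<in>carrier V.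
      h (t u v) = t (A j u) (if j \<le> s then up v else down v))" by (elim bexE) (intro exI conjI)
  qed
  from bchoice[OF this] obtain T where T0: "\<forall>j\<in>{1..n}. T j \<in> module_hom K W W \<and>
      (\<forall>u\<in>carrier UK. \<forall>v\<in>carrier V. T j (t u v) = t (A j u) (if j \<le> s then up v else down v))"
    by (elim exE)
  have T: "T j \<in> module_hom K W W" if "j \<in> {1..n}" for j using T0 that by blast
  have T_pure: "T j (t u v) = t (A j u) (if j \<le> s then up v else down v)"
    if "j \<in> {1..n}" "u \<in> carrier UK" "v \<in> carrier V" for j u v using T0 that by blast
  interpret CT: chinese_tensor K UK V s n f lam B A up down T
    by (intro chinese_tensor.intro chinese_tensor_axioms.intro;
      fact tensor_axioms field_axioms assms(3,4,11,12) f B_hom[unfolded G_def] B_rels[unfolded G_def]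
        B_comm A_def up down(1) down_f T T_pure)

  \<comment> \<open>The operators \<open>T j\<close> act on the basis by exactly the prescribed formulas.\<close>
  have T_basis: "T j (t (e I) (f i)) =
      (if j < s then t (gen_elem K n j \<odot>\<^bsub>U\<^esub> e I) (f (i + 1))
       else if j = s then lam \<odot>\<^bsub>W\<^esub> t (e I) (f (i + 1))
       else if j = s + 1 \<and> i > 0 then t (e I) (f (i - 1))
       else if j > s + 1 \<and> i > 0 then t (gen_elem K n j \<odot>\<^bsub>U\<^esub> e I) (f (i - 1))
       else \<zero>\<^bsub>W\<^esub>)"
    if I: "length I = s - 1" and j: "j \<in> {1..n}" for I i j
  proof -
    have Aj: "A j (e I) \<in> carrier UK" using CT.A_in[OF j e_in[OF I]] .
    consider "j < s" | "j = s" | "j = s + 1" | "j > s + 1" by linarith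
    then show ?thesis
    proof cases
      case 1
      then show ?thesis using T_pure[OF j e_in[OF I] f_in] by (simp add: up A_def B_def)
    next
      case 2
      then show ?thesis using T_pure[OF j e_in[OF I] f_in] pure_tensor_smult_left[OF assms(11) e_in[OF I] f_in]
        by (simp add: up A_def)
    next
      case 3
      then show ?thesis using T_pure[OF j e_in[OF I] f_in] e_in[OF I]
        by (cases i) (simp_all add: down A_def)
    next
      case 4
      then show ?thesis using T_pure[OF j e_in[OF I] f_in] Aj
        by (cases i) (simp_all add: down A_def B_def)
    qed
  qed
  \<comment> \<open>The defining property of the action thus says that the generators act on the basis as the \<open>T j\<close>.\<close>
  have action_iff: "chinese_tensor_action K n s U V e f lam \<sigma> \<longleftrightarrow>
      left_module (monoid_algebra K ?CM) (with_smult W \<sigma>) \<and>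
      (\<forall>a\<in>carrier K. \<forall>w\<in>carrier W. \<sigma> (monomial K a \<one>\<^bsub>?CM\<^esub>) w = a \<odot>\<^bsub>W\<^esub> w) \<and>
      (\<forall>I i. length I = s - 1 \<longrightarrow> (\<forall>j\<in>{1..n}.
        \<sigma> (gen_elem K n j) (t (e I) (f i)) = T j (t (e I) (f i))))" for \<sigma>
    unfolding chinese_tensor_action_def Let_def UK_def[symmetric]
    by (simp add: T_basis cong: conj_cong)
  have basis: "basis_family K W ({I. length I = s - 1} \<times> UNIV) (\<lambda>(I, i). t (e I) (f i))"
    by (rule tensor_basis[OF field_axioms UK V.module_axioms e f])
  have W_space: "vectorspace K W" by (simp add: vectorspace_def W.module_axioms field_axioms)
  interpret CM: monoid_alg K ?CM by (rule CT.monoid_alg)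

  have exists: "\<exists>\<sigma>. chinese_tensor_action K n s U V e f lam \<sigma>"
  proof -
    obtain \<sigma> where \<sigma>: "left_module (monoid_algebra K ?CM) (with_smult W \<sigma>)"
      and words: "\<And>a u w. a \<in> carrier K \<Longrightarrow> u \<in> lists {1..n} \<Longrightarrow> w \<in> carrier W \<Longrightarrow>
        \<sigma> (monomial K a (chinese_class n u)) w = a \<odot>\<^bsub>W\<^esub> foldr T u w"
      using CT.module_exists by (elim exE conjE) simp
    have "\<sigma> (monomial K a \<one>\<^bsub>?CM\<^esub>) w = a \<odot>\<^bsub>W\<^esub> w" if "a \<in> carrier K" "w \<in> carrier W" for a w
      using words[OF that(1) lists.Nil that(2)] by (simp add: chinese_monoid_one)
    moreover have "\<sigma> (gen_elem K n j) w = T j w" if j: "j \<in> {1..n}" and w: "w \<in> carrier W" for j w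
    proof -
      have "[j] \<in> lists {1..n}" using j by simp
      from words[OF one_closed this w] show ?thesis
        using CT.T_in[OF j w] by (simp add: gen_elem_def chinese_gen_eq)
    qed
    ultimately have "chinese_tensor_action K n s U V e f lam \<sigma>"
      unfolding action_iff using \<sigma> e_in f_in by simp
    then show ?thesis by blast
  qed

  have properties: "left_module (monoid_algebra K ?CM) (with_smult W \<sigma>) \<and>
      (\<forall>i j. (i \<in> {1..s} \<and> j \<in> {1..s}) \<or> (i \<in> {s+1..n} \<and> j \<in> {s+1..n}) \<longrightarrow>
        (\<forall>w\<in>carrier (with_smult W \<sigma>).
          (gen_elem K n i \<otimes>\<^bsub>CM.A\<^esub> gen_elem K n j \<ominus>\<^bsub>CM.A\<^esub> gen_elem K n j \<otimes>\<^bsub>CM.A\<^esub> gen_elem K n i)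
            \<odot>\<^bsub>with_smult W \<sigma>\<^esub> w = \<zero>\<^bsub>with_smult W \<sigma>\<^esub>)) \<and>
      (\<forall>w\<in>carrier (with_smult W \<sigma>). w \<noteq> \<zero>\<^bsub>with_smult W \<sigma>\<^esub> \<longrightarrow> (\<forall>I i. length I = s - 1 \<longrightarrow>
        (\<exists>x\<in>scalar_multiples K ?CM. x \<odot>\<^bsub>with_smult W \<sigma>\<^esub> w = t (e I) (f i)))) \<and>
      simple_left_module (monoid_algebra K ?CM) (with_smult W \<sigma>)"
    if "chinese_tensor_action K n s U V e f lam \<sigma>" for \<sigma>
  proof -
    from that have \<sigma>: "left_module (monoid_algebra K ?CM) (with_smult W \<sigma>)"
      and scalar: "\<And>a w. a \<in> carrier K \<Longrightarrow> w \<in> carrier W \<Longrightarrow> \<sigma> (monomial K a \<one>\<^bsub>?CM\<^esub>) w = a \<odot>\<^bsub>W\<^esub> w"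
      and gen: "\<And>j I i. j \<in> {1..n} \<Longrightarrow> I \<in> {I. length I = s - 1} \<Longrightarrow>
        \<sigma> (gen_elem K n j) (t (e I) (f i)) = T j (t (e I) (f i))"
      unfolding action_iff by simp_all
    interpret \<sigma>: left_module "monoid_algebra K ?CM" "with_smult W \<sigma>" by (rule \<sigma>)
    note words = CT.module_determined[OF e \<sigma> scalar gen]
    have gen_T: "\<sigma> (gen_elem K n j) w = T j w" if j: "j \<in> {1..n}" and w: "w \<in> carrier W" for j w
    proof -
      have "[j] \<in> lists {1..n}" using j by simp
      from words[OF _ _ _ _ one_closed this w] show ?thesis
        using CT.T_in[OF j w] by (simp add: gen_elem_def chinese_gen_eq)
    qed
    have gen_C: "gen_elem K n j \<in> carrier CM.A" if "j \<in> {1..n}" for j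
      unfolding gen_elem_def
      by (rule CM.monomial_carrier) (use that in \<open>auto simp: chinese_gen_eq chinese_monoid_carrier\<close>)
    have commute: "(gen_elem K n i \<otimes>\<^bsub>CM.A\<^esub> gen_elem K n j \<ominus>\<^bsub>CM.A\<^esub> gen_elem K n j \<otimes>\<^bsub>CM.A\<^esub> gen_elem K n i)
            \<odot>\<^bsub>with_smult W \<sigma>\<^esub> w = \<zero>\<^bsub>with_smult W \<sigma>\<^esub>"
      if ij: "(i \<in> {1..s} \<and> j \<in> {1..s}) \<or> (i \<in> {s+1..n} \<and> j \<in> {s+1..n})"
        and w: "w \<in> carrier (with_smult W \<sigma>)" for i j w
    proof -
      have mem: "i \<in> {1..n}" "j \<in> {1..n}" using ij assms(4) by auto
      have w': "w \<in> carrier W" using w by simp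
      show ?thesis
        using CT.T_comm[OF ij w']
        by (intro iffD2[OF \<sigma>.commutator_smult_iff[OF gen_C[OF mem(1)] gen_C[OF mem(2)] w]])
          (simp only: with_smult_simps gen_T mem w' CT.T_in)
    qed
    have reach: "\<exists>x\<in>scalar_multiples K ?CM. \<sigma> x w = t (e I) (f i)"
      if w: "w \<in> carrier W" "w \<noteq> \<zero>\<^bsub>W\<^esub>" and I: "length I = s - 1" for w I i
    proof -
      have "\<exists>a\<in>carrier K. \<exists>ws\<in>lists {1..n}. a \<odot>\<^bsub>W\<^esub> foldr T ws w = t (e I) (f i)"
      proof (rule CT.reach[OF e_in[OF I] _ w])
        fix u assume u: "u \<in> carrier UK" "u \<noteq> \<zero>\<^bsub>UK\<^esub>"
        then have uU: "u \<in> carrier U" "u \<noteq> \<zero>\<^bsub>U\<^esub>" by (simp_all add: UK_simps)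
        obtain x where x: "x \<in> scalar_multiples K ?SM" "x \<odot>\<^bsub>U\<^esub> u = e I"
          using assms(8) uU I by blast
        then obtain a ws where a: "x = monomial K a (chinese_class n ws)" "a \<in> carrier K" "ws \<in> lists G"
          unfolding scalar_multiples_def SM_carrier by blast
        have "chinese_class n ws \<in> carrier ?SM" using a(3) by (simp add: SM_carrier)
        from SM.monomial_smult[OF assms(5) a(2) this uU(1)]
        have "a \<odot>\<^bsub>UK\<^esub> foldr B ws u = e I"
          using x(2) B_word[OF a(3) uU(1)] by (simp add: UK_simps a(1))
        with a show "\<exists>a\<in>carrier K. \<exists>ws\<in>lists ({1..n} - {s, s + 1}). a \<odot>\<^bsub>UK\<^esub> foldr B ws u = e I"
          unfolding G_def by blast
      qed
      then obtain a ws where a: "a \<in> carrier K" "ws \<in> lists {1..n}"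
        "a \<odot>\<^bsub>W\<^esub> foldr T ws w = t (e I) (f i)" by (elim bexE)
      have "monomial K a (chinese_class n ws) \<in> scalar_multiples K ?CM"
        unfolding scalar_multiples_def chinese_monoid_carrier using a by blast
      moreover have "\<sigma> (monomial K a (chinese_class n ws)) w = t (e I) (f i)"
        using words[OF _ _ _ _ a(1,2) w(1)] a(3) by simp
      ultimately show ?thesis by blast
    qed
    have simple: "simple_left_module (monoid_algebra K ?CM) (with_smult W \<sigma>)"
    proof (rule CM.simple_if_reaches_basis[OF W_space \<sigma> scalar basis])
      \<comment> \<open>For \<open>s = 1\<close> the only index is the empty list.\<close>
      have "replicate (s - 1) (0::nat) \<in> {I. length I = s - 1}" by simp
      then show "{I :: nat list. length I = s - 1} \<times> (UNIV :: nat set) \<noteq> {}" by blast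
      fix w p assume w: "w \<in> carrier W" "w \<noteq> \<zero>\<^bsub>W\<^esub>" and "p \<in> {I :: nat list. length I = s - 1} \<times> (UNIV :: nat set)"
      then obtain I i where p: "p = (I, i)" "length I = s - 1" by auto
      obtain x where x: "x \<in> scalar_multiples K ?CM" "\<sigma> x w = t (e I) (f i)"
        using reach[OF w p(2)] by blast
      have "x \<in> carrier CM.A"
        using x(1) CM.monomial_carrier unfolding scalar_multiples_def by blast
      with x p show "\<exists>x\<in>carrier CM.A. \<sigma> x w = (case p of (I, i) \<Rightarrow> t (e I) (f i))" by auto
    qed
    show ?thesis
      using \<sigma> commute reach simple by simp
  qed
  show ?thesis
    unfolding Let_def UK_def[symmetric] prod.case
    using basis exists properties by blast
qed

end
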